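(* Let $\zeta$ be the Riemann zeta function, let $\rho$ run over all its zeros and its pole, with multiplicities $n_\rho$ (positive for zeros, $n_1=-1$ for the pole). As distributions on $\mathbb{R}$, $$\sum_\rho n_\rho e^{(\rho-1/2)|t|}=2c_0(\zeta,1/2)\,\delta_0-\sum_{p,\,k\ge1}(\log p)\,p^{-k/2}\big(\delta_{k\log p}+\delta_{-k\log p}\big),$$ where $p$ runs over the prime numbers and $k$ over the positive integers.
   Context: The sum on the left is understood in the following distributional sense. The zeta function has convergence exponent $d=2$. With $\sigma=1/2$ (which is not in the divisor), $\mathbf{1}_{\mathbb{R}_+}$ the indicator of $[0,\infty)$ and $D/Dt$ the distributional derivative, $$K_2(t)=\sum_\rho\frac{n_\rho}{(\rho-\sigma)^2}e^{(\rho-\sigma)t}\,\mathbf{1}_{\mathbb{R}_+},\qquad W(t)=W(\zeta,\sigma)=e^{\sigma t}\frac{D^2}{Dt^2}\big((K_2(t)-K_2(0))\mathbf{1}_{\mathbb{R}_+}\big),$$ and $\sum_\rho n_\rho e^{(\rho-1/2)|t|}:=e^{-t/2}W(t)+e^{t/2}W(-t)$, where $W(-t)$ is the image of $W$ under $t\mapsto-t$. The discrepancy of $\zeta$ relative to $\sigma$ is $G(s)-\zeta'(s)/\zeta(s)$, where $G(s)=\sum_\rho n_\rho\frac{s-\sigma}{\rho-\sigma}\frac1{s-\rho}$; it is a constant, denoted $c_0(\zeta,\sigma)$. *)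

theory Defs
  imports "HOL-Complex_Analysis.Complex_Analysis"
begin

section \<open>The Riemann zeta function\<close>

text \<open>The analytic continuation of the Dirichlet series to the plane punctured at \<open>1\<close>. The value
  at \<open>1\<close> is a convention that only serves to make the function unique; divisor and
  multiplicities are computed from the germ on the punctured neighbourhood.\<close>

definition riemann_zeta :: "complex \<Rightarrow> complex" where
  "riemann_zeta = (THE f. f holomorphic_on - {1} \<and> f 1 = 0 \<and>
     (\<forall>s. Re s > 1 \<longrightarrow> f s = (\<Sum>n. of_nat (Suc n) powr (- s))))"

section \<open>Zeros and poles\<close>

text \<open>The multiplicity \<open>n\<^sub>\<rho>\<close> is the library's \<open>zorder\<close>, negative at poles.\<close>

definition divisor :: "(complex \<Rightarrow> complex) \<Rightarrow> complex set" where
  "divisor f = {\<rho>. isolated_zero f \<rho> \<or> is_pole f \<rho>}"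

definition G_fun :: "(complex \<Rightarrow> complex) \<Rightarrow> complex \<Rightarrow> complex \<Rightarrow> complex" where
  "G_fun f \<sigma> s =
     (\<Sum>\<^sub>\<infinity>\<rho>\<in>divisor f. of_int (zorder f \<rho>) * ((s - \<sigma>) / (\<rho> - \<sigma>)) * (1 / (s - \<rho>)))"

definition discrepancy_const :: "(complex \<Rightarrow> complex) \<Rightarrow> complex \<Rightarrow> complex" where
  "discrepancy_const f \<sigma> =
     (THE c. \<forall>s. s \<notin> divisor f \<longrightarrow> G_fun f \<sigma> s - deriv f s / f s = c)"

section \<open>Distributions on the real line\<close>

definition vderiv :: "(real \<Rightarrow> complex) \<Rightarrow> real \<Rightarrow> complex" where
  "vderiv \<phi> = (\<lambda>t. vector_derivative \<phi> (at t))"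

definition smooth :: "(real \<Rightarrow> complex) \<Rightarrow> bool" where
  "smooth \<phi> \<longleftrightarrow> (\<forall>n t. (vderiv ^^ n) \<phi> differentiable (at t))"

definition test_function :: "(real \<Rightarrow> complex) \<Rightarrow> bool" where
  "test_function \<phi> \<longleftrightarrow> smooth \<phi> \<and> compact (closure {t. \<phi> t \<noteq> 0})"

text \<open>Distributions are represented by functionals on all functions, of which only the values on
  test functions matter; the bound below is continuity for the usual topology on test functions.\<close>

type_synonym functional = "(real \<Rightarrow> complex) \<Rightarrow> complex"

definition distribution :: "functional \<Rightarrow> bool" where
  "distribution T \<longleftrightarrow>
     (\<forall>\<phi> \<psi>. test_function \<phi> \<longrightarrow> test_function \<psi> \<longrightarrow> T (\<lambda>t. \<phi> t + \<psi> t) = T \<phi> + T \<psi>) \<and>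
     (\<forall>c \<phi>. test_function \<phi> \<longrightarrow> T (\<lambda>t. c * \<phi> t) = c * T \<phi>) \<and>
     (\<forall>R. \<exists>C N. \<forall>\<phi>. test_function \<phi> \<longrightarrow> (\<forall>t. \<bar>t\<bar> > R \<longrightarrow> \<phi> t = 0) \<longrightarrow>
        norm (T \<phi>) \<le> C * (\<Sum>n\<le>N. SUP t. norm ((vderiv ^^ n) \<phi> t)))"

definition equal_distributions :: "functional \<Rightarrow> functional \<Rightarrow> bool" where
  "equal_distributions S T \<longleftrightarrow>
     distribution S \<and> distribution T \<and> (\<forall>\<phi>. test_function \<phi> \<longrightarrow> S \<phi> = T \<phi>)"

definition dist_of_fun :: "(real \<Rightarrow> complex) \<Rightarrow> functional" where
  "dist_of_fun F = (\<lambda>\<phi>. LINT t|lborel. F t * \<phi> t)"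

definition dist_deriv :: "functional \<Rightarrow> functional" where
  "dist_deriv T = (\<lambda>\<phi>. - T (vderiv \<phi>))"

definition dist_mult :: "(real \<Rightarrow> complex) \<Rightarrow> functional \<Rightarrow> functional" where
  "dist_mult g T = (\<lambda>\<phi>. T (\<lambda>t. g t * \<phi> t))"

text \<open>The image under \<open>t \<mapsto> - t\<close>.\<close>

definition dist_reflect :: "functional \<Rightarrow> functional" where
  "dist_reflect T = (\<lambda>\<phi>. T (\<lambda>t. \<phi> (- t)))"

definition dirac :: "real \<Rightarrow> functional" where
  "dirac a = (\<lambda>\<phi>. \<phi> a)"

section \<open>The sum over the divisor as a distribution\<close>

definition K2 :: "(complex \<Rightarrow> complex) \<Rightarrow> complex \<Rightarrow> real \<Rightarrow> complex" where
  "K2 f \<sigma> t = (\<Sum>\<^sub>\<infinity>\<rho>\<in>divisor f.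
     of_int (zorder f \<rho>) / (\<rho> - \<sigma>)\<^sup>2 * exp ((\<rho> - \<sigma>) * of_real t)) * indicator {0..} t"

definition W_dist :: "(complex \<Rightarrow> complex) \<Rightarrow> complex \<Rightarrow> functional" where
  "W_dist f \<sigma> = dist_mult (\<lambda>t. exp (\<sigma> * of_real t))
     (dist_deriv (dist_deriv (dist_of_fun (\<lambda>t. (K2 f \<sigma> t - K2 f \<sigma> 0) * indicator {0..} t))))"

text \<open>The meaning given to \<open>\<Sum>\<^sub>\<rho> n\<^sub>\<rho> e\<^bsup>(\<rho> - 1/2)|t|\<^esup>\<close>.\<close>

definition divisor_exp_sum :: "(complex \<Rightarrow> complex) \<Rightarrow> functional" where
  "divisor_exp_sum f = (\<lambda>\<phi>.
     dist_mult (\<lambda>t. exp (- of_real t / 2)) (W_dist f (1/2)) \<phi> +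
     dist_mult (\<lambda>t. exp (of_real t / 2)) (dist_reflect (W_dist f (1/2))) \<phi>)"

end

theory Submission
  imports Defs "HOL-Number_Theory.Prime_Powers"
begin

text \<open>Write \<open>\<sigma> = 1/2\<close> and \<open>F(t) = K\<^sub>2(t) - K\<^sub>2(0)\<close> for \<open>t \<ge> 0\<close>. When the definitions are unfolded the
  exponential factors cancel, and the left-hand side pairs with \<open>\<phi>\<close> to \<open>\<integral>\<^sub>0\<^sup>\<infinity> F(t) (\<phi>''(t) + \<phi>''(-t)) dt\<close>.
  Integration by parts gives \<open>\<integral>\<^sub>0\<^sup>\<infinity> max(0, t - a) \<phi>''(t) dt = \<phi>(a)\<close> for \<open>a \<ge> 0\<close>. So the theorem amounts to
  the identity of continuous functions \<open>F(t) = c\<^sub>0 t - \<Sum>\<^sub>n \<Lambda>(n) n\<^sup>-\<^sup>1\<^sup>/\<^sup>2 max(0, t - log n)\<close>, which is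
  \<open>zeros_eq_primes\<close>.

Both sides of that identity grow at most exponentially and may be compared through their Laplace
  transforms, which determine them (\<open>laplace_injective\<close>). At \<open>z\<close>, with \<open>s = z + 1/2\<close>, the sum over the
  divisor has the transform \<open>G(s) / z\<^sup>2\<close> by partial fractions, and the sum over the integers has the
  transform \<open>-(\<zeta>'/\<zeta>)(s) / z\<^sup>2\<close> by the Dirichlet series of \<open>\<zeta>'/\<zeta>\<close>. The identity of the transforms is
  therefore the statement that \<open>G - \<zeta>'/\<zeta>\<close> is the constant \<open>c\<^sub>0\<close>.

That constancy is Hadamard's theorem for \<open>f(s) = (s - 1) \<zeta>(s)\<close>, in the form of
  \<open>log_derivative_expansion\<close>: for an entire \<open>f\<close> with \<open>|f(s)| \<le> exp(O(|s|\<^sup>3\<^sup>/\<^sup>2))\<close>, the difference of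
  \<open>f'/f\<close> and the sum over the zeros is constant. After division by the zeros in a disc of radius \<open>R\<close>, the
  Borel-Caratheodory inequality shows that the logarithmic derivative of the quotient varies by
  \<open>O(R\<^sup>-\<^sup>1\<^sup>/\<^sup>2)\<close> near the centre, so that it becomes constant in the limit.

The continuation of \<open>\<zeta>\<close> and the bound on \<open>f\<close> in the whole plane both come from one recursion. The
  differences \<open>(n - 1)\<^sup>1\<^sup>-\<^sup>s - n\<^sup>1\<^sup>-\<^sup>s\<close> with \<open>n > a\<close> add up to \<open>a\<^sup>1\<^sup>-\<^sup>s\<close>. Expanding each of them by the
  binomial series expresses \<open>F\<^sub>a(s) = (s - 1) \<Sum>\<^sub>n\<^sub>>\<^sub>a n\<^sup>-\<^sup>s\<close> through its values at \<open>s + 1, s + 2, \<dots>\<close>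
  (\<open>ztail_recursion\<close>), hence continues it one strip at a time to the left; and when \<open>a\<close> is a large
  multiple of \<open>|s|\<close>, the loss per strip is so small that crossing about \<open>|s|\<close> strips costs only
  \<open>exp(O(|s| log |s|))\<close>. The same recursion gives \<open>\<zeta>(1/2) \<noteq> 0\<close>, so that the weights \<open>1 / (\<rho> - \<sigma>)\<^sup>2\<close> in
  \<open>K\<^sub>2\<close> are finite.\<close>

section \<open>Tails of the zeta series and their recursion\<close>

definition dtail :: "nat \<Rightarrow> complex \<Rightarrow> complex" where
  "dtail a s = (\<Sum>n. of_nat (n + Suc a) powr (- s))"

lemma norm_nat_powr: "n > 0 \<Longrightarrow> norm (of_nat n powr (s::complex)) = real n powr Re s"
  using norm_powr_real_powr[of "of_nat n" s] by simp

lemma summable_shifted_powr: "c > 1 \<Longrightarrow> summable (\<lambda>n. real (n + a) powr (- c))"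
  by (subst summable_iff_shift) (simp add: summable_real_powr_iff)

lemma summable_norm_dtail:
  assumes "Re s > 1"
  shows "summable (\<lambda>n. norm (of_nat (n + Suc a) powr (- s)))"
  using summable_shifted_powr[OF assms, of "Suc a"] by (simp add: norm_nat_powr del: of_nat_Suc of_nat_add)

lemma summable_dtail:
  assumes "Re s > 1"
  shows "summable (\<lambda>n. of_nat (n + Suc a) powr (- s))"
  using summable_norm_dtail[OF assms] by (rule summable_norm_cancel)

text \<open>The bound is asked only for almost all terms, because the series to which this is applied have finitely
  many terms for which no decay estimate is available.\<close>

lemma holomorphic_suminf_M_test:
  fixes f :: "nat \<Rightarrow> complex \<Rightarrow> complex"
  assumes "open S" and hol: "\<And>n. f n holomorphic_on S"
    and bd: "\<And>x. x \<in> S \<Longrightarrow> \<exists>d M. 0 < d \<and> cball x d \<subseteq> S \<and> summable M \<and>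
               (\<forall>\<^sub>F n in sequentially. \<forall>y\<in>cball x d. norm (f n y) \<le> M n)"
  shows "(\<lambda>s. \<Sum>n. f n s) holomorphic_on S"
proof (rule holomorphic_uniform_sequence[OF \<open>open S\<close>, where f = "\<lambda>n s. \<Sum>k<n. f k s"])
  show "(\<lambda>s. \<Sum>k<n. f k s) holomorphic_on S" for n
    by (intro holomorphic_intros hol)
next
  fix x assume "x \<in> S"
  from bd[OF this] obtain d M where dM: "0 < d" "cball x d \<subseteq> S" "summable M"
    "\<forall>\<^sub>F n in sequentially. \<forall>y\<in>cball x d. norm (f n y) \<le> M n" by blast
  have "uniform_limit (cball x d) (\<lambda>n s. \<Sum>k<n. f k s) (\<lambda>s. \<Sum>n. f n s) sequentially"
    by (rule Weierstrass_m_test_ev[OF dM(4,3)])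
  with dM show "\<exists>d>0. cball x d \<subseteq> S \<and>
      uniform_limit (cball x d) (\<lambda>n s. \<Sum>k<n. f k s) (\<lambda>s. \<Sum>n. f n s) sequentially" by blast
qed

lemma Re_cball: "y \<in> cball x d \<Longrightarrow> \<bar>Re y - Re x\<bar> \<le> d"
  using abs_Re_le_cmod[of "y - x"] by (simp add: dist_norm norm_minus_commute)

lemma holomorphic_dtail: "dtail a holomorphic_on {s. Re s > 1}"
  unfolding dtail_def
proof (rule holomorphic_suminf_M_test[OF open_halfspace_Re_gt])
  show "(\<lambda>s. of_nat (n + Suc a) powr (- s)) holomorphic_on {s. Re s > 1}" for n
    by (intro holomorphic_intros) (auto simp del: of_nat_Suc of_nat_add)
next
  fix x :: complex assume x: "x \<in> {s. Re s > 1}"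
  define d where "d = (Re x - 1) / 2"
  define c where "c = (Re x + 1) / 2"
  have "norm (of_nat (n + Suc a) powr (- y)) \<le> real (n + Suc a) powr (- c)"
    if "y \<in> cball x d" for y n
  proof -
    have "Re y \<ge> Re x - d" using Re_cball[OF that] by linarith
    hence "Re y \<ge> c" by (simp add: c_def d_def field_simps)
    hence "real (n + Suc a) powr (- Re y) \<le> real (n + Suc a) powr (- c)"
      by (intro powr_mono) auto
    thus ?thesis by (subst norm_nat_powr) auto
  qed
  moreover have "cball x d \<subseteq> {s. Re s > 1}"
    using Re_cball x by (fastforce simp: d_def field_simps abs_if split: if_splits)
  moreover have "d > 0" "c > 1" using x by (auto simp: d_def c_def)
  ultimately show "\<exists>d M. 0 < d \<and> cball x d \<subseteq> {s. Re s > 1} \<and> summable M \<and>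
      (\<forall>\<^sub>F n in sequentially. \<forall>y\<in>cball x d. norm (of_nat (n + Suc a) powr (- y)) \<le> M n)"
    by (intro exI[of _ d] exI[of _ "\<lambda>n. real (n + Suc a) powr (- c)"] conjI summable_shifted_powr
          always_eventually allI) auto
qed

lemma sums_inverse_consecutive:
  assumes "a \<ge> 1"
  shows "(\<lambda>n. 1 / (real (n + a) * real (n + Suc a))) sums (1 / real a)"
proof -
  have "(\<lambda>n. 1 / real (n + a)) \<longlonglongrightarrow> 0"
    using LIMSEQ_ignore_initial_segment[OF lim_1_over_n, of a] by simp
  from telescope_sums'[OF this]
  have "(\<lambda>n. 1 / real (n + a) - 1 / real (Suc n + a)) sums (1 / real (0 + a) - 0)" .
  moreover have "1 / real (n + a) - 1 / real (Suc n + a) = 1 / (real (n + a) * real (n + Suc a))" for n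
    using assms by (simp add: field_simps)
  ultimately show ?thesis by simp
qed

text \<open>For \<open>n > a\<close> the term is at most \<open>a\<^bsup>2 - Re s\<^esup> n\<^sup>-\<^sup>2\<close>, and \<open>n\<^sup>-\<^sup>2 \<le> 1 / ((n - 1) n)\<close> telescopes.\<close>

lemma norm_dtail_le:
  assumes a: "a \<ge> 1" and s: "Re s \<ge> 2"
  shows "norm (dtail a s) \<le> real a powr (1 - Re s)"
proof -
  let ?p = "real a powr (2 - Re s)" and ?q = "\<lambda>n. 1 / (real (n + a) * real (n + Suc a))"
  have bd: "norm (of_nat (n + Suc a) powr (- s)) \<le> ?p * ?q n"
    for n
  proof -
    have "norm (of_nat (n + Suc a) powr (- s)) = real (n + Suc a) powr (- Re s)"
      by (subst norm_nat_powr) auto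
    also have "\<dots> = real (n + Suc a) powr (2 - Re s) * real (n + Suc a) powr (- 2)"
      by (simp flip: powr_add)
    also have "\<dots> \<le> ?p * real (n + Suc a) powr (- 2)"
      using a s by (intro mult_right_mono powr_mono2') auto
    also have "real (n + Suc a) powr (- 2) = 1 / (real (n + Suc a) * real (n + Suc a))"
      by (simp add: powr_minus field_simps power2_eq_square)
    also have "?p * (1 / (real (n + Suc a) * real (n + Suc a)))
       \<le> ?p * ?q n"
      using a by (intro mult_left_mono divide_left_mono mult_right_mono mult_pos_pos) auto
    finally show ?thesis .
  qed
  have "norm (dtail a s) \<le> (\<Sum>n. norm (of_nat (n + Suc a) powr (- s)))"
    unfolding dtail_def by (rule summable_norm, rule summable_norm_dtail) (use s in auto)
  also have "\<dots> \<le> (\<Sum>n. ?p * ?q n)"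
    by (intro suminf_le bd summable_norm_dtail summable_mult sums_summable[OF sums_inverse_consecutive[OF a]])
       (use s in auto)
  also have "\<dots> = ?p * (1 / real a)"
    by (intro sums_unique[symmetric] sums_mult sums_inverse_consecutive a)
  also have "\<dots> = real a powr (1 - Re s)"
    using a powr_add[of "real a" "2 - Re s" "-1"] by (simp add: powr_minus field_simps)
  finally show ?thesis .
qed

lemma pochhammer_nonneg': "0 \<le> x \<Longrightarrow> 0 \<le> pochhammer (x::real) k"
  by (induction k) (auto simp: pochhammer_Suc)

lemma norm_pochhammer_le: "norm (pochhammer (w::complex) k) \<le> pochhammer (norm w) k"
proof (induction k)
  case (Suc k)
  have "norm (w + of_nat k) \<le> norm w + real k"
    using norm_triangle_ineq[of w "of_nat k"] by simp
  thus ?case using Suc unfolding pochhammer_Suc norm_mult by (intro mult_mono pochhammer_nonneg') auto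
qed auto

lemma pochhammer_mono_real: "0 \<le> x \<Longrightarrow> x \<le> y \<Longrightarrow> pochhammer x k \<le> pochhammer (y::real) k"
  by (induction k) (auto simp: pochhammer_Suc intro!: mult_mono pochhammer_nonneg')

text \<open>This is the binomial series of \<open>(1 - x)\<^bsup>-q\<^esup>\<close>. It majorizes the series for complex exponents.\<close>

lemma summable_pochhammer_powser:
  assumes "\<bar>x::real\<bar> < 1"
  shows "summable (\<lambda>k. pochhammer q k / fact k * x ^ k)"
proof -
  have "summable (\<lambda>k. ((- q) gchoose k) * (- x) ^ k)"
    using gen_binomial_real[of "-x" "-q"] assms by (auto simp: sums_iff)
  moreover have "((- q) gchoose k) * (- x) ^ k = pochhammer q k / fact k * x ^ k" for k
    by (simp add: gbinomial_pochhammer power_minus[of x] field_simps flip: power_add)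
  ultimately show ?thesis by simp
qed

text \<open>The binomial series of \<open>(n - 1)\<^bsup>1 - s\<^esup> = n\<^bsup>1 - s\<^esup> (1 - 1/n)\<^bsup>1 - s\<^esup>\<close>, with its first term moved to the
  other side.\<close>

lemma binomial_difference_sums:
  fixes s :: complex
  assumes n: "n \<ge> 2"
  shows "(\<lambda>k. pochhammer (s - 1) (Suc k) / fact (Suc k) * of_nat n powr (- (s + of_nat k))) sums
           (of_nat (n - 1) powr (1 - s) - of_nat n powr (1 - s))"
proof -
  have "(\<lambda>k. ((1 - s) gchoose k) * of_real (-1) ^ k * of_real (real n) powr (1 - s - of_nat k)) sums
               of_real (-1 + real n) powr (1 - s)"
    by (rule gen_binomial_complex') (use n in auto)
  moreover have "((1 - s) gchoose k) * of_real (-1) ^ k = pochhammer (s - 1) k / fact k" for k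
    by (simp add: gbinomial_pochhammer field_simps flip: power_add)
  moreover have "complex_of_real (-1 + real n) = of_nat (n - 1)" using n by (simp add: of_nat_diff)
  ultimately have "(\<lambda>k. pochhammer (s - 1) k / fact k * of_nat n powr (1 - s - of_nat k)) sums
      of_nat (n - 1) powr (1 - s)" by simp
  from this[THEN sums_split_initial_segment, of 1]
  show ?thesis by (simp add: algebra_simps)
qed

lemma summable_on_product_nonneg:
  fixes A :: "'a \<Rightarrow> real" and B :: "'b \<Rightarrow> real"
  assumes "A summable_on I" "B summable_on J"
    and "\<And>n. n \<in> I \<Longrightarrow> A n \<ge> 0" "\<And>k. k \<in> J \<Longrightarrow> B k \<ge> 0"
  shows "(\<lambda>(n,k). A n * B k) summable_on I \<times> J"
  by (rule summable_on_SigmaI[where g = "\<lambda>n. A n * infsum B J"])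
     (use assms in \<open>auto intro!: has_sum_cmult_right summable_on_cmult_left\<close>)

text \<open>Summation of the preceding identity over \<open>n > a\<close>: the right-hand sides telescope. As \<open>n \<ge> 2\<close> throughout,
  the double series is dominated by a product of two convergent series, and the order of summation may be
  exchanged.\<close>

lemma dtail_recursion_sums:
  assumes s: "Re s > 1" and a: "a \<ge> 1"
  shows "(\<lambda>k. pochhammer (s - 1) (Suc k) / fact (Suc k) * dtail a (s + of_nat k)) sums
           of_nat a powr (1 - s)"
proof -
  let ?c = "\<lambda>k. pochhammer (s - 1) (Suc k) / fact (Suc k)"
  define t :: "nat \<Rightarrow> nat \<Rightarrow> complex" where
    "t n k = ?c k * of_nat (n + Suc a) powr (- (s + of_nat k))" for n k
  define q where "q = norm (s - 1)"
  define A where "A n = real (n + Suc a) powr (- Re s)" for n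
  \<comment> \<open>the factor \<open>2\<close> compensates for the exponent \<open>Suc k\<close> instead of \<open>k\<close>\<close>
  define B where "B k = pochhammer q (Suc k) / fact (Suc k) * (1/2) ^ Suc k * 2" for k
  have A0: "A n \<ge> 0" for n by (simp add: A_def)
  have B0: "B k \<ge> 0" for k
    unfolding B_def q_def by (intro mult_nonneg_nonneg divide_nonneg_nonneg pochhammer_nonneg') auto
  have bd: "norm (t n k) \<le> A n * B k" for n k
  proof -
    have "norm (t n k) = norm (pochhammer (s - 1) (Suc k)) / fact (Suc k) * real (n + Suc a) powr (- Re s - k)"
      unfolding t_def norm_mult norm_divide norm_fact by (subst norm_nat_powr) auto
    also have "real (n + Suc a) powr (- Re s - k) = A n * (1 / real (n + Suc a)) ^ k"
      unfolding A_def powr_diff by (subst powr_realpow) (auto simp: power_one_over field_simps)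
    also have "norm (pochhammer (s - 1) (Suc k)) / fact (Suc k) * (A n * (1 / real (n + Suc a)) ^ k)
        \<le> pochhammer q (Suc k) / fact (Suc k) * (A n * (1/2) ^ k)"
      unfolding q_def using a
      by (intro mult_mono divide_right_mono norm_pochhammer_le power_mono A0)
         (auto intro!: pochhammer_nonneg' mult_nonneg_nonneg divide_nonneg_nonneg A0 divide_left_mono
           simp del: fact_Suc)
    also have "\<dots> = A n * B k" by (simp add: B_def)
    finally show ?thesis .
  qed
  have sA: "summable A" unfolding A_def using s by (intro summable_shifted_powr)
  have "summable (\<lambda>k. pochhammer q (Suc k) / fact (Suc k) * (1/2) ^ Suc k)"
    by (subst summable_Suc_iff) (rule summable_pochhammer_powser, simp)
  hence sB: "summable B" unfolding B_def by (rule summable_mult2)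
  have A_on: "A summable_on UNIV" and B_on: "B summable_on UNIV"
    using sA sB A0 B0 by (auto intro!: norm_summable_imp_summable_on)
  have "(\<lambda>(n,k). A n * B k) summable_on UNIV \<times> UNIV"
    using A_on B_on A0 B0 by (intro summable_on_product_nonneg) auto
  hence "(\<lambda>x. norm (case x of (n,k) \<Rightarrow> t n k)) summable_on UNIV \<times> UNIV"
    by (rule Infinite_Sum.abs_summable_on_comparison_test') (use bd in auto)
  hence ton: "(\<lambda>(n,k). t n k) summable_on UNIV \<times> UNIV"
    by (rule abs_summable_summable)
  have row: "infsum (t n) UNIV = of_nat (n + a) powr (1 - s) - of_nat (n + Suc a) powr (1 - s)" for n
  proof -
    have 1: "t n sums (of_nat (n + Suc a - 1) powr (1 - s) - of_nat (n + Suc a) powr (1 - s))"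
      unfolding t_def by (rule binomial_difference_sums) (use a in auto)
    have "t n summable_on UNIV"
      by (rule summable_on_SigmaD1[OF ton UNIV_I])
    hence "t n sums infsum (t n) UNIV" by (intro has_sum_imp_sums has_sum_infsum)
    with 1 have "infsum (t n) UNIV = of_nat (n + Suc a - 1) powr (1 - s) - of_nat (n + Suc a) powr (1 - s)"
      by (metis sums_unique2)
    thus ?thesis by simp
  qed
  have col: "infsum (\<lambda>n. t n k) UNIV = ?c k * dtail a (s + of_nat k)" for k
  proof -
    have "summable (\<lambda>n. norm (of_nat (n + Suc a) powr (- (s + of_nat k))))"
      by (rule summable_norm_dtail) (use s in auto)
    hence "((\<lambda>n. of_nat (n + Suc a) powr (- (s + of_nat k))) has_sum dtail a (s + of_nat k)) UNIV"
      unfolding dtail_def by (intro norm_summable_imp_has_sum) (auto intro: summable_norm_cancel summable_sums)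
    from has_sum_cmult_right[OF this, of "?c k"]
    show ?thesis unfolding t_def by (intro infsumI) auto
  qed
  define S where "S = infsum (\<lambda>(n,k). t n k) (UNIV \<times> UNIV)"
  have "(\<lambda>n. infsum (t n) UNIV) summable_on UNIV" 
    using summable_on_Sigma_banach[OF ton] by simp
  moreover have "infsum (\<lambda>n. infsum (t n) UNIV) UNIV = S"
    unfolding S_def using infsum_Sigma'_banach[OF ton] by simp
  ultimately have "((\<lambda>n. infsum (t n) UNIV) has_sum S) UNIV"
    by (metis has_sum_infsum)
  hence 1: "(\<lambda>n. of_nat (n + a) powr (1 - s) - of_nat (Suc n + a) powr (1 - s)) sums S"
    unfolding row by (auto dest: has_sum_imp_sums)
  have "(\<lambda>n. of_nat (n + a) powr (1 - s)) \<longlonglongrightarrow> 0"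
  proof (rule tendsto_norm_zero_cancel)
    have "(\<lambda>n. real (n + a) powr (1 - Re s)) \<longlonglongrightarrow> 0"
      using s by (intro tendsto_neg_powr filterlim_compose[OF filterlim_real_sequentially]
          filterlim_add_const_nat_at_top) auto
    thus "(\<lambda>n. norm (of_nat (n + a) powr (1 - s))) \<longlonglongrightarrow> 0"
      using a by (subst norm_nat_powr) auto
  qed
  from telescope_sums'[OF this] have S_eq: "S = of_nat a powr (1 - s)"
    using 1 by (auto dest: sums_unique2)
  have ton': "(\<lambda>(k,n). t n k) summable_on UNIV \<times> UNIV"
    using ton by (subst (asm) summable_on_swap) simp
  have "infsum (\<lambda>k. infsum (\<lambda>n. t n k) UNIV) UNIV = S"
    unfolding S_def using infsum_swap_banach[OF ton] infsum_Sigma'_banach[OF ton] by simp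
  moreover have "(\<lambda>k. infsum (\<lambda>n. t n k) UNIV) summable_on UNIV"
    using summable_on_Sigma_banach[OF ton'] by simp
  ultimately have "((\<lambda>k. infsum (\<lambda>n. t n k) UNIV) has_sum S) UNIV" by (metis has_sum_infsum)
  hence "(\<lambda>k. infsum (\<lambda>n. t n k) UNIV) sums S" by (rule has_sum_imp_sums)
  thus ?thesis unfolding col by (simp add: S_eq)
qed

text \<open>The factor \<open>s - 1\<close> removes the pole of the tail, so that the recursion has no singular terms.\<close>

definition ztail :: "nat \<Rightarrow> complex \<Rightarrow> complex" where "ztail a s = (s - 1) * dtail a s"

text \<open>The Pochhammer symbol has one factor less than in \<open>dtail_recursion_sums\<close>: the missing factor \<open>s + j\<close> is
  the one that \<open>ztail\<close> carries at the point \<open>s + j + 1\<close>.\<close>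

definition tail_coeff :: "complex \<Rightarrow> nat \<Rightarrow> complex" where
  "tail_coeff s j = pochhammer (s - 1) (Suc j) / fact (j + 2)"

text \<open>The value at \<open>s\<close> involves \<open>F\<close> only at points at least one unit further to the right, so this operator
  extends a function across one more vertical strip.\<close>

definition tail_step :: "nat \<Rightarrow> (complex \<Rightarrow> complex) \<Rightarrow> complex \<Rightarrow> complex" where
  "tail_step a F s = of_nat a powr (1 - s) - (\<Sum>j. tail_coeff s j * F (s + of_nat (Suc j)))"

lemma ztail_recursion:
  assumes s: "Re s > 1" and a: "a \<ge> 1"
  shows "tail_step a (ztail a) s = ztail a s"
proof -
  note S = dtail_recursion_sums[OF assms]
  have eq: "pochhammer (s - 1) (Suc (Suc j)) / fact (Suc (Suc j)) * dtail a (s + of_nat (Suc j))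
     = tail_coeff s j * ztail a (s + of_nat (Suc j))" for j
    by (simp add: tail_coeff_def ztail_def pochhammer_Suc algebra_simps)
  from sums_split_initial_segment[OF S, of 1]
  have "(\<lambda>j. pochhammer (s - 1) (Suc (Suc j)) / fact (Suc (Suc j)) * dtail a (s + of_nat (Suc j)))
        sums (of_nat a powr (1 - s) - ztail a s)"
    by (simp add: ztail_def)
  thus ?thesis unfolding eq tail_step_def by (simp add: sums_iff)
qed

lemma norm_ztail_le:
  assumes a: "a \<ge> 1" and s: "Re s \<ge> 2"
  shows "norm (ztail a s) \<le> norm (s - 1) * real a powr (1 - Re s)"
  unfolding ztail_def norm_mult by (intro mult_left_mono norm_dtail_le assms) auto

lemma norm_tail_coeff_ztail_le:
  assumes a: "a \<ge> 1" and s: "Re s + real (Suc j) \<ge> 2" "norm (s - 1) \<le> q"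
  shows "norm (tail_coeff s j * ztail a (s + of_nat (Suc j)))
     \<le> pochhammer q (j + 2) / fact (j + 2) * (1 / real a) ^ j * real a powr (- Re s)"
proof -
  have q: "q \<ge> 0" using s(2) norm_ge_zero order_trans by blast
  have "norm (ztail a (s + of_nat (Suc j))) \<le> norm (s + of_nat (Suc j) - 1) * real a powr (1 - Re (s + of_nat (Suc j)))"
    by (rule norm_ztail_le) (use assms in auto)
  also have "1 - Re (s + of_nat (Suc j)) = - Re s - real j" by simp
  also have "real a powr (- Re s - real j) = (1 / real a) ^ j * real a powr (- Re s)"
    using a by (simp add: powr_diff powr_realpow power_one_over)
  also have "norm (s + of_nat (Suc j) - 1) \<le> q + real (Suc j)"
  proof -
    have "s + of_nat (Suc j) - 1 = (s - 1) + of_nat (Suc j)" by simp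
    thus ?thesis using norm_triangle_ineq[of "s - 1" "of_nat (Suc j)"] s(2)
      by (metis add_mono_thms_linordered_semiring(3) norm_of_nat order_trans)
  qed
  finally have z: "norm (ztail a (s + of_nat (Suc j))) \<le> (q + real (Suc j)) * ((1 / real a) ^ j * real a powr (- Re s))"
    by (auto simp: mult_right_mono)
  have "norm (pochhammer (s - 1) (Suc j)) \<le> pochhammer q (Suc j)"
    using norm_pochhammer_le pochhammer_mono_real s(2) norm_ge_zero order_trans by blast
  hence r: "norm (tail_coeff s j) \<le> pochhammer q (Suc j) / fact (j + 2)"
    unfolding tail_coeff_def norm_divide by (simp add: divide_right_mono del: pochhammer_Suc fact_Suc)
  have "norm (tail_coeff s j * ztail a (s + of_nat (Suc j)))
      \<le> pochhammer q (Suc j) / fact (j + 2) * ((q + real (Suc j)) * ((1 / real a) ^ j * real a powr (- Re s)))"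
    unfolding norm_mult using q by (intro mult_mono r z) (auto intro!: divide_nonneg_nonneg pochhammer_nonneg')
  also have "\<dots> = pochhammer q (j + 2) / fact (j + 2) * (1 / real a) ^ j * real a powr (- Re s)"
    using pochhammer_Suc[of q "Suc j"] by simp
  finally show ?thesis .
qed

section \<open>Analytic continuation\<close>

lemma tail_coeff_holomorphic: "(\<lambda>s. tail_coeff s j) holomorphic_on S"
  unfolding tail_coeff_def pochhammer_prod by (intro holomorphic_intros) auto

text \<open>The elementary bound on the tail needs \<open>Re y + j + 1 \<ge> 2\<close>, which on a fixed disc fails for finitely many
  \<open>j\<close> only.\<close>

lemma eventually_norm_tail_coeff_le:
  assumes "a \<ge> 1" "\<And>s. Re s > 1 \<Longrightarrow> F s = ztail a s"
  shows "\<forall>\<^sub>F j in sequentially. \<forall>y\<in>cball x d. norm (tail_coeff y j * F (y + of_nat (Suc j)))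
     \<le> pochhammer (norm (x - 1) + d) (j + 2) / fact (j + 2) * (1 / real a) ^ j * real a powr (d - Re x)" (is "\<forall>\<^sub>F j in _. \<forall>y\<in>_. _ \<le> ?M j")
  using eventually_ge_at_top[of "nat \<lceil>2 + d - Re x\<rceil>"]
proof eventually_elim
  case (elim j)
  show ?case
  proof
    fix y assume y: "y \<in> cball x d"
    have d0: "d \<ge> 0" using y by (meson dual_order.trans mem_cball zero_le_dist)
    have Re: "\<bar>Re y - Re x\<bar> \<le> d" by (rule Re_cball[OF y])
    have j: "real j \<ge> 2 + d - Re x" using elim by linarith
    have nq: "norm (y - 1) \<le> norm (x - 1) + d"
      using y norm_triangle_ineq[of "x - 1" "y - x"] by (auto simp: dist_norm norm_minus_commute)
    have "norm (tail_coeff y j * F (y + of_nat (Suc j))) = norm (tail_coeff y j * ztail a (y + of_nat (Suc j)))"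
      using j Re by (subst assms(2)) auto
    also have "\<dots> \<le> pochhammer (norm (x - 1) + d) (j + 2) / fact (j + 2) * (1 / real a) ^ j * real a powr (- Re y)"
      using j Re nq assms(1) by (intro norm_tail_coeff_ztail_le) auto
    also have "\<dots> \<le> ?M j"
      using Re assms(1) d0
      by (intro mult_left_mono powr_mono mult_nonneg_nonneg divide_nonneg_nonneg pochhammer_nonneg') auto
    finally show "norm (tail_coeff y j * F (y + of_nat (Suc j)))
     \<le> ?M j" .
  qed
qed

lemma summable_tail_coeff_bound:
  assumes "a \<ge> 2"
  shows "summable (\<lambda>j. pochhammer q (j + 2) / fact (j + 2) * (1 / real a) ^ j * C)"
proof -
  have "summable (\<lambda>k. pochhammer q k / fact k * (1 / real a) ^ k)"
    using assms by (intro summable_pochhammer_powser) auto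
  hence "summable (\<lambda>j. pochhammer q (j + 2) / fact (j + 2) * (1 / real a) ^ (j + 2))"
    by (subst summable_iff_shift)
  hence "summable (\<lambda>j. pochhammer q (j + 2) / fact (j + 2) * (1 / real a) ^ (j + 2) * (real a ^ 2 * C))"
    by (rule summable_mult2)
  moreover have "x * (1 / real a) ^ (j + 2) * (real a ^ 2 * C) = x * (1 / real a) ^ j * C" for j x
    using assms by (simp add: power_add power_divide power2_eq_square)
  ultimately show ?thesis by (simp only:)
qed

lemma summable_tail_step:
  assumes "a \<ge> 2" "\<And>s. Re s > 1 \<Longrightarrow> F s = ztail a s"
  shows "summable (\<lambda>j. tail_coeff s j * F (s + of_nat (Suc j)))"
proof (rule summable_comparison_test_ev)
  show "summable (\<lambda>j. pochhammer (norm (s - 1) + 0) (j + 2) / fact (j + 2) * (1 / real a) ^ j * real a powr (0 - Re s))"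
    by (rule summable_tail_coeff_bound[OF assms(1)])
  show "\<forall>\<^sub>F j in sequentially. norm (tail_coeff s j * F (s + of_nat (Suc j)))
     \<le> pochhammer (norm (s - 1) + 0) (j + 2) / fact (j + 2) * (1 / real a) ^ j * real a powr (0 - Re s)"
    using eventually_norm_tail_coeff_le[of a F s 0] assms by simp
qed

lemma holomorphic_tail_step:
  assumes a: "a \<ge> 2" and F: "F holomorphic_on {s. Re s > c}"
    and eq: "\<And>s. Re s > 1 \<Longrightarrow> F s = ztail a s"
  shows "tail_step a F holomorphic_on {s. Re s > c - 1}"
proof -
  have "(\<lambda>s. \<Sum>j. tail_coeff s j * F (s + of_nat (Suc j))) holomorphic_on {s. Re s > c - 1}"
  proof (rule holomorphic_suminf_M_test[OF open_halfspace_Re_gt])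
    fix j
    have "F \<circ> (\<lambda>s. s + of_nat (Suc j)) holomorphic_on {s. Re s > c - 1}"
      by (rule holomorphic_on_compose_gen[OF _ F]) (auto intro!: holomorphic_intros)
    thus "(\<lambda>s. tail_coeff s j * F (s + of_nat (Suc j))) holomorphic_on {s. Re s > c - 1}"
      by (intro holomorphic_on_mult tail_coeff_holomorphic) (simp add: o_def)
  next
    fix x assume x: "x \<in> {s. Re s > c - 1}"
    define d where "d = (Re x - (c - 1)) / 2"
    have d: "d > 0" using x by (simp add: d_def)
    have sub: "cball x d \<subseteq> {s. Re s > c - 1}"
    proof
      fix y assume "y \<in> cball x d"
      hence "Re y \<ge> Re x - d" using Re_cball by (smt (verit))
      thus "y \<in> {s. Re s > c - 1}" using d by (simp add: d_def field_simps)
    qed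
    show "\<exists>d M. 0 < d \<and> cball x d \<subseteq> {s. Re s > c - 1} \<and> summable M \<and>
      (\<forall>\<^sub>F n in sequentially. \<forall>y\<in>cball x d. norm (tail_coeff y n * F (y + of_nat (Suc n))) \<le> M n)"
      using d sub summable_tail_coeff_bound[OF a] eventually_norm_tail_coeff_le[of a F x d, OF _ eq] a
      by (intro exI conjI) auto
  qed
  thus ?thesis unfolding tail_step_def using a by (intro holomorphic_intros) auto
qed

definition tail_iter :: "nat \<Rightarrow> complex \<Rightarrow> complex" where
  "tail_iter m = (tail_step 2 ^^ m) (ztail 2)"

lemma holomorphic_ztail: "ztail a holomorphic_on {s. Re s > 1}"
  unfolding ztail_def by (intro holomorphic_intros holomorphic_dtail)

lemma tail_iter_properties:
  "tail_iter m holomorphic_on {s. Re s > 1 - real m} \<and> (\<forall>s. Re s > 1 \<longrightarrow> tail_iter m s = ztail 2 s)"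
proof (induction m)
  case 0
  thus ?case by (simp add: tail_iter_def holomorphic_ztail)
next
  case (Suc m)
  have eq: "tail_iter (Suc m) = tail_step 2 (tail_iter m)" by (simp add: tail_iter_def)
  have "tail_step 2 (tail_iter m) holomorphic_on {s. Re s > 1 - real m - 1}"
    by (rule holomorphic_tail_step) (use Suc in auto)
  moreover have "tail_step 2 (tail_iter m) s = ztail 2 s" if "Re s > 1" for s
  proof -
    have "tail_step 2 (tail_iter m) s = tail_step 2 (ztail 2) s"
      unfolding tail_step_def using Suc that by simp
    thus ?thesis using ztail_recursion[OF that, of 2] by simp
  qed
  ultimately show ?case unfolding eq by (simp add: algebra_simps)
qed

lemma halfplane_continuation:
  assumes "f holomorphic_on {s. Re s > c}" "g holomorphic_on {s. Re s > c}" "c \<le> 1"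
    "\<And>s. Re s > 1 \<Longrightarrow> f s = g s" "Re s > c"
  shows "f s = g s"
proof (rule analytic_continuation_open[of "{s. Re s > 1}" "{s. Re s > c}" f g s])
  show "{s. Re s > 1} \<noteq> {}" by (auto intro!: exI[of _ 2])
qed (use assms in \<open>auto intro!: open_halfspace_Re_gt convex_connected convex_halfspace_Re_gt\<close>)

lemma tail_iter_eq:
  assumes "m \<le> n" "Re s > 1 - real m"
  shows "tail_iter n s = tail_iter m s"
proof (rule halfplane_continuation[of "tail_iter n" "1 - real m" "tail_iter m" s])
  show "tail_iter n holomorphic_on {s. Re s > 1 - real m}"
    using tail_iter_properties[of n] assms(1) by (auto elim!: holomorphic_on_subset)
qed (use tail_iter_properties assms in auto)

text \<open>The iterates are eventually constant near every point, since successive ones agree by the identity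
  theorem. The recursion starts from \<open>a = 2\<close>, the smallest value for which the coefficients times \<open>a\<^bsup>-j\<^esup>\<close>
  are summable.\<close>

lemma ztail2_continuation:
  obtains F where "F holomorphic_on UNIV" "\<And>s. Re s > 1 \<Longrightarrow> F s = ztail 2 s"
proof -
  define F where "F s = tail_iter (nat \<lceil>2 - Re s\<rceil>) s" for s
  have F: "F s = tail_iter m s" if "Re s > 1 - real m" for s m
  proof -
    let ?k = "nat \<lceil>2 - Re s\<rceil>"
    have "Re s > 1 - real ?k" by linarith
    hence "tail_iter (max m ?k) s = tail_iter ?k s" by (intro tail_iter_eq) auto
    moreover have "tail_iter (max m ?k) s = tail_iter m s" using that by (intro tail_iter_eq) auto
    ultimately show ?thesis by (simp add: F_def)
  qed
  have "F holomorphic_on {s. Re s > 1 - real m}" for m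
    using tail_iter_properties[of m] F by (metis (mono_tags, lifting) holomorphic_transform mem_Collect_eq)
  hence "F holomorphic_on (\<Union>m. {s. Re s > 1 - real m})"
    by (intro holomorphic_on_UN_open open_halfspace_Re_gt) auto
  moreover have "(\<Union>m. {s. Re s > 1 - real m}) = UNIV"
  proof -
    have "\<exists>m. Re s > 1 - real m" for s
      using reals_Archimedean2[of "1 - Re s"] by (auto simp: algebra_simps)
    thus ?thesis by auto
  qed
  moreover have "F s = ztail 2 s" if "Re s > 1" for s
    using F[of 0 s] that tail_iter_properties[of 0] by simp
  ultimately show ?thesis using that by metis
qed

lemma tail_step_fixed:
  assumes F: "F holomorphic_on UNIV" "\<And>s. Re s > 1 \<Longrightarrow> F s = ztail a s" and a: "a \<ge> 2"
  shows "tail_step a F s = F s"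
proof (rule halfplane_continuation[of "tail_step a F" "min 1 (Re s) - 1" F s])
  show "tail_step a F holomorphic_on {z. min 1 (Re s) - 1 < Re z}"
    using holomorphic_tail_step[of a F "min 1 (Re s)"] F a holomorphic_on_subset by blast
  show "tail_step a F z = F z" if "Re z > 1" for z
  proof -
    have "tail_step a F z = tail_step a (ztail a) z"
      unfolding tail_step_def using F that by simp
    thus ?thesis using ztail_recursion[OF that, of a] a F(2)[OF that] by simp
  qed
qed (use F holomorphic_on_subset in auto)

lemma dtail_split:
  assumes "Re s > 1"
  shows "dtail 0 s = (\<Sum>n=1..a. of_nat n powr (- s)) + dtail a s"
proof -
  have "dtail 0 s = (\<Sum>n. of_nat (n + a + Suc 0) powr (- s)) + (\<Sum>n<a. of_nat (n + Suc 0) powr (- s))"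
    unfolding dtail_def by (rule suminf_split_initial_segment[OF summable_dtail[OF assms]])
  also have "(\<Sum>n. of_nat (n + a + Suc 0) powr (- s)) = dtail a s" by (simp add: dtail_def)
  also have "(\<Sum>n<a. of_nat (n + Suc 0) powr (- s)) = (\<Sum>n=1..a. of_nat n powr (- s))"
    by (rule sum.reindex_bij_witness[of _ "\<lambda>n. n - 1" Suc]) auto
  finally show ?thesis by simp
qed

text \<open>At \<open>s = 1\<close> all coefficients of the recursion vanish, which leaves the value \<open>1\<close>.\<close>

lemma zeta_numerator_exists:
  obtains f where "f holomorphic_on UNIV" "\<And>s. Re s > 1 \<Longrightarrow> f s = (s - 1) * dtail 0 s" "f 1 = 1"
proof -
  obtain F where F: "F holomorphic_on UNIV" "\<And>s. Re s > 1 \<Longrightarrow> F s = ztail 2 s"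
    using ztail2_continuation by blast
  define f where "f s = F s + (s - 1) * (\<Sum>n=1..2. of_nat n powr (- s))" for s
  show ?thesis
  proof (rule that)
    show "f holomorphic_on UNIV" unfolding f_def by (intro holomorphic_intros F) auto
    show "f s = (s - 1) * dtail 0 s" if "Re s > 1" for s
      unfolding f_def F(2)[OF that] dtail_split[OF that, of 2] ztail_def by (simp add: algebra_simps)
    have "F 1 = tail_step 2 F 1" using tail_step_fixed[of F 2 1, OF F] by simp
    also have "\<dots> = 1" by (simp add: tail_step_def tail_coeff_def pochhammer_rec)
    finally show "f 1 = 1" by (simp add: f_def)
  qed
qed

lemma riemann_zeta_spec:
  "riemann_zeta holomorphic_on - {1} \<and> riemann_zeta 1 = 0 \<and>
     (\<forall>s. Re s > 1 \<longrightarrow> riemann_zeta s = (\<Sum>n. of_nat (Suc n) powr (- s)))"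
proof -
  let ?series = "\<lambda>f. \<forall>s. Re s > 1 \<longrightarrow> f s = (\<Sum>n. of_nat (Suc n) powr (- s))"
  obtain f where f: "f holomorphic_on UNIV" "\<And>s. Re s > 1 \<Longrightarrow> f s = (s - 1) * dtail 0 s"
    using zeta_numerator_exists by metis
  have "\<exists>!f. f holomorphic_on - {1} \<and> f 1 = 0 \<and> ?series f"
  proof (rule ex1I[of _ "\<lambda>s. if s = 1 then 0 else f s / (s - 1)"], intro conjI allI impI)
    have "(\<lambda>s. f s / (s - 1)) holomorphic_on - {1}"
      by (intro holomorphic_intros holomorphic_on_subset[OF f(1)]) auto
    thus "(\<lambda>s. if s = 1 then 0 else f s / (s - 1)) holomorphic_on - {1}"
      by (rule holomorphic_transform) auto
    show "(if s = 1 then 0 else f s / (s - 1)) = (\<Sum>n. of_nat (Suc n) powr (- s))" if "Re s > 1" for s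
      using f(2)[OF that] that by (auto simp: dtail_def)
  next
    fix g assume g: "g holomorphic_on - {1} \<and> g 1 = 0 \<and> ?series g"
    show "g = (\<lambda>s. if s = 1 then 0 else f s / (s - 1))"
    proof
      fix s
      show "g s = (if s = 1 then 0 else f s / (s - 1))"
      proof (cases "s = 1")
        case False
        have "g s = f s / (s - 1)"
        proof (rule analytic_continuation_open[of "{s. Re s > 1}" "- {1}" g "\<lambda>s. f s / (s - 1)" s])
          show "connected (- {1::complex})" by (intro connected_punctured_universe) auto
          show "(\<lambda>s. f s / (s - 1)) holomorphic_on - {1}"
            by (intro holomorphic_intros holomorphic_on_subset[OF f(1)]) auto
          show "g z = f z / (z - 1)" if "z \<in> {s. Re s > 1}" for z
            using f(2)[of z] that g by (auto simp: dtail_def)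
          show "{s. Re s > 1} \<noteq> {}" by (auto intro!: exI[of _ 2])
        qed (use g False in \<open>auto intro!: open_halfspace_Re_gt\<close>)
        thus ?thesis using False by simp
      qed (use g in auto)
    qed
  qed simp
  from theI'[OF this] show ?thesis unfolding riemann_zeta_def .
qed

text \<open>The value at \<open>1\<close> fills the removable singularity: it is the residue of the zeta function.\<close>

definition zeta_num :: "complex \<Rightarrow> complex" where
  "zeta_num s = (if s = 1 then 1 else (s - 1) * riemann_zeta s)"

lemma riemann_zeta_eq_dtail: "Re s > 1 \<Longrightarrow> riemann_zeta s = dtail 0 s"
  using riemann_zeta_spec by (simp add: dtail_def)

lemma zeta_num_holomorphic: "zeta_num holomorphic_on UNIV"
proof -
  obtain f where f: "f holomorphic_on UNIV" "\<And>s. Re s > 1 \<Longrightarrow> f s = (s - 1) * dtail 0 s" "f 1 = 1"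
    using zeta_numerator_exists by metis
  have "f s = (s - 1) * riemann_zeta s" if "s \<noteq> 1" for s
  proof (rule analytic_continuation_open[of "{s. Re s > 1}" "- {1}" f "\<lambda>s. (s - 1) * riemann_zeta s" s])
    show "connected (- {1::complex})" by (intro connected_punctured_universe) auto
    show "(\<lambda>s. (s - 1) * riemann_zeta s) holomorphic_on - {1}"
      using riemann_zeta_spec by (intro holomorphic_intros) auto
    show "{s. Re s > 1} \<noteq> {}" by (auto intro!: exI[of _ 2])
  qed (use f that riemann_zeta_eq_dtail in
         \<open>auto intro!: open_halfspace_Re_gt intro: holomorphic_on_subset\<close>)
  hence "f = zeta_num" using f(3) by (auto simp: zeta_num_def fun_eq_iff)
  thus ?thesis using f(1) by simp
qed

lemma zeta_num_eq_dtail: "Re s > 1 \<Longrightarrow> zeta_num s = (s - 1) * dtail 0 s"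
  using riemann_zeta_eq_dtail[of s] by (auto simp: zeta_num_def)

text \<open>The entire continuation of \<open>ztail a\<close>, for all \<open>a\<close> at once: the growth estimate chooses \<open>a\<close> depending on
  \<open>s\<close>.\<close>

definition num_tail :: "nat \<Rightarrow> complex \<Rightarrow> complex" where
  "num_tail a s = zeta_num s - (s - 1) * (\<Sum>n=1..a. of_nat n powr (- s))"

lemma num_tail_holomorphic: "num_tail a holomorphic_on UNIV"
  unfolding num_tail_def by (intro holomorphic_intros zeta_num_holomorphic) auto

lemma num_tail_eq_ztail: "Re s > 1 \<Longrightarrow> num_tail a s = ztail a s"
  using dtail_split[of s a] by (simp add: num_tail_def zeta_num_eq_dtail ztail_def algebra_simps)

lemma num_tail_recursion: "a \<ge> 2 \<Longrightarrow> tail_step a (num_tail a) s = num_tail a s"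
  by (rule tail_step_fixed[OF num_tail_holomorphic num_tail_eq_ztail])

text \<open>At \<open>s = 1/2\<close> the factor \<open>s - 1\<close> makes all coefficients of the recursion negative, whereas the tails to
  the right are positive. So the tail beyond \<open>2\<close> contributes at least \<open>\<surd>2\<close>, which is more than the first
  two terms of the series can cancel.\<close>

lemma zeta_num_half_nonzero: "zeta_num (1/2) \<noteq> 0"
proof -
  let ?u = "\<lambda>j. tail_coeff (1/2) j * num_tail 2 (1/2 + of_nat (Suc j))"
  have nonpos: "Re (?u j) \<le> 0" for j
  proof -
    let ?x = "\<lambda>n. real (n + Suc 2) powr (- (1/2 + real (Suc j)))"
    have "pochhammer (complex_of_real (-1/2)) (Suc j) = complex_of_real (pochhammer (-1/2) (Suc j))"
      by (simp only: pochhammer_of_real)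
    hence r: "tail_coeff (1/2) j = complex_of_real (pochhammer (-1/2) (Suc j) / fact (j + 2))"
      unfolding tail_coeff_def by (simp del: pochhammer_Suc)
    have r0: "pochhammer (-1/2 :: real) (Suc j) / fact (j + 2) \<le> 0"
      using pochhammer_nonneg'[of "1/2" j] by (simp add: pochhammer_rec field_simps)
    have t: "of_nat (n + Suc 2) powr (- (1/2 + of_nat (Suc j))) =
       complex_of_real (?x n)" for n
      by (subst powr_of_real[symmetric]) (auto simp del: of_nat_Suc of_nat_add simp: of_real_of_nat_eq)
    have s: "summable ?x"
      by (intro summable_shifted_powr) auto
    have "dtail 2 (1/2 + of_nat (Suc j)) = complex_of_real (\<Sum>n. ?x n)"
      unfolding dtail_def t by (rule suminf_of_real[OF s, symmetric])
    moreover have "(\<Sum>n. ?x n) \<ge> 0"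
      by (intro suminf_nonneg s) auto
    ultimately obtain x where x: "dtail 2 (1/2 + of_nat (Suc j)) = complex_of_real x" "x \<ge> 0" by blast
    have "num_tail 2 (1/2 + of_nat (Suc j)) = (1/2 + of_nat (Suc j) - 1) * complex_of_real x"
      by (subst num_tail_eq_ztail) (auto simp: ztail_def x(1) simp del: of_nat_Suc)
    also have "\<dots> = complex_of_real ((1/2 + real j) * x)" by simp
    finally have z: "num_tail 2 (1/2 + of_nat (Suc j)) = complex_of_real ((1/2 + real j) * x)" .
    show ?thesis unfolding r z using r0 x(2)
      by (simp only: Re_complex_of_real flip: of_real_mult) (intro mult_nonpos_nonneg mult_nonneg_nonneg, auto)
  qed
  have sm: "summable ?u"
    by (rule summable_tail_step) (auto intro: num_tail_eq_ztail)
  have "Re (\<Sum>j. ?u j) =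
      (\<Sum>j. Re (?u j))"
    by (rule bounded_linear.suminf[OF bounded_linear_Re sm])
  also have "\<dots> \<le> 0"
    by (intro suminf_le_const[OF bounded_linear.summable[OF bounded_linear_Re sm]] sum_nonpos nonpos)
  finally have S: "Re (\<Sum>j. ?u j) \<le> 0" .
  have rp: "complex_of_nat 2 powr (of_real x) = of_real (2 powr x)" for x :: real
    using powr_of_real[of 2 x] by simp
  have "num_tail 2 (1/2) = tail_step 2 (num_tail 2) (1/2)" by (simp add: num_tail_recursion)
  hence "Re (num_tail 2 (1/2)) \<ge> Re (of_nat 2 powr (of_real (1/2)))"
    unfolding tail_step_def using S by simp
  hence 1: "Re (num_tail 2 (1/2)) \<ge> sqrt 2"
    unfolding rp by (simp add: powr_half_sqrt)
  have "(\<Sum>n=1..2. of_nat n powr (- (1/2))) = 1 + complex_of_real (2 powr (- (1/2)))"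
  proof -
    have "{1..2} = {1, 2::nat}" by auto
    thus ?thesis using rp[of "- (1/2)"] by simp
  qed
  hence "zeta_num (1/2) = num_tail 2 (1/2) - 1/2 * (1 + complex_of_real (2 powr (- (1/2))))"
    unfolding num_tail_def by simp
  hence "Re (zeta_num (1/2)) \<ge> sqrt 2 - 1/2 * (1 + 1 / sqrt 2)"
    using 1 by (simp add: powr_minus powr_half_sqrt inverse_eq_divide)
  moreover have "sqrt 2 - 1/2 * (1 + 1 / sqrt 2) > 0"
  proof -
    have "sqrt 2 \<ge> 1" by simp
    hence "1 / sqrt 2 \<le> 1" by (simp add: field_simps)
    moreover have "sqrt 2 > 1" by simp
    ultimately have "1 + 1 / sqrt 2 < 2 * sqrt 2" by linarith
    thus ?thesis by (simp add: field_simps)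
  qed
  ultimately show ?thesis by auto
qed

section \<open>Growth in the whole plane\<close>

lemma pochhammer_le_power_fact: "q \<ge> 1 \<Longrightarrow> pochhammer (q::real) k \<le> q ^ k * fact k"
proof (induction k)
  case (Suc k)
  have "q + real k \<le> q * (1 + real k)" using Suc.prems mult_right_mono[of 1 q "real k"] by (simp add: algebra_simps)
  hence "pochhammer q k * (q + real k) \<le> (q ^ k * fact k) * (q * (1 + real k))"
    using Suc by (intro mult_mono) auto
  thus ?case by (simp add: pochhammer_Suc algebra_simps)
qed auto

lemma norm_tail_coeff_le:
  assumes "norm (s - 1) \<le> q" "q \<ge> 1"
  shows "norm (tail_coeff s j) \<le> q ^ Suc j"
proof -
  have "norm (pochhammer (s - 1) (Suc j)) \<le> pochhammer q (Suc j)"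
    using norm_pochhammer_le pochhammer_mono_real assms(1) norm_ge_zero order_trans by blast
  also have "\<dots> \<le> q ^ Suc j * fact (Suc j)" by (rule pochhammer_le_power_fact[OF assms(2)])
  also have "\<dots> \<le> q ^ Suc j * fact (j + 2)"
    using assms(2) by (intro mult_left_mono fact_mono) auto
  finally show ?thesis unfolding tail_coeff_def norm_divide norm_fact by (simp add: field_simps del: fact_Suc pochhammer_Suc power_Suc)
qed

text \<open>Induction over strips of unit width, towards the left. Measured in units of \<open>exp(Re s) a\<^bsup>1 - Re s\<^esup>\<close>, the
  terms of the recursion are at most the old bound times \<open>2\<^bsup>-j-1\<^esup>\<close>, and these factors add up to \<open>1\<close>, so
  that a new strip inherits the old bound and only the inhomogeneous term adds to it, by at most \<open>exp R\<close>.\<close>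

lemma num_tail_strip_bound:
  fixes R :: real
  assumes R: "R \<ge> 1" and a: "real a \<ge> 24 * R"
    and s: "\<bar>Im s\<bar> \<le> R" "Re s \<ge> - R" "Re s \<ge> 2 - real m"
  shows "norm (num_tail a s) \<le> (R + 1 + real m * exp R) * exp (Re s) * real a powr (1 - Re s)"
  using s
proof (induction m arbitrary: s)
  have a1: "a \<ge> 2" using a R by linarith
  {
    case 0
    have "norm (num_tail a s) \<le> norm (s - 1) * real a powr (1 - Re s)"
      using 0 a1 by (subst num_tail_eq_ztail) (auto intro!: norm_ztail_le)
    also have "norm (s - 1) \<le> \<bar>Re s - 1\<bar> + \<bar>Im s\<bar>" using cmod_le[of "s - 1"] by simp
    also have "\<bar>Re s - 1\<bar> + \<bar>Im s\<bar> \<le> (R + 1) * exp (Re s)"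
    proof -
      have e: "exp (Re s) \<ge> 1 + Re s" by (rule exp_ge_add_one_self)
      hence "R * 1 \<le> R * exp (Re s)" using 0 R by (intro mult_left_mono) auto
      thus ?thesis using e 0 unfolding distrib_right by linarith
    qed
    finally show ?case by (simp add: mult_right_mono)
  next
    case (Suc m)
    define B where "B = R + 1 + real m * exp R"
    have B: "B \<ge> 0" using R by (simp add: B_def)
    show ?case
    proof (cases "Re s \<ge> 2")
      case True
      hence "norm (num_tail a s) \<le> B * exp (Re s) * real a powr (1 - Re s)"
        unfolding B_def using Suc by (intro Suc.IH) auto
      also have "\<dots> \<le> (R + 1 + real (Suc m) * exp R) * exp (Re s) * real a powr (1 - Re s)"
        unfolding B_def by (intro mult_right_mono) auto
      finally show ?thesis .
    next
      case False
      define C where "C = B * exp (Re s) * real a powr (1 - Re s)"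
      have C: "C \<ge> 0" using B by (simp add: C_def)
      have q: "norm (s - 1) \<le> 3 * R"
        using cmod_le[of "s - 1"] Suc.prems False R by (simp add: abs_if split: if_splits)
      have bd: "norm (tail_coeff s j * num_tail a (s + of_nat (Suc j))) \<le> C * (1/2) ^ Suc j" for j
      proof -
        have 1: "norm (tail_coeff s j) \<le> (3 * R) ^ Suc j" using q R by (intro norm_tail_coeff_le) auto
        have 2: "norm (num_tail a (s + of_nat (Suc j))) \<le>
            B * exp (Re (s + of_nat (Suc j))) * real a powr (1 - Re (s + of_nat (Suc j)))"
          unfolding B_def using Suc.prems by (intro Suc.IH) auto
        have e: "exp (Re (s + of_nat (Suc j))) = exp (Re s) * exp 1 ^ Suc j"
          by (simp add: exp_add exp_of_nat_mult[symmetric] algebra_simps del: of_nat_Suc power_Suc)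
        have "real a powr (1 - Re (s + of_nat (Suc j))) = real a powr (1 - Re s - real (Suc j))"
          by (simp add: algebra_simps)
        also have "\<dots> = real a powr (1 - Re s) / real a ^ Suc j"
          unfolding powr_diff[of "real a" "1 - Re s"] using a1 by (subst powr_realpow) auto
        finally have p: "real a powr (1 - Re (s + of_nat (Suc j))) = real a powr (1 - Re s) / real a ^ Suc j" .
        have "norm (tail_coeff s j * num_tail a (s + of_nat (Suc j))) \<le>
           (3 * R) ^ Suc j * (B * (exp (Re s) * exp 1 ^ Suc j) * (real a powr (1 - Re s) / real a ^ Suc j))"
          unfolding norm_mult using 1 2 R unfolding e p by (intro mult_mono) auto
        also have "\<dots> = C * (3 * R * exp 1 / real a) ^ Suc j"
          unfolding C_def power_mult_distrib power_divide by (simp add: field_simps del: power_Suc)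
        also have "\<dots> \<le> C * (1/2) ^ Suc j"
        proof -
          \<comment> \<open>here \<open>24 R \<le> a\<close> enters: \<open>|s - 1| \<le> 3 R\<close> and \<open>e \<le> 3\<close> give the ratio \<open>1/2\<close>\<close>
          have "3 * R * exp 1 \<le> 3 * R * 3" using exp_le R by (intro mult_left_mono) auto
          also have "\<dots> \<le> real a / 2" using a R by linarith
          finally have "3 * R * exp 1 / real a \<le> 1/2" using a1 by (simp add: field_simps)
          thus ?thesis using C R by (intro mult_left_mono power_mono) auto
        qed
        finally show ?thesis .
      qed
      have geo: "(\<lambda>j. C * (1/2) ^ Suc j) sums C"
        using sums_mult[OF power_half_series, of C] by simp
      have "norm (\<Sum>j. tail_coeff s j * num_tail a (s + of_nat (Suc j))) \<le> C"
        using norm_suminf_le[OF bd sums_summable[OF geo]] sums_unique[OF geo] by simp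
      moreover have "num_tail a s = of_nat a powr (1 - s) - (\<Sum>j. tail_coeff s j * num_tail a (s + of_nat (Suc j)))"
        using num_tail_recursion[OF a1, of s] by (simp add: tail_step_def)
      moreover have "norm (of_nat a powr (1 - s)) = real a powr (1 - Re s)"
        using a1 by (subst norm_nat_powr) auto
      ultimately have "norm (num_tail a s) \<le> real a powr (1 - Re s) + C"
        using norm_triangle_ineq4[of "of_nat a powr (1 - s)" "\<Sum>j. tail_coeff s j * num_tail a (s + of_nat (Suc j))"]
        by simp
      also have "real a powr (1 - Re s) \<le> exp R * exp (Re s) * real a powr (1 - Re s)"
      proof -
        have "exp 0 \<le> exp (R + Re s)" using Suc.prems by (subst exp_le_cancel_iff) auto
        thus ?thesis by (simp add: exp_add mult_le_cancel_right1)
      qed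
      also have "exp R * exp (Re s) * real a powr (1 - Re s) + C =
          (R + 1 + real (Suc m) * exp R) * exp (Re s) * real a powr (1 - Re s)"
        by (simp add: C_def B_def algebra_simps)
      finally show ?thesis by simp
    qed
  }
qed

text \<open>About \<open>N\<close> strips lead from the half-plane of convergence to the disc of radius \<open>N\<close>. The factor
  \<open>a\<^bsup>1 + N\<^esup>\<close> with \<open>a = 24 N\<close> dominates; it is \<open>exp(O(N log N))\<close>, and the logarithm is absorbed into \<open>\<surd>N\<close>.\<close>

lemma zeta_num_growth_nat:
  fixes N :: nat
  assumes N: "N \<ge> 1" and s: "norm s \<le> real N"
  shows "norm (zeta_num s) \<le> exp (30 * real N * sqrt (real N))"
proof -
  define R where "R = real N"
  have R: "R \<ge> 1" using N by (simp add: R_def)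
  define a where "a = 24 * N"
  have a: "real a = 24 * R" by (simp add: a_def R_def)
  let ?S = "\<Sum>n=1..a. of_nat n powr (- s)"
  define P where "P = real a powr (1 + R)"
  have re: "\<bar>Re s\<bar> \<le> R" "\<bar>Im s\<bar> \<le> R"
    using s abs_Re_le_cmod[of s] abs_Im_le_cmod[of s] by (auto simp: R_def)
  have sq: "sqrt R \<ge> 1" using R by simp
  have P: "P \<le> exp (20 * R * sqrt R)"
  proof -
    have "ln (24 * R) = 2 * ln (sqrt (24 * R))" using R by (simp add: ln_sqrt)
    also have "ln (sqrt (24 * R)) \<le> sqrt (24 * R) - 1"
      using R by (intro ln_le_minus_one) auto
    also have "sqrt (24 * R) - 1 \<le> sqrt (25 * R)"
    proof -
      have "sqrt (24 * R) \<le> sqrt (25 * R)" using R by (intro real_sqrt_le_mono) auto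
      thus ?thesis by linarith
    qed
    also have "sqrt (25 * R) = 5 * sqrt R" by (simp add: real_sqrt_mult)
    finally have l: "ln (24 * R) \<le> 10 * sqrt R" by simp
    have "P = exp ((1 + R) * ln (24 * R))" unfolding P_def a using R by (simp add: powr_def)
    also have "(1 + R) * ln (24 * R) \<le> (2 * R) * (10 * sqrt R)"
      using R l by (intro mult_mono) auto
    finally show ?thesis by (simp add: mult.assoc)
  qed
  have pw: "real a powr (1 - Re s) \<le> P"
    unfolding P_def using re R a by (intro powr_mono) auto
  define m where "m = N + 2"
  have "norm (num_tail a s) \<le> (R + 1 + real m * exp R) * exp (Re s) * real a powr (1 - Re s)"
    by (rule num_tail_strip_bound) (use R a re in \<open>auto simp: m_def R_def\<close>)
  also have "\<dots> \<le> exp (2 * R + 2) * exp R * exp R * P"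
  proof (intro mult_mono pw)
    have "exp (R + 2) \<ge> R + 3" using exp_ge_add_one_self[of "R + 2"] by simp
    moreover have "(R + 1 + real m * exp R) \<le> (2 * R + 3) * exp R"
    proof -
      have "(R + 1) * 1 \<le> (R + 1) * exp R" using R by (intro mult_left_mono) auto
      thus ?thesis by (simp add: m_def R_def algebra_simps)
    qed
    moreover have "exp (2 * R + 2) \<ge> 2 * R + 3" using exp_ge_add_one_self[of "2 * R + 2"] by simp
    hence "(2 * R + 3) * exp R \<le> exp (2 * R + 2) * exp R" by (intro mult_right_mono) auto
    ultimately show "R + 1 + real m * exp R \<le> exp (2 * R + 2) * exp R" by linarith
  qed (use re R in auto)
  also have "exp (2 * R + 2) * exp R * exp R = exp (4 * R + 2)" by (simp flip: exp_add)
  finally have 1: "norm (num_tail a s) \<le> exp (4 * R + 2) * P" .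
  have "norm ?S \<le> (\<Sum>n=1..a. real a powr R)"
  proof (rule sum_norm_le)
    fix n assume n: "n \<in> {1..a}"
    have "norm (of_nat n powr (- s)) = real n powr (- Re s)" using n by (subst norm_nat_powr) auto
    also have "\<dots> \<le> real n powr R" using n re by (intro powr_mono) auto
    also have "\<dots> \<le> real a powr R" using n R by (intro powr_mono2) auto
    finally show "norm (of_nat n powr (- s)) \<le> real a powr R" .
  qed
  also have "\<dots> = P" using a R by (simp add: P_def powr_add)
  finally have 2: "norm ?S \<le> P" .
  have 3: "norm (s - 1) \<le> exp (4 * R + 2)"
  proof -
    have "norm (s - 1) \<le> R + 1" using s norm_triangle_ineq4[of s 1] by (simp add: R_def)
    also have "\<dots> \<le> exp R" using exp_ge_add_one_self[of R] by linarith
    also have "\<dots> \<le> exp (4 * R + 2)" using R by simp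
    finally show ?thesis .
  qed
  have "zeta_num s = num_tail a s + (s - 1) * ?S" by (simp add: num_tail_def)
  hence "norm (zeta_num s) \<le> norm (num_tail a s) + norm (s - 1) * norm ?S"
    by (metis norm_mult norm_triangle_ineq)
  also have "\<dots> \<le> exp (4 * R + 2) * P + exp (4 * R + 2) * P"
    by (intro add_mono 1 mult_mono 2 3) auto
  also have "\<dots> = 2 * (exp (4 * R + 2) * P)" by simp
  also have "\<dots> \<le> exp 1 * (exp (4 * R + 2) * exp (20 * R * sqrt R))"
    using exp_ge_add_one_self[of 1] P by (intro mult_mono) (auto simp: P_def)
  also have "\<dots> = exp (4 * R + 3 + 20 * R * sqrt R)" by (simp flip: exp_add)
  also have "\<dots> \<le> exp (30 * R * sqrt R)"
  proof -
    have "R * 1 \<le> R * sqrt R" using sq R by (intro mult_left_mono) auto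
    hence "4 * R + 3 \<le> 10 * (R * sqrt R)" using R by linarith
    thus ?thesis by simp
  qed
  finally show ?thesis by (simp add: R_def)
qed

lemma zeta_num_growth:
  assumes r: "r \<ge> 1" and s: "norm s \<le> r"
  shows "norm (zeta_num s) \<le> exp (120 * r * sqrt r)"
proof -
  define N where "N = nat \<lceil>r\<rceil>"
  have N: "N \<ge> 1" "r \<le> real N" "real N \<le> 2 * r" using r unfolding N_def by linarith+
  have "norm (zeta_num s) \<le> exp (30 * real N * sqrt (real N))"
    using s N by (intro zeta_num_growth_nat) auto
  also have "30 * real N * sqrt (real N) \<le> 30 * (2 * r) * sqrt (4 * r)"
    using N r by (intro mult_mono real_sqrt_le_mono) auto
  also have "\<dots> = 120 * r * sqrt r" by (simp add: real_sqrt_mult)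
  finally show ?thesis by simp
qed

section \<open>Entire functions of moderate growth and their zeros\<close>

text \<open>The summand of the series \<open>G\<close>.\<close>

abbreviation G_term :: "(complex \<Rightarrow> complex) \<Rightarrow> complex \<Rightarrow> complex \<Rightarrow> complex \<Rightarrow> complex" where
  "G_term f \<sigma> z \<rho> \<equiv> of_int (zorder f \<rho>) * ((z - \<sigma>) / (\<rho> - \<sigma>)) * (1 / (z - \<rho>))"

lemma finite_zeros_in_compact:
  assumes "f holomorphic_on UNIV" "f (\<sigma>::complex) \<noteq> 0" "compact K"
  shows "finite {z\<in>K. f z = 0}"
proof (cases "f constant_on UNIV")
  case True
  hence "f z \<noteq> 0" for z using assms(2) unfolding constant_on_def by (metis UNIV_I)
  thus ?thesis by simp
next
  case False
  show ?thesis by (rule holomorphic_compact_finite_zeros[OF assms(1) _ _ assms(3) _ False]) auto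
qed

text \<open>Near a zero \<open>f\<close> is a power times a nonvanishing function, which provides the value of the quotient
  there.\<close>

lemma entire_divide_zeros:
  assumes f: "f holomorphic_on UNIV" "f (\<sigma>::complex) \<noteq> 0" and S: "finite S" "\<And>\<rho>. \<rho> \<in> S \<Longrightarrow> f \<rho> = 0"
  shows "\<exists>g. g holomorphic_on UNIV \<and> (\<forall>z. f z = g z * (\<Prod>\<rho>\<in>S. (z - \<rho>) ^ nat (zorder f \<rho>))) \<and> (\<forall>\<rho>\<in>S. g \<rho> \<noteq> 0)"
  using S
proof (induction S rule: finite_induct)
  case empty
  thus ?case using f(1) by (intro exI[of _ f]) auto
next
  case (insert \<rho> S)
  then obtain g where g: "g holomorphic_on UNIV" "\<And>z. f z = g z * (\<Prod>\<rho>\<in>S. (z - \<rho>) ^ nat (zorder f \<rho>))"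
    "\<And>\<rho>. \<rho> \<in> S \<Longrightarrow> g \<rho> \<noteq> 0" by auto
  define n where "n = nat (zorder f \<rho>)"
  define P where "P z = (\<Prod>\<rho>\<in>S. (z - \<rho>) ^ nat (zorder f \<rho>))" for z
  have P0: "P z \<noteq> 0" if "z \<notin> S" for z using that insert.hyps by (auto simp: P_def)
  obtain r h where r: "r > 0" "h holomorphic_on cball \<rho> r"
    "\<And>w. w \<in> cball \<rho> r \<Longrightarrow> f w = h w * (w - \<rho>) ^ n \<and> h w \<noteq> 0"
    using zorder_exist_zero[OF f(1) open_UNIV connected_UNIV UNIV_I, of \<rho>] f(2) unfolding n_def by blast
  define U where "U = ball \<rho> r - S"
  have U: "open U" "\<rho> \<in> U" using insert.hyps r(1) unfolding U_def
    by (auto intro!: open_Diff finite_imp_closed)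
  define g' where "g' w = (if w = \<rho> then h \<rho> / P \<rho> else g w / (w - \<rho>) ^ n)" for w
  have gU: "g' w = h w / P w" if "w \<in> U" for w
  proof (cases "w = \<rho>")
    case False
    have "g w * P w = h w * (w - \<rho>) ^ n" using r(3)[of w] g(2)[of w] that by (simp add: U_def P_def)
    moreover have "P w \<noteq> 0" using that P0 by (auto simp: U_def)
    ultimately have "g w = h w * (w - \<rho>) ^ n / P w" by (simp add: field_simps)
    thus ?thesis using False by (simp add: g'_def)
  qed (simp add: g'_def)
  have "(\<lambda>w. h w / P w) holomorphic_on U"
    unfolding P_def using r(2) P0
    by (intro holomorphic_intros) (auto simp: U_def P_def elim!: holomorphic_on_subset)
  hence 1: "g' holomorphic_on U" by (rule holomorphic_transform) (use gU in auto)
  have "(\<lambda>w. g w / (w - \<rho>) ^ n) holomorphic_on - {\<rho>}"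
    by (intro holomorphic_intros holomorphic_on_subset[OF g(1)]) auto
  hence 2: "g' holomorphic_on - {\<rho>}" by (rule holomorphic_transform) (auto simp: g'_def)
  have "g' holomorphic_on U \<union> - {\<rho>}"
    by (rule holomorphic_on_Un[OF 1 2]) (use U in auto)
  moreover have "U \<union> - {\<rho>} = UNIV" using U by auto
  ultimately have hol: "g' holomorphic_on UNIV" by simp
  have n0: "n > 0"
    using zorder_exist_zero[OF f(1) open_UNIV connected_UNIV UNIV_I, of \<rho>] f(2) insert.prems unfolding n_def
    by (metis UNIV_I insertI1 zero_less_nat_eq)
  have eq: "f z = g' z * (\<Prod>\<rho>\<in>insert \<rho> S. (z - \<rho>) ^ nat (zorder f \<rho>))" for z
  proof (cases "z = \<rho>")
    case True
    thus ?thesis using n0 insert by (simp add: n_def)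
  next
    case False
    thus ?thesis using g(2)[of z] insert.hyps by (simp add: g'_def n_def)
  qed
  have nz: "g' w \<noteq> 0" if "w \<in> insert \<rho> S" for w
    using that r(3)[of \<rho>] r(1) P0 g(3)[of w] insert.hyps by (auto simp: g'_def)
  show ?case using hol eq nz by blast
qed

lemma has_field_derivative_prod_powers:
  fixes S :: "'a::real_normed_field set"
  assumes "finite S" "w \<notin> S"
  shows "((\<lambda>z. \<Prod>\<rho>\<in>S. ((z - \<rho>) / (\<sigma> - \<rho>)) ^ m \<rho>) has_field_derivative
     (\<Prod>\<rho>\<in>S. ((w - \<rho>) / (\<sigma> - \<rho>)) ^ m \<rho>) * (\<Sum>\<rho>\<in>S. of_nat (m \<rho>) / (w - \<rho>))) (at w)"
  using assms
proof (induction S rule: finite_induct)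
  case (insert \<rho> S)
  define P where "P z = (\<Prod>\<rho>\<in>S. ((z - \<rho>) / (\<sigma> - \<rho>)) ^ m \<rho>)" for z
  define T where "T = (\<Sum>\<rho>\<in>S. of_nat (m \<rho>) / (w - \<rho>))"
  have w: "w \<noteq> \<rho>" using insert by auto
  have d1: "((\<lambda>z. ((z - \<rho>) / (\<sigma> - \<rho>)) ^ m \<rho>) has_field_derivative
      ((w - \<rho>) / (\<sigma> - \<rho>)) ^ m \<rho> * (of_nat (m \<rho>) / (w - \<rho>))) (at w)"
  proof (cases "m \<rho>")
    case (Suc k)
    have "((\<lambda>z. ((z - \<rho>) / (\<sigma> - \<rho>)) ^ Suc k) has_field_derivative
       of_nat (Suc k) * (((w - \<rho>) / (\<sigma> - \<rho>)) ^ k * (1 / (\<sigma> - \<rho>)))) (at w)"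
    proof -
      have "((\<lambda>z. (z - \<rho>) / (\<sigma> - \<rho>)) has_field_derivative 1 / (\<sigma> - \<rho>)) (at w)"
        by (intro DERIV_cdivide) (auto intro!: derivative_eq_intros)
      from DERIV_power[OF this, of "Suc k"] show ?thesis by (simp add: mult_ac del: power_Suc of_nat_Suc)
    qed
    moreover have "of_nat (Suc k) * (((w - \<rho>) / (\<sigma> - \<rho>)) ^ k * (1 / (\<sigma> - \<rho>))) =
       ((w - \<rho>) / (\<sigma> - \<rho>)) ^ Suc k * (of_nat (Suc k) / (w - \<rho>))"
    proof (cases "\<sigma> = \<rho>")
      case True
      thus ?thesis by (simp only: diff_self division_ring_divide_zero power_0_Suc mult_zero_left mult_zero_right)
    next
      case False
      have "c * ((x / y) ^ k * (1 / y)) = (x / y) ^ Suc k * (c / x)" if "x \<noteq> 0" "y \<noteq> 0" for c x y :: 'a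
        using that by (simp add: field_simps)
      thus ?thesis using w False by simp
    qed
    ultimately show ?thesis unfolding Suc by metis
  qed simp
  have d2: "(P has_field_derivative P w * T) (at w)"
    using insert unfolding P_def T_def by auto
  have "((\<lambda>z. ((z - \<rho>) / (\<sigma> - \<rho>)) ^ m \<rho> * P z) has_field_derivative
     ((w - \<rho>) / (\<sigma> - \<rho>)) ^ m \<rho> * (of_nat (m \<rho>) / (w - \<rho>)) * P w +
     P w * T * ((w - \<rho>) / (\<sigma> - \<rho>)) ^ m \<rho>) (at w)"
    by (rule DERIV_mult[OF d1 d2])
  moreover have "((w - \<rho>) / (\<sigma> - \<rho>)) ^ m \<rho> * (of_nat (m \<rho>) / (w - \<rho>)) * P w +
     P w * T * ((w - \<rho>) / (\<sigma> - \<rho>)) ^ m \<rho> =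
     ((w - \<rho>) / (\<sigma> - \<rho>)) ^ m \<rho> * P w * (of_nat (m \<rho>) / (w - \<rho>) + T)"
    by (simp add: algebra_simps)
  ultimately show ?case using insert.hyps by (simp add: P_def T_def)
qed simp

text \<open>The map \<open>w \<mapsto> w / (2 B - w)\<close> sends the half-plane \<open>Re w < B\<close> into the unit disc and fixes \<open>0\<close>, so
  Schwarz' lemma applies to its composition with \<open>h\<close>.\<close>

lemma Borel_Caratheodory:
  assumes h: "h holomorphic_on ball \<sigma> R" "h \<sigma> = 0" and R: "R > 0" and B: "B > 0"
    and Re: "\<And>w. w \<in> ball \<sigma> R \<Longrightarrow> Re (h w) < B" and w: "norm (w - \<sigma>) \<le> R / 2"
  shows "norm (h w) \<le> 2 * B"
proof -
  define \<phi> where "\<phi> u = h (\<sigma> + of_real R * u) / (2 * of_real B - h (\<sigma> + of_real R * u))" for u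
  have inb: "\<sigma> + of_real R * u \<in> ball \<sigma> R" if "norm u < 1" for u
    using that R by (simp add: dist_norm norm_mult)
  have nz: "2 * of_real B - h (\<sigma> + of_real R * u) \<noteq> 0" if "norm u < 1" for u
  proof
    assume "2 * of_real B - h (\<sigma> + of_real R * u) = 0"
    hence "Re (h (\<sigma> + of_real R * u)) = 2 * B" by (metis Re_complex_of_real eq_iff_diff_eq_0 of_real_mult of_real_numeral)
    with Re[OF inb[OF that]] B show False by simp
  qed
  have hc: "(h \<circ> (\<lambda>u. \<sigma> + of_real R * u)) holomorphic_on ball 0 1"
    by (rule holomorphic_on_compose_gen[OF _ h(1)]) (auto intro!: holomorphic_intros inb simp del: mem_ball)
  have hol: "\<phi> holomorphic_on ball 0 1"
    unfolding \<phi>_def using hc nz by (intro holomorphic_intros) (auto simp: o_def)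
  have lt: "norm (\<phi> u) < 1" if "norm u < 1" for u
  proof -
    let ?z = "h (\<sigma> + of_real R * u)"
    have "Re ?z < B" by (rule Re[OF inb[OF that]])
    hence "(Re ?z)\<^sup>2 < (2 * B - Re ?z)\<^sup>2"
      using B mult_pos_pos[of B "B - Re ?z"] by (simp add: power2_eq_square algebra_simps)
    hence "(norm ?z)\<^sup>2 < (norm (2 * of_real B - ?z))\<^sup>2"
      by (simp add: cmod_power2)
    hence "norm ?z < norm (2 * of_real B - ?z)" by (rule power_less_imp_less_base) simp
    thus ?thesis unfolding \<phi>_def norm_divide using nz[OF that] by (simp add: divide_less_eq)
  qed
  define u where "u = (w - \<sigma>) / of_real R"
  have u: "norm u \<le> 1/2" using w R by (simp add: u_def norm_divide field_simps)
  have uw: "\<sigma> + of_real R * u = w" using R by (simp add: u_def)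
  have "norm (\<phi> u) \<le> norm u"
    by (rule Schwarz_Lemma(1)[OF hol _ lt]) (use u h(2) in \<open>auto simp: \<phi>_def\<close>)
  hence "norm (\<phi> u) \<le> 1/2" using u by simp
  hence "norm (h w) \<le> 1/2 * norm (2 * of_real B - h w)"
    unfolding \<phi>_def uw norm_divide using nz[of u] u uw by (simp add: field_simps)
  also have "norm (2 * of_real B - h w) \<le> 2 * B + norm (h w)"
    using norm_triangle_ineq4[of "2 * of_real B" "h w"] B by (simp add: norm_mult)
  finally show ?thesis by simp
qed

text \<open>Cauchy's inequality on circles of radius \<open>R/4\<close> bounds the second derivative.\<close>

lemma deriv_diff_bound:
  assumes h: "h holomorphic_on ball \<sigma> R" and R: "R > 0"
    and B: "\<And>w. norm (w - \<sigma>) \<le> R / 2 \<Longrightarrow> norm (h w) \<le> B" and z: "norm (z - \<sigma>) \<le> R / 4"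
  shows "norm (deriv h z - deriv h \<sigma>) \<le> 32 * B / R\<^sup>2 * norm (z - \<sigma>)"
proof (rule field_differentiable_bound[of "cball \<sigma> (R/4)" _ "deriv (deriv h)"])
  fix w assume w: "w \<in> cball \<sigma> (R/4)"
  have "deriv h holomorphic_on ball \<sigma> R" by (rule holomorphic_deriv[OF h]) auto
  moreover have "w \<in> ball \<sigma> R" using w R by auto
  ultimately show "(deriv h has_field_derivative deriv (deriv h) w) (at w within cball \<sigma> (R/4))"
    by (intro has_field_derivative_at_within[OF holomorphic_derivI[of _ "ball \<sigma> R"]]) auto
  have sub: "cball w (R/4) \<subseteq> ball \<sigma> R"
  proof
    fix x assume "x \<in> cball w (R/4)"
    thus "x \<in> ball \<sigma> R" using w R dist_triangle[of \<sigma> x w] by auto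
  qed
  have "norm ((deriv ^^ 2) h w) \<le> fact 2 * B / (R/4)^2"
  proof (rule Cauchy_inequality)
    show "h holomorphic_on ball w (R/4)" using sub h by (meson ball_subset_cball holomorphic_on_subset order_trans)
    show "continuous_on (cball w (R/4)) h"
      using sub h by (meson holomorphic_on_imp_continuous_on holomorphic_on_subset)
    show "norm (h x) \<le> B" if "norm (w - x) = R/4" for x
    proof (rule B)
      have "dist x \<sigma> \<le> dist x w + dist w \<sigma>" by (rule dist_triangle)
      thus "norm (x - \<sigma>) \<le> R / 2" using w that by (simp add: dist_norm norm_minus_commute)
    qed
  qed (use R in auto)
  thus "norm (deriv (deriv h) w) \<le> 32 * B / R\<^sup>2"
    by (simp add: numeral_2_eq_2 power2_eq_square field_simps)
qed (use z R in \<open>auto simp: dist_norm norm_minus_commute\<close>)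

text \<open>Exponent \<open>3/2\<close> leaves room for the logarithm in \<open>|s| log |s|\<close>, and being below \<open>2\<close> it makes the sum of
  \<open>|\<rho> - \<sigma>|\<^sup>-\<^sup>2\<close> converge and the logarithmic derivative of the zero-free part constant in the limit.\<close>

locale entire_moderate_growth =
  fixes f :: "complex \<Rightarrow> complex" and \<sigma> :: complex and A :: real
  assumes hol: "f holomorphic_on UNIV" and nz: "f \<sigma> \<noteq> 0"
    and growth: "\<And>z r. r \<ge> 1 \<Longrightarrow> norm (z - \<sigma>) \<le> r \<Longrightarrow> norm (f z) \<le> exp (A * r * sqrt r)"
begin

definition Z where "Z = {\<rho>. f \<rho> = 0}"
definition ZR where "ZR R = {\<rho>. f \<rho> = 0 \<and> norm (\<rho> - \<sigma>) \<le> R}"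
definition m where "m \<rho> = nat (zorder f \<rho>)"
text \<open>Adapted to \<open>growth_C\<close>, where the summand \<open>1\<close> makes the inequality strict.\<close>

definition C where "C = 6 * \<bar>A\<bar> + \<bar>ln (norm (f \<sigma>))\<bar> + 1"

lemma C_pos: "C \<ge> 1" by (simp add: C_def)

lemma finite_ZR: "finite (ZR R)"
proof -
  have "ZR R = {z \<in> cball \<sigma> R. f z = 0}" by (auto simp: ZR_def dist_norm norm_minus_commute)
  thus ?thesis using finite_zeros_in_compact[OF hol nz, of "cball \<sigma> R"] by simp
qed

lemma zorder_eq_m: "f \<rho> = 0 \<Longrightarrow> zorder f \<rho> = int (m \<rho>)"
  using zorder_exist_zero[OF hol open_UNIV connected_UNIV UNIV_I, of \<rho>] nz unfolding m_def by force

lemma growth_C: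
  assumes "R \<ge> 1"
  shows "exp (A * (3 * R) * sqrt (3 * R)) < exp (C * R * sqrt R) * norm (f \<sigma>)"
proof -
  have s1: "sqrt R \<ge> 1" using assms by simp
  have RS: "R * sqrt R \<ge> 1" using mult_mono[of 1 R 1 "sqrt R"] assms s1 by simp
  have "sqrt (3 * R) \<le> sqrt (4 * R)" using assms by (intro real_sqrt_le_mono) auto
  also have "\<dots> = 2 * sqrt R" by (simp add: real_sqrt_mult)
  finally have s: "sqrt (3 * R) \<le> 2 * sqrt R" .
  have "A * (3 * R) * sqrt (3 * R) \<le> \<bar>A\<bar> * (3 * R) * (2 * sqrt R)"
    using s assms by (intro mult_mono) auto
  also have "\<dots> = 6 * \<bar>A\<bar> * (R * sqrt R)" by simp
  also have "\<dots> < C * R * sqrt R + ln (norm (f \<sigma>))"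
  proof -
    have "\<bar>ln (norm (f \<sigma>))\<bar> * 1 \<le> \<bar>ln (norm (f \<sigma>))\<bar> * (R * sqrt R)"
      using RS by (intro mult_left_mono) auto
    moreover have "C * R * sqrt R = 6 * \<bar>A\<bar> * (R * sqrt R) + \<bar>ln (norm (f \<sigma>))\<bar> * (R * sqrt R) + R * sqrt R"
      by (simp add: C_def algebra_simps)
    moreover have "- \<bar>ln (norm (f \<sigma>))\<bar> \<le> ln (norm (f \<sigma>))" by linarith
    ultimately show ?thesis using RS by linarith
  qed
  finally have "exp (A * (3 * R) * sqrt (3 * R)) < exp (C * R * sqrt R + ln (norm (f \<sigma>)))" by simp
  thus ?thesis using nz by (simp add: exp_add)
qed

text \<open>On the circle of radius \<open>3 R\<close> each of the factors \<open>(z - \<rho>) / (\<sigma> - \<rho>)\<close> has modulus at least \<open>2\<close>. By the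
  maximum principle the quotient \<open>g\<close> is bounded by the maximum of \<open>f\<close> on that circle, with a gain of \<open>2\<close>
  for every zero. The factors are \<open>1\<close> at \<open>\<sigma>\<close>, so that \<open>g\<close> keeps the value of \<open>f\<close> there.\<close>

lemma zero_free_part:
  assumes R: "R \<ge> 1"
  obtains g where "g holomorphic_on UNIV"
    "\<And>z. f z = g z * (\<Prod>\<rho>\<in>ZR R. ((z - \<rho>) / (\<sigma> - \<rho>)) ^ m \<rho>)"
    "\<And>z. norm (z - \<sigma>) \<le> R \<Longrightarrow> g z \<noteq> 0" "g \<sigma> = f \<sigma>"
    "\<And>z. norm (z - \<sigma>) \<le> 3 * R \<Longrightarrow>
       2 ^ (\<Sum>\<rho>\<in>ZR R. m \<rho>) * norm (g z) < exp (C * R * sqrt R) * norm (f \<sigma>)"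
proof -
  obtain g0 where g0: "g0 holomorphic_on UNIV"
    "\<And>z. f z = g0 z * (\<Prod>\<rho>\<in>ZR R. (z - \<rho>) ^ nat (zorder f \<rho>))" "\<And>\<rho>. \<rho> \<in> ZR R \<Longrightarrow> g0 \<rho> \<noteq> 0"
  proof -
    have "f \<rho> = 0" if "\<rho> \<in> ZR R" for \<rho> using that by (simp add: ZR_def)
    from entire_divide_zeros[OF hol nz finite_ZR this] show ?thesis using that by blast
  qed
  define c where "c = (\<Prod>\<rho>\<in>ZR R. (\<sigma> - \<rho>) ^ m \<rho>)"
  define g where "g z = g0 z * c" for z
  define P where "P z = (\<Prod>\<rho>\<in>ZR R. ((z - \<rho>) / (\<sigma> - \<rho>)) ^ m \<rho>)" for z
  have ne: "\<rho> \<noteq> \<sigma>" if "\<rho> \<in> ZR R" for \<rho> using that nz by (auto simp: ZR_def)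
  have c0: "c \<noteq> 0" unfolding c_def using finite_ZR ne by auto
  have fg: "f z = g z * P z" for z
    using g0(2)[of z] c0 unfolding g_def P_def power_divide prod_dividef c_def[symmetric] m_def[symmetric] by simp
  have P\<sigma>: "P \<sigma> = 1" unfolding P_def using ne by (intro prod.neutral) auto
  have holg: "g holomorphic_on UNIV" unfolding g_def by (intro holomorphic_intros g0)
  have nzg: "g z \<noteq> 0" if "norm (z - \<sigma>) \<le> R" for z
  proof (cases "f z = 0")
    case True
    hence "g0 z \<noteq> 0" using that by (intro g0(3)) (simp add: ZR_def)
    thus ?thesis using c0 by (simp add: g_def)
  next
    case False
    thus ?thesis using fg by auto
  qed
  define k where "k = (\<Sum>\<rho>\<in>ZR R. m \<rho>)"
  define M where "M = exp (A * (3 * R) * sqrt (3 * R))"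
  have sph: "norm (g z) \<le> M / 2 ^ k" if "norm (z - \<sigma>) = 3 * R" for z
  proof -
    have "2 ^ k = (\<Prod>\<rho>\<in>ZR R. 2 ^ m \<rho> :: real)" by (simp add: k_def power_sum)
    also have "\<dots> \<le> (\<Prod>\<rho>\<in>ZR R. norm (((z - \<rho>) / (\<sigma> - \<rho>)) ^ m \<rho>))"
    proof (intro prod_mono conjI)
      fix \<rho> assume r: "\<rho> \<in> ZR R"
      have "norm (\<sigma> - \<rho>) \<le> R" using r by (simp add: ZR_def norm_minus_commute)
      moreover have "norm (z - \<sigma>) \<le> norm (z - \<rho>) + norm (\<sigma> - \<rho>)"
        using norm_triangle_ineq4[of "z - \<rho>" "\<sigma> - \<rho>"] by simp
      ultimately have "2 * norm (\<sigma> - \<rho>) \<le> norm (z - \<rho>)" using that by linarith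
      hence "2 \<le> norm ((z - \<rho>) / (\<sigma> - \<rho>))" using ne[OF r] by (simp add: norm_divide le_divide_eq)
      thus "2 ^ m \<rho> \<le> norm (((z - \<rho>) / (\<sigma> - \<rho>)) ^ m \<rho>)"
        unfolding norm_power by (intro power_mono) auto
    qed auto
    also have "\<dots> = norm (P z)" unfolding P_def by (simp add: prod_norm)
    finally have "2 ^ k \<le> norm (P z)" .
    hence "norm (g z) * 2 ^ k \<le> norm (g z) * norm (P z)" by (intro mult_left_mono) auto
    also have "\<dots> = norm (f z)" by (simp add: fg norm_mult)
    also have "\<dots> \<le> M" unfolding M_def using that R by (intro growth) auto
    finally show ?thesis by (simp add: field_simps)
  qed
  have ins: "norm (g z) \<le> M / 2 ^ k" if "norm (z - \<sigma>) \<le> 3 * R" for z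
  proof (rule maximum_modulus_frontier[of g "cball \<sigma> (3 * R)"])
    show "g holomorphic_on interior (cball \<sigma> (3 * R))" using holg holomorphic_on_subset by blast
    show "continuous_on (closure (cball \<sigma> (3 * R))) g"
      using holg holomorphic_on_imp_continuous_on holomorphic_on_subset by blast
    show "z \<in> cball \<sigma> (3 * R)" using that by (simp add: dist_norm norm_minus_commute)
    fix z assume "z \<in> frontier (cball \<sigma> (3 * R))"
    thus "norm (g z) \<le> M / 2 ^ k"
      using R by (intro sph) (auto simp: dist_norm norm_minus_commute)
  qed auto
  have bd: "2 ^ k * norm (g z) < exp (C * R * sqrt R) * norm (f \<sigma>)" if "norm (z - \<sigma>) \<le> 3 * R" for z
  proof -
    have "2 ^ k * norm (g z) \<le> M"
      using ins[OF that]
      by (simp add: pos_le_divide_eq mult.commute)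
    thus ?thesis using growth_C[OF R] unfolding M_def by (rule le_less_trans)
  qed
  show ?thesis using that[of g] holg fg[unfolded P_def] nzg fg[of \<sigma>] P\<sigma> bd unfolding k_def by simp
qed

text \<open>At \<open>z = \<sigma>\<close> the gain in \<open>zero_free_part\<close> bounds the number of zeros.\<close>

lemma zero_count:
  assumes R: "R \<ge> 1"
  shows "real (\<Sum>\<rho>\<in>ZR R. m \<rho>) \<le> 2 * C * R * sqrt R"
proof -
  define k where "k = (\<Sum>\<rho>\<in>ZR R. m \<rho>)"
  obtain g where g: "g \<sigma> = f \<sigma>" "\<And>z. norm (z - \<sigma>) \<le> 3 * R \<Longrightarrow>
       2 ^ k * norm (g z) < exp (C * R * sqrt R) * norm (f \<sigma>)"
    unfolding k_def by (rule zero_free_part[OF R]) blast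
  have "2 ^ k * norm (f \<sigma>) < exp (C * R * sqrt R) * norm (f \<sigma>)" using g(2)[of \<sigma>] g(1) R by simp
  hence "2 ^ k < exp (C * R * sqrt R)" using nz by simp
  hence "ln (2 ^ k) < C * R * sqrt R" by (metis exp_less_cancel_iff exp_ln zero_less_numeral zero_less_power)
  hence "real k * ln 2 < C * R * sqrt R" by (simp add: ln_realpow)
  moreover have "real k * (1/2) \<le> real k * ln 2"
    using ln2_ge_two_thirds by (intro mult_left_mono) auto
  ultimately show ?thesis by (simp add: k_def)
qed

lemma zero_distance:
  assumes "f z \<noteq> 0"
  obtains d where "0 < d" "d \<le> 1" "\<And>\<rho>. f \<rho> = 0 \<Longrightarrow> d \<le> norm (\<rho> - z)"
proof -
  have "open {w. f w \<noteq> 0}"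
    using open_Collect_neq[of f "\<lambda>_. 0"] holomorphic_on_imp_continuous_on[OF hol] by simp
  then obtain e where e: "e > 0" "ball z e \<subseteq> {w. f w \<noteq> 0}"
    using assms openE[of "{w. f w \<noteq> 0}" z] by blast
  have "min e 1 \<le> norm (\<rho> - z)" if "f \<rho> = 0" for \<rho>
  proof (rule ccontr)
    assume "\<not> ?thesis"
    hence "\<rho> \<in> ball z e" by (auto simp: dist_norm norm_minus_commute)
    with e(2) that show False by auto
  qed
  thus ?thesis using that[of "min e 1"] e(1) by auto
qed

text \<open>Dyadic decomposition: a zero is charged to the least \<open>j\<close> with \<open>|\<rho> - \<sigma>| \<le> 2\<^sup>j\<close>. The zeros in that disc
  number \<open>O(2\<^bsup>3j/2\<^esup>)\<close> and each contributes \<open>O(4\<^bsup>-j\<^esup>)\<close>, which leaves a geometric series of ratio \<open>\<surd>2 / 2\<close>.\<close>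

lemma summable_inverse_squares: "(\<lambda>\<rho>. real (m \<rho>) / (norm (\<rho> - \<sigma>))\<^sup>2) summable_on Z"
proof -
  \<comment> \<open>the weight \<open>d\<^sup>-\<^sup>2\<close> lets the radii \<open>2\<^sup>j\<close> with \<open>j \<ge> 0\<close> also serve the zeros in the unit disc\<close>
  obtain d where d: "0 < d" "d \<le> 1" "\<And>\<rho>. f \<rho> = 0 \<Longrightarrow> d \<le> norm (\<rho> - \<sigma>)"
    using zero_distance[OF nz] by blast
  define q where "q = sqrt 2 / 2"
  have q: "0 \<le> q" "q < 1" using real_sqrt_less_mono[of 2 4] by (auto simp: q_def)
  define K where "K = 8 * C / d\<^sup>2 * (1 / (1 - q))"
  have "(\<Sum>\<rho>\<in>S. real (m \<rho>) / (norm (\<rho> - \<sigma>))\<^sup>2) \<le> K" if S: "S \<subseteq> Z" "finite S" for S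
  proof -
    obtain J where J: "\<And>\<rho>. \<rho> \<in> S \<Longrightarrow> norm (\<rho> - \<sigma>) \<le> 2 ^ J"
    proof -
      obtain B where B: "\<And>\<rho>. \<rho> \<in> S \<Longrightarrow> norm (\<rho> - \<sigma>) \<le> B"
        using finite_imp_bounded[OF finite_imageI[OF S(2), of "\<lambda>\<rho>. \<rho> - \<sigma>"]]
        by (auto simp: bounded_iff)
      obtain J where "B < 2 ^ J" using real_arch_pow[of 2 B] by auto
      thus ?thesis using B that by (meson less_imp_le order_trans)
    qed
    have pt: "1 / (norm (\<rho> - \<sigma>))\<^sup>2 \<le> (\<Sum>j\<le>J. 4 / (d\<^sup>2 * 4 ^ j) * of_bool (norm (\<rho> - \<sigma>) \<le> 2 ^ j))"
      if r: "\<rho> \<in> S" for \<rho>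
    proof -
      define x where "x = norm (\<rho> - \<sigma>)"
      have x: "x \<ge> d" using d(3)[of \<rho>] r S by (auto simp: x_def Z_def)
      hence x0: "x > 0" using d(1) by simp
      define j where "j = (LEAST j. x \<le> 2 ^ j)"
      have xJ: "x \<le> 2 ^ J" using J[OF r] by (simp add: x_def)
      have j: "x \<le> 2 ^ j" "j \<le> J" unfolding j_def
        by (rule LeastI[of "\<lambda>j. x \<le> 2 ^ j" J, OF xJ]) (rule Least_le[of "\<lambda>j. x \<le> 2 ^ j" J, OF xJ])
      have "1 / x\<^sup>2 \<le> 4 / (d\<^sup>2 * 4 ^ j)"
      proof (cases j)
        case 0
        have "d\<^sup>2 \<le> x\<^sup>2" using x d by (intro power_mono) auto
        hence "1 / x\<^sup>2 \<le> 1 / d\<^sup>2" using d x0 by (intro divide_left_mono) auto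
        also have "\<dots> \<le> 4 / d\<^sup>2" by (intro divide_right_mono) auto
        finally show ?thesis using 0 by simp
      next
        case (Suc i)
        have "\<not> x \<le> 2 ^ i" using not_less_Least[of i "\<lambda>j. x \<le> 2 ^ j"] Suc by (simp add: j_def)
        moreover have "d * 2 ^ i \<le> 1 * 2 ^ i" using d by (intro mult_right_mono) auto
        ultimately have "d * 2 ^ i \<le> x" by linarith
        hence "(d * 2 ^ i)\<^sup>2 \<le> x\<^sup>2" using d by (intro power_mono) auto
        also have "(d * 2 ^ i)\<^sup>2 = d\<^sup>2 * (2 ^ i * 2 ^ i)" by (simp add: power2_eq_square)
        also have "(2::real) ^ i * 2 ^ i = 4 ^ i" by (simp flip: power_mult_distrib)
        finally have "1 / x\<^sup>2 \<le> 1 / (d\<^sup>2 * 4 ^ i)" using d x0 by (intro divide_left_mono) auto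
        thus ?thesis using Suc by simp
      qed
      also have "\<dots> = 4 / (d\<^sup>2 * 4 ^ j) * of_bool (x \<le> 2 ^ j)" using j by simp
      also have "\<dots> \<le> (\<Sum>j\<le>J. 4 / (d\<^sup>2 * 4 ^ j) * of_bool (x \<le> 2 ^ j))"
        using j by (intro member_le_sum[of j "{..J}" "\<lambda>j. 4 / (d\<^sup>2 * 4 ^ j) * of_bool (x \<le> 2 ^ j)"]) auto
      finally show ?thesis by (simp only: x_def)
    qed
    have "(\<Sum>\<rho>\<in>S. real (m \<rho>) / (norm (\<rho> - \<sigma>))\<^sup>2) \<le>
       (\<Sum>\<rho>\<in>S. real (m \<rho>) * (\<Sum>j\<le>J. 4 / (d\<^sup>2 * 4 ^ j) * of_bool (norm (\<rho> - \<sigma>) \<le> 2 ^ j)))"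
      using mult_left_mono[OF pt, of _ "real (m _)"] by (intro sum_mono) fastforce
    also have "\<dots> = (\<Sum>j\<le>J. 4 / (d\<^sup>2 * 4 ^ j) * (\<Sum>\<rho>\<in>S. real (m \<rho>) * of_bool (norm (\<rho> - \<sigma>) \<le> 2 ^ j)))"
      unfolding sum_distrib_left by (subst sum.swap) (simp add: mult_ac)
    also have "\<dots> \<le> (\<Sum>j\<le>J. 4 / (d\<^sup>2 * 4 ^ j) * (2 * C * 2 ^ j * sqrt (2 ^ j)))"
    proof (intro sum_mono mult_left_mono)
      fix j
      have "(\<Sum>\<rho>\<in>S. real (m \<rho>) * of_bool (norm (\<rho> - \<sigma>) \<le> 2 ^ j)) =
          (\<Sum>\<rho>\<in>{\<rho>\<in>S. norm (\<rho> - \<sigma>) \<le> 2 ^ j}. real (m \<rho>))"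
        using S(2) by (intro sum.mono_neutral_cong_right) auto
      also have "\<dots> \<le> (\<Sum>\<rho>\<in>ZR (2 ^ j). real (m \<rho>))"
        using S(1) by (intro sum_mono2 finite_ZR) (auto simp: ZR_def Z_def)
      also have "\<dots> \<le> 2 * C * 2 ^ j * sqrt (2 ^ j)"
        using zero_count[of "2 ^ j"] by simp
      finally show "(\<Sum>\<rho>\<in>S. real (m \<rho>) * of_bool (norm (\<rho> - \<sigma>) \<le> 2 ^ j)) \<le> 2 * C * 2 ^ j * sqrt (2 ^ j)" .
    qed auto
    also have "\<dots> = 8 * C / d\<^sup>2 * (\<Sum>j\<le>J. q ^ j)"
    proof -
      have "4 / (d\<^sup>2 * 4 ^ j) * (2 * C * 2 ^ j * sqrt (2 ^ j)) = 8 * C / d\<^sup>2 * q ^ j" for j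
      proof -
        have "(4::real) ^ j = 2 ^ j * 2 ^ j" by (simp flip: power_mult_distrib)
        thus ?thesis using d by (simp add: q_def power_divide real_sqrt_power field_simps)
      qed
      thus ?thesis by (simp add: sum_distrib_left)
    qed
    also have "\<dots> \<le> K"
    proof -
      have "(\<Sum>j\<le>J. q ^ j) \<le> (\<Sum>j. q ^ j)"
        using q by (intro sum_le_suminf summable_geometric) auto
      also have "\<dots> = 1 / (1 - q)" using q by (intro suminf_geometric) auto
      finally show ?thesis unfolding K_def using C_pos by (intro mult_left_mono) auto
    qed
    finally show ?thesis .
  qed
  thus ?thesis by (intro nonneg_bdd_above_summable_on bdd_aboveI2[of _ _ K]) auto
qed

text \<open>On the disc of radius \<open>R\<close> the zero-free part has a logarithm \<open>h\<close> with \<open>h(\<sigma>) = 0\<close> after normalization,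
  whose real part is below \<open>C R\<^bsup>3/2\<^esup>\<close>. Hence \<open>|h|\<close> is of the same order on half the disc, and \<open>h'\<close> changes
  by \<open>O(R\<^bsup>3/2\<^esup> / R\<^sup>2)\<close> between \<open>\<sigma>\<close> and \<open>z\<close>. The derivative of the remaining product supplies the sum over
  the zeros.\<close>

lemma log_derivative_approx:
  assumes R: "R \<ge> 1" "R \<ge> 4 * norm (z - \<sigma>)" and fz: "f z \<noteq> 0"
  shows "norm (deriv f z / f z - deriv f \<sigma> / f \<sigma> -
           (\<Sum>\<rho>\<in>ZR R. of_nat (m \<rho>) * ((z - \<sigma>) / (\<rho> - \<sigma>)) * (1 / (z - \<rho>))))
         \<le> 64 * C * norm (z - \<sigma>) / sqrt R"
proof -
  let ?sum = "\<Sum>\<rho>\<in>ZR R. of_nat (m \<rho>) * ((z - \<sigma>) / (\<rho> - \<sigma>)) * (1 / (z - \<rho>))"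
  obtain g where g: "g holomorphic_on UNIV"
    "\<And>z. f z = g z * (\<Prod>\<rho>\<in>ZR R. ((z - \<rho>) / (\<sigma> - \<rho>)) ^ m \<rho>)"
    "\<And>z. norm (z - \<sigma>) \<le> R \<Longrightarrow> g z \<noteq> 0" "g \<sigma> = f \<sigma>"
    "\<And>z. norm (z - \<sigma>) \<le> 3 * R \<Longrightarrow>
       2 ^ (\<Sum>\<rho>\<in>ZR R. m \<rho>) * norm (g z) < exp (C * R * sqrt R) * norm (f \<sigma>)"
    by (rule zero_free_part[OF R(1)]) blast
  have inR: "norm (w - \<sigma>) \<le> R" if "w \<in> ball \<sigma> R" for w
    using that by (simp add: dist_norm norm_minus_commute)
  obtain h0 where h0: "h0 holomorphic_on ball \<sigma> R" "\<And>w. w \<in> ball \<sigma> R \<Longrightarrow> exp (h0 w) = g w"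
  proof (rule holomorphic_logarithm_exists[of "ball \<sigma> R" g \<sigma>])
    show "g holomorphic_on ball \<sigma> R" using g(1) holomorphic_on_subset by blast
    show "g x \<noteq> 0" if "x \<in> ball \<sigma> R" for x using g(3) inR[OF that] by blast
  qed (use R in auto)
  define h where "h w = h0 w - h0 \<sigma>" for w
  have h: "h holomorphic_on ball \<sigma> R" "h \<sigma> = 0"
    unfolding h_def by (auto intro!: holomorphic_intros h0)
  have \<sigma>in: "\<sigma> \<in> ball \<sigma> R" and zin: "z \<in> ball \<sigma> R" using R by (auto simp: dist_norm norm_minus_commute)
  have Reh: "Re (h w) < C * R * sqrt R" if "w \<in> ball \<sigma> R" for w
  proof -
    have "1 * norm (g w) \<le> 2 ^ (\<Sum>\<rho>\<in>ZR R. m \<rho>) * norm (g w)"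
      by (intro mult_right_mono) auto
    also have "\<dots> < exp (C * R * sqrt R) * norm (f \<sigma>)"
      using inR[OF that] R by (intro g(5)) auto
    finally have "norm (g w) / norm (g \<sigma>) < exp (C * R * sqrt R)" using nz g(4) by (simp add: divide_less_eq)
    also have "norm (g w) / norm (g \<sigma>) = norm (exp (h w))"
      unfolding h_def exp_diff norm_divide using h0(2)[OF that] h0(2)[OF \<sigma>in] by simp
    also have "norm (exp (h w)) = exp (Re (h w))" by (rule norm_exp_eq_Re)
    finally show ?thesis by simp
  qed
  have Bpos: "C * R * sqrt R > 0" using C_pos R by auto
  have hb: "norm (h w) \<le> 2 * (C * R * sqrt R)" if "norm (w - \<sigma>) \<le> R / 2" for w
    by (rule Borel_Caratheodory[OF h]) (use R Bpos Reh that in auto)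
  have "norm (deriv h z - deriv h \<sigma>) \<le> 32 * (2 * (C * R * sqrt R)) / R\<^sup>2 * norm (z - \<sigma>)"
    by (rule deriv_diff_bound[OF h(1)]) (use R hb in auto)
  also have "\<dots> = 64 * C * norm (z - \<sigma>) / sqrt R"
  proof -
    have "(sqrt R * R) / R\<^sup>2 = 1 / sqrt R"
      using R by (simp add: divide_simps power2_eq_square)
    moreover have "32 * (2 * (C * R * sqrt R)) / R\<^sup>2 * norm (z - \<sigma>) = 64 * C * norm (z - \<sigma>) * ((sqrt R * R) / R\<^sup>2)"
      by simp
    ultimately show ?thesis by simp
  qed
  finally have 1: "norm (deriv h z - deriv h \<sigma>) \<le> 64 * C * norm (z - \<sigma>) / sqrt R" .
  have ld: "deriv f w / f w = deriv h w + (\<Sum>\<rho>\<in>ZR R. of_nat (m \<rho>) / (w - \<rho>))"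
    if w: "w \<in> ball \<sigma> R" "f w \<noteq> 0" for w
  proof -
    define P where "P z = (\<Prod>\<rho>\<in>ZR R. ((z - \<rho>) / (\<sigma> - \<rho>)) ^ m \<rho>)" for z
    define T where "T = (\<Sum>\<rho>\<in>ZR R. of_nat (m \<rho>) / (w - \<rho>))"
    have dP: "(P has_field_derivative P w * T) (at w)"
      unfolding P_def T_def by (rule has_field_derivative_prod_powers[OF finite_ZR]) (use w in \<open>auto simp: ZR_def\<close>)
    have dh: "(h has_field_derivative deriv h w) (at w)"
      by (rule holomorphic_derivI[OF h(1) open_ball w(1)])
    have "((\<lambda>z. g \<sigma> * exp (h z) * P z) has_field_derivative g \<sigma> * exp (h w) * P w * (deriv h w + T)) (at w)"
      by (rule derivative_eq_intros dP dh refl)+ (simp add: algebra_simps)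
    moreover have eq: "g \<sigma> * exp (h x) * P x = f x" if "x \<in> ball \<sigma> R" for x
      using g(2)[of x] g(4) nz h0(2)[OF that] h0(2)[OF \<sigma>in] by (simp add: h_def exp_diff P_def)
    ultimately have "(f has_field_derivative g \<sigma> * exp (h w) * P w * (deriv h w + T)) (at w)"
      by (rule has_field_derivative_transform_within_open[OF _ open_ball w(1)])
    hence "deriv f w = f w * (deriv h w + T)" using eq[OF w(1)] by (simp add: DERIV_imp_deriv)
    thus ?thesis using w(2) by (simp add: T_def)
  qed
  have "deriv f z / f z - deriv f \<sigma> / f \<sigma> -
           ?sum = deriv h z - deriv h \<sigma>"
  proof -
    have "?sum =
        (\<Sum>\<rho>\<in>ZR R. of_nat (m \<rho>) / (z - \<rho>) - of_nat (m \<rho>) / (\<sigma> - \<rho>))"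
    proof (intro sum.cong refl)
      fix \<rho> assume "\<rho> \<in> ZR R"
      hence "\<rho> \<noteq> \<sigma>" "\<rho> \<noteq> z" using fz nz by (auto simp: ZR_def)
      thus "of_nat (m \<rho>) * ((z - \<sigma>) / (\<rho> - \<sigma>)) * (1 / (z - \<rho>)) = of_nat (m \<rho>) / (z - \<rho>) - of_nat (m \<rho>) / (\<sigma> - \<rho>)"
        by (simp add: divide_simps) (simp add: algebra_simps)
    qed
    thus ?thesis unfolding ld[OF zin fz] ld[OF \<sigma>in nz] by (simp add: sum_subtractf)
  qed
  thus ?thesis using 1 by simp
qed

lemma filterlim_ZR: "filterlim ZR (finite_subsets_at_top Z) (at_top :: real filter)"
  unfolding filterlim_finite_subsets_at_top
proof (intro allI impI)
  fix X assume X: "finite X \<and> X \<subseteq> Z"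
  obtain B where B: "\<And>\<rho>. \<rho> \<in> X \<Longrightarrow> norm (\<rho> - \<sigma>) \<le> B"
    using finite_imp_bounded[OF finite_imageI[of X "\<lambda>\<rho>. \<rho> - \<sigma>"]] X by (auto simp: bounded_iff)
  show "\<forall>\<^sub>F R in at_top. finite (ZR R) \<and> X \<subseteq> ZR R \<and> ZR R \<subseteq> Z"
    using eventually_ge_at_top[of B]
    by eventually_elim (use finite_ZR X B in \<open>fastforce simp: ZR_def Z_def\<close>)
qed

text \<open>The limit \<open>R \<rightarrow> \<infinity>\<close> of \<open>log_derivative_approx\<close>. The sum converges absolutely, as the distance of a zero
  from \<open>z\<close> is at least a fixed multiple of its distance from \<open>\<sigma>\<close>.\<close>

theorem log_derivative_expansion:
  assumes fz: "f z \<noteq> 0"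
  shows "(G_term f \<sigma> z has_sum
           (deriv f z / f z - deriv f \<sigma> / f \<sigma>)) Z"
proof -
  let ?t = "\<lambda>\<rho>. of_nat (m \<rho>) * ((z - \<sigma>) / (\<rho> - \<sigma>)) * (1 / (z - \<rho>))"
  let ?D = "deriv f z / f z - deriv f \<sigma> / f \<sigma>"
  obtain d where d: "0 < d" "d \<le> 1" "\<And>\<rho>. f \<rho> = 0 \<Longrightarrow> d \<le> norm (\<rho> - z)"
    using zero_distance[OF fz] by blast
  \<comment> \<open>zeros within \<open>2 |z - \<sigma>|\<close> of \<open>\<sigma>\<close> are at distance at least \<open>d\<close> from \<open>z\<close>, and for all others \<open>c = 1/2\<close> is a valid constant\<close>
  define c where "c = d / (2 * (norm (z - \<sigma>) + 1))"
  have "d \<le> norm (z - \<sigma>) + 1" "norm (z - \<sigma>) + 1 > 0"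
    using d(2) norm_ge_zero[of "z - \<sigma>"] by linarith+
  hence c: "c > 0" "c \<le> 1/2" using d(1) unfolding c_def by (auto simp: divide_simps simp del: norm_ge_zero)
  have far: "c * norm (\<rho> - \<sigma>) \<le> norm (z - \<rho>)" if "f \<rho> = 0" for \<rho>
  proof (cases "norm (\<rho> - \<sigma>) \<le> 2 * norm (z - \<sigma>)")
    case True
    have "c * norm (\<rho> - \<sigma>) \<le> c * (2 * (norm (z - \<sigma>) + 1))" using True c by (intro mult_left_mono) auto
    also have "\<dots> = d" unfolding c_def using norm_ge_zero[of "z - \<sigma>"] by (simp add: add_nonneg_eq_0_iff)
    finally show ?thesis using d(3)[OF that] by (simp add: norm_minus_commute)
  next
    case False
    have "norm (\<rho> - \<sigma>) \<le> norm (z - \<rho>) + norm (z - \<sigma>)"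
      using norm_triangle_ineq4[of "z - \<sigma>" "z - \<rho>"] by simp
    moreover have "c * norm (\<rho> - \<sigma>) \<le> 1/2 * norm (\<rho> - \<sigma>)" using c by (intro mult_right_mono) auto
    ultimately show ?thesis using False by linarith
  qed
  have "(\<lambda>\<rho>. norm (?t \<rho>)) summable_on Z"
  proof (rule Infinite_Sum.abs_summable_on_comparison_test')
    show "(\<lambda>\<rho>. norm (z - \<sigma>) / c * (real (m \<rho>) / (norm (\<rho> - \<sigma>))\<^sup>2)) summable_on Z"
      by (intro summable_on_cmult_right summable_inverse_squares)
    fix \<rho> assume "\<rho> \<in> Z"
    hence r: "f \<rho> = 0" by (simp add: Z_def)
    have pos: "norm (\<rho> - \<sigma>) > 0" using r nz by auto
    have "norm (?t \<rho>) = real (m \<rho>) * (norm (z - \<sigma>) / norm (\<rho> - \<sigma>)) * (1 / norm (z - \<rho>))"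
      by (simp add: norm_mult norm_divide)
    also have "\<dots> \<le> real (m \<rho>) * (norm (z - \<sigma>) / norm (\<rho> - \<sigma>)) * (1 / (c * norm (\<rho> - \<sigma>)))"
    proof -
      have 1: "c * norm (\<rho> - \<sigma>) > 0" using c pos by simp
      hence "norm (z - \<rho>) > 0" using far[OF r] by (rule less_le_trans)
      thus ?thesis using mult_pos_pos[OF _ 1] far[OF r] by (intro mult_left_mono divide_left_mono) auto
    qed
    also have "\<dots> = norm (z - \<sigma>) / c * (real (m \<rho>) / (norm (\<rho> - \<sigma>))\<^sup>2)"
      by (simp add: power2_eq_square field_simps)
    finally show "norm (?t \<rho>) \<le> norm (z - \<sigma>) / c * (real (m \<rho>) / (norm (\<rho> - \<sigma>))\<^sup>2)" .
  qed
  hence "?t summable_on Z" by (rule abs_summable_summable)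
  then obtain S where S: "(?t has_sum S) Z" by (auto simp: summable_on_def)
  hence "((\<lambda>R. sum ?t (ZR R)) \<longlongrightarrow> S) at_top"
    unfolding has_sum_def by (rule filterlim_compose[OF _ filterlim_ZR])
  moreover have "((\<lambda>R. sum ?t (ZR R)) \<longlongrightarrow> ?D) at_top"
  proof (rule Lim_transform2)
    show "((\<lambda>R. ?D) \<longlongrightarrow> ?D) (at_top :: real filter)"
      by simp
    show "((\<lambda>R. ?D - sum ?t (ZR R)) \<longlongrightarrow> 0) at_top"
    proof (rule Lim_null_comparison)
      show "\<forall>\<^sub>F R in at_top. norm (?D - sum ?t (ZR R))
         \<le> 64 * C * norm (z - \<sigma>) / sqrt R"
        using eventually_ge_at_top[of 1] eventually_ge_at_top[of "4 * norm (z - \<sigma>)"]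
        by eventually_elim (rule log_derivative_approx[OF _ _ fz])
      show "((\<lambda>R. 64 * C * norm (z - \<sigma>) / sqrt R) \<longlongrightarrow> 0) at_top"
        by (intro tendsto_divide_0[OF tendsto_const] filterlim_at_top_imp_at_infinity sqrt_at_top)
    qed
  qed
  ultimately have "S = ?D"
    by (rule tendsto_unique[rotated]) simp
  moreover have "(?t has_sum S) Z \<longleftrightarrow>
      (G_term f \<sigma> z has_sum S) Z"
    by (intro has_sum_cong) (simp add: zorder_eq_m Z_def)
  ultimately show ?thesis using S by simp
qed

lemma summable_zorder_squares: "(\<lambda>\<rho>. norm (of_int (zorder f \<rho>) / (\<rho> - \<sigma>)\<^sup>2)) summable_on Z"
proof -
  have "norm (of_int (zorder f \<rho>) / (\<rho> - \<sigma>)\<^sup>2) = real (m \<rho>) / (norm (\<rho> - \<sigma>))\<^sup>2" if "\<rho> \<in> Z" for \<rho>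
    using that by (simp add: zorder_eq_m Z_def norm_divide norm_power)
  thus ?thesis using summable_inverse_squares by (subst summable_on_cong) auto
qed

end

section \<open>The divisor and the discrepancy of the zeta function\<close>

lemma growth_about_half:
  assumes "r \<ge> 1" "norm (z - 1/2) \<le> r"
  shows "norm (zeta_num z) \<le> exp (480 * r * sqrt r)"
proof -
  have "norm z \<le> norm (z - 1/2) + norm (1/2 :: complex)" using norm_triangle_ineq[of "z - 1/2" "1/2"] by simp
  hence "norm z \<le> 2 * r" using assms by simp
  hence "norm (zeta_num z) \<le> exp (120 * (2 * r) * sqrt (2 * r))"
    using assms by (intro zeta_num_growth) auto
  also have "120 * (2 * r) * sqrt (2 * r) \<le> 120 * (2 * r) * sqrt (4 * r)"
    using assms by (intro mult_left_mono real_sqrt_le_mono) auto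
  also have "\<dots> = 480 * r * sqrt r" by (simp add: real_sqrt_mult)
  finally show ?thesis by simp
qed

interpretation zeta: entire_moderate_growth zeta_num "1/2" 480
  by unfold_locales (use zeta_num_holomorphic zeta_num_half_nonzero growth_about_half in auto)

lemma zeta_num_1 [simp]: "zeta_num 1 = 1" by (simp add: zeta_num_def)

lemma riemann_zeta_eq: "s \<noteq> 1 \<Longrightarrow> riemann_zeta s = zeta_num s / (s - 1)"
  by (simp add: zeta_num_def)

lemma riemann_zeta_analytic: "s \<noteq> 1 \<Longrightarrow> riemann_zeta analytic_on {s}"
  using riemann_zeta_spec analytic_at[of riemann_zeta s] by blast

lemma is_pole_riemann_zeta_1: "is_pole riemann_zeta 1"
proof -
  have "is_pole (\<lambda>s. zeta_num s / (s - 1)) 1"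
  proof (rule is_pole_divide)
    show "isCont zeta_num 1"
      using zeta_num_holomorphic holomorphic_on_imp_continuous_on continuous_on_eq_continuous_at by blast
    show "filterlim (\<lambda>s. s - 1) (at 0) (at (1::complex))"
      by (auto simp: filterlim_at eventually_at_filter intro!: tendsto_eq_intros)
  qed auto
  also have "?this \<longleftrightarrow> is_pole riemann_zeta 1"
    by (intro is_pole_cong) (auto simp: eventually_at_filter riemann_zeta_eq)
  finally show ?thesis .
qed

lemma divisor_riemann_zeta: "divisor riemann_zeta = insert 1 zeta.Z"
proof -
  have "isolated_zero riemann_zeta s \<or> is_pole riemann_zeta s \<longleftrightarrow> zeta_num s = 0" if s: "s \<noteq> 1" for s
  proof -
    have ev: "eventually (\<lambda>z. riemann_zeta z \<noteq> 0) (at s)"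
    proof -
      have "eventually (\<lambda>z. zeta_num z \<noteq> 0 \<and> z \<in> UNIV) (at s)"
        by (rule non_zero_neighbour_alt[OF zeta_num_holomorphic, where \<beta> = 1]) auto
      moreover have "eventually (\<lambda>z. z \<noteq> 1) (at s)"
        using eventually_neq_at_within by blast
      ultimately show ?thesis by eventually_elim (auto simp: zeta_num_def)
    qed
    have "\<not> is_pole riemann_zeta s" using analytic_at_imp_no_pole[OF riemann_zeta_analytic[OF s]] .
    thus ?thesis using ev s
      by (simp add: isolated_zero_analytic_iff[OF riemann_zeta_analytic[OF s]] riemann_zeta_eq)
  qed
  hence "s \<in> divisor riemann_zeta \<longleftrightarrow> s \<in> insert 1 zeta.Z" for s
    using is_pole_riemann_zeta_1 by (cases "s = 1") (simp_all add: divisor_def zeta.Z_def)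
  thus ?thesis by blast
qed

lemma one_notin_Z: "1 \<notin> zeta.Z" by (simp add: zeta.Z_def)

lemma zorder_riemann_zeta_1: "zorder riemann_zeta 1 = -1"
  by (rule zorder_eqI[where S = UNIV and g = zeta_num])
     (use zeta_num_holomorphic in \<open>auto simp: riemann_zeta_eq field_simps power_int_minus\<close>)

lemma zorder_riemann_zeta:
  assumes "\<rho> \<in> zeta.Z"
  shows "zorder riemann_zeta \<rho> = zorder zeta_num \<rho>"
proof -
  have \<rho>: "\<rho> \<noteq> 1" "zeta_num \<rho> = 0" using assms by (auto simp: zeta.Z_def)
  define n where "n = zorder zeta_num \<rho>"
  have "\<exists>w\<in>UNIV. zeta_num w \<noteq> 0" using zeta_num_1 by (metis UNIV_I zero_neq_one)
  from zorder_exist_zero[OF zeta_num_holomorphic open_UNIV connected_UNIV UNIV_I this, of \<rho>] \<rho>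
  obtain g r where g: "n > 0" "r > 0" "g holomorphic_on cball \<rho> r"
    "\<And>w. w \<in> cball \<rho> r \<Longrightarrow> zeta_num w = g w * (w - \<rho>) ^ nat n \<and> g w \<noteq> 0"
    unfolding n_def by (metis (no_types, lifting))
  show ?thesis unfolding n_def[symmetric]
  proof (rule zorder_eqI[where S = "ball \<rho> r - {1}" and g = "\<lambda>w. g w / (w - 1)"])
    show "(\<lambda>w. g w / (w - 1)) holomorphic_on ball \<rho> r - {1}"
      by (intro holomorphic_intros holomorphic_on_subset[OF g(3)]) auto
    show "g \<rho> / (\<rho> - 1) \<noteq> 0" using g(2) g(4)[of \<rho>] \<rho> by simp
    show "riemann_zeta w = g w / (w - 1) * (w - \<rho>) powi n" if "w \<in> ball \<rho> r - {1}" "w \<noteq> \<rho>" for w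
      using that g(1) g(4)[of w] by (simp add: riemann_zeta_eq power_int_def)
  qed (use \<rho> g in auto)
qed

lemma logderiv_riemann_zeta:
  assumes "s \<noteq> 1" "zeta_num s \<noteq> 0"
  shows "deriv riemann_zeta s / riemann_zeta s = deriv zeta_num s / zeta_num s - 1 / (s - 1)"
proof -
  have d: "(zeta_num has_field_derivative deriv zeta_num s) (at s)"
    by (rule holomorphic_derivI[OF zeta_num_holomorphic]) auto
  have "((\<lambda>s. zeta_num s / (s - 1)) has_field_derivative (deriv zeta_num s * (s - 1) - zeta_num s) / ((s - 1) * (s - 1))) (at s)"
    using assms by (auto intro!: derivative_eq_intros d)
  hence "(riemann_zeta has_field_derivative (deriv zeta_num s * (s - 1) - zeta_num s) / ((s - 1) * (s - 1))) (at s)"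
    by (rule has_field_derivative_transform_within_open[where S = "- {1}"]) (use assms in \<open>auto simp: riemann_zeta_eq\<close>)
  hence "deriv riemann_zeta s = (deriv zeta_num s * (s - 1) - zeta_num s) / ((s - 1) * (s - 1))"
    by (rule DERIV_imp_deriv)
  moreover have "(d * a - z) / (a * a) / (z / a) = d / z - 1 / a" if "a \<noteq> 0" "z \<noteq> 0" for a d z :: complex
    using that by (simp add: field_simps)
  ultimately show ?thesis using assms by (simp add: riemann_zeta_eq)
qed

text \<open>The pole contributes \<open>-1/(s - 1) - 2\<close>. Its first part turns the logarithmic derivative of \<open>(s - 1) \<zeta>(s)\<close>
  into that of \<open>\<zeta>\<close>, and its second part enters the discrepancy.\<close>

lemma G_fun_has_sum:
  assumes "s \<notin> divisor riemann_zeta"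
  shows "(G_term riemann_zeta (1/2) s has_sum
     (deriv riemann_zeta s / riemann_zeta s - deriv zeta_num (1/2) / zeta_num (1/2) - 2)) (divisor riemann_zeta)"
proof -
  have s: "s \<noteq> 1" "zeta_num s \<noteq> 0" using assms by (auto simp: divisor_riemann_zeta zeta.Z_def)
  let ?t = "G_term riemann_zeta (1/2) s"
  let ?D = "deriv zeta_num s / zeta_num s - deriv zeta_num (1/2) / zeta_num (1/2)"
  have "(?t has_sum ?D) zeta.Z
      \<longleftrightarrow> (G_term zeta_num (1/2) s has_sum
           ?D) zeta.Z"
    by (intro has_sum_cong) (simp add: zorder_riemann_zeta)
  hence "(?t has_sum ?D) zeta.Z"
    using zeta.log_derivative_expansion[OF s(2)] by simp
  from has_sum_insert[OF one_notin_Z this]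
  have "(?t has_sum (?t 1 + ?D)) (divisor riemann_zeta)"
    unfolding divisor_riemann_zeta .
  moreover have "?t 1 = - 1 / (s - 1) - 2"
    using s by (simp add: zorder_riemann_zeta_1 field_simps)
  moreover have "- 1 / (s - 1) - 2 + ?D =
     deriv riemann_zeta s / riemann_zeta s - deriv zeta_num (1/2) / zeta_num (1/2) - 2"
    unfolding logderiv_riemann_zeta[OF s] by simp
  ultimately show ?thesis by metis
qed

lemma G_fun_eq:
  "s \<notin> divisor riemann_zeta \<Longrightarrow> G_fun riemann_zeta (1/2) s =
     deriv riemann_zeta s / riemann_zeta s - deriv zeta_num (1/2) / zeta_num (1/2) - 2"
  unfolding G_fun_def by (rule infsumI[OF G_fun_has_sum])

lemma half_notin_divisor: "1/2 \<notin> divisor riemann_zeta"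
proof -
  have "(1/2 :: complex) \<noteq> 1" by simp
  thus ?thesis using zeta_num_half_nonzero by (simp add: divisor_riemann_zeta zeta.Z_def)
qed

lemma discrepancy_eq:
  "discrepancy_const riemann_zeta (1/2) = - deriv zeta_num (1/2) / zeta_num (1/2) - 2"
  unfolding discrepancy_const_def
proof (rule the_equality)
  show "\<forall>s. s \<notin> divisor riemann_zeta \<longrightarrow>
      G_fun riemann_zeta (1/2) s - deriv riemann_zeta s / riemann_zeta s = - deriv zeta_num (1/2) / zeta_num (1/2) - 2"
    by (simp add: G_fun_eq)
  fix c assume c: "\<forall>s. s \<notin> divisor riemann_zeta \<longrightarrow>
      G_fun riemann_zeta (1/2) s - deriv riemann_zeta s / riemann_zeta s = c"
  obtain s where "s \<notin> divisor riemann_zeta" using half_notin_divisor by blast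
  thus "c = - deriv zeta_num (1/2) / zeta_num (1/2) - 2" using c G_fun_eq[of s] by auto
qed

lemma divisor_sum:
  assumes "s \<notin> divisor riemann_zeta"
  shows "(G_term riemann_zeta (1/2) s has_sum
     (discrepancy_const riemann_zeta (1/2) + deriv riemann_zeta s / riemann_zeta s)) (divisor riemann_zeta)"
  using G_fun_has_sum[OF assms] unfolding discrepancy_eq by (simp add: algebra_simps)

lemma summable_divisor_squares:
  "(\<lambda>\<rho>. norm (of_int (zorder riemann_zeta \<rho>) / (\<rho> - 1/2)\<^sup>2)) summable_on divisor riemann_zeta"
proof -
  have "(\<lambda>\<rho>. norm (of_int (zorder riemann_zeta \<rho>) / (\<rho> - 1/2)\<^sup>2)) summable_on zeta.Z \<longleftrightarrow>
      (\<lambda>\<rho>. norm (of_int (zorder zeta_num \<rho>) / (\<rho> - 1/2)\<^sup>2)) summable_on zeta.Z"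
    by (intro summable_on_cong) (simp add: zorder_riemann_zeta)
  thus ?thesis using zeta.summable_zorder_squares unfolding divisor_riemann_zeta
    by (simp add: summable_on_insert_iff)
qed

lemma dtail_0_nonzero:
  assumes "Re s \<ge> 3"
  shows "dtail 0 s \<noteq> 0"
proof -
  have "norm (dtail 2 s) \<le> 2 powr (1 - Re s)" using norm_dtail_le[of 2 s] assms by simp
  also have "\<dots> \<le> 2 powr (- 2)" using assms by (intro powr_mono) auto
  finally have 1: "norm (dtail 2 s) \<le> 1/4" by (simp add: powr_minus)
  have "norm (of_nat 2 powr (- s)) = 2 powr (- Re s)" using norm_nat_powr[of 2 "- s"] by simp
  also have "\<dots> \<le> 2 powr (- 3)" using assms by (intro powr_mono) auto
  finally have 2: "norm (of_nat 2 powr (- s)) \<le> 1/8" by (simp add: powr_minus)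
  have "{1..2} = {1, 2::nat}" by auto
  hence eq: "dtail 0 s = 1 + of_nat 2 powr (- s) + dtail 2 s"
    using dtail_split[of s 2] assms by simp
  show ?thesis
  proof
    assume "dtail 0 s = 0"
    hence "- 1 = of_nat 2 powr (- s) + dtail 2 s"
      using eq by (simp add: add_eq_0_iff add.assoc)
    hence "norm (- 1 :: complex) \<le> norm (of_nat 2 powr (- s)) + norm (dtail 2 s)"
      using norm_triangle_ineq by metis
    thus False using 1 2 by simp
  qed
qed

text \<open>This bounds the exponential rate of \<open>K\<^sub>2\<close> and shows where its Laplace transform converges. For
  \<open>Re s \<ge> 3\<close> the first term of the Dirichlet series exceeds the sum of all others.\<close>

lemma divisor_Re_le:
  assumes "\<rho> \<in> divisor riemann_zeta"
  shows "Re \<rho> \<le> 3"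
proof (rule ccontr)
  assume "\<not> Re \<rho> \<le> 3"
  hence r: "Re \<rho> > 3" by simp
  hence "\<rho> \<noteq> 1" by auto
  hence "zeta_num \<rho> = 0" using assms by (auto simp: divisor_riemann_zeta zeta.Z_def)
  moreover have "zeta_num \<rho> = (\<rho> - 1) * dtail 0 \<rho>" using r by (intro zeta_num_eq_dtail) auto
  ultimately show False using dtail_0_nonzero[of \<rho>] r \<open>\<rho> \<noteq> 1\<close> by simp
qed

section \<open>The logarithmic derivative as a sum over prime powers\<close>

lemma nat_powr_exp: "n > 0 \<Longrightarrow> (of_nat n :: complex) powr z = exp (z * of_real (ln (real n)))"
  using Ln_of_real[of "real n"] by (simp add: powr_def)

lemma norm_log_term_le:
  assumes "Re s > 3"
  shows "norm (- of_real (ln (real (n + Suc 0))) * of_nat (n + Suc 0) powr (- s)) \<le> real (n + Suc 0) powr (- 2)"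
proof -
  define k where "k = real (n + Suc 0)"
  have k: "k \<ge> 1" by (simp add: k_def)
  have "norm (- of_real (ln (real (n + Suc 0))) * of_nat (n + Suc 0) powr (- s)) = ln k * k powr (- Re s)"
    using k norm_nat_powr[of "n + Suc 0" "- s"] by (simp add: norm_mult k_def)
  also have "\<dots> \<le> k * k powr (- 3)"
    using k assms ln_le_minus_one[of k] by (intro mult_mono powr_mono) auto
  also have "\<dots> = k powr (- 2)" using k powr_add[of k 1 "- 3"] by simp
  finally show ?thesis by (simp add: k_def)
qed

lemma dtail_0_deriv:
  assumes s: "Re s > 3"
  shows "(dtail 0 has_field_derivative (\<Sum>n. - of_real (ln (real (n + Suc 0))) * of_nat (n + Suc 0) powr (- s))) (at s)"
proof -
  let ?f = "\<lambda>n z. of_nat (n + Suc 0) powr (- z) :: complex"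
  let ?f' = "\<lambda>n z. - of_real (ln (real (n + Suc 0))) * of_nat (n + Suc 0) powr (- z) :: complex"
  have "((\<lambda>z. \<Sum>n. ?f n z) has_field_derivative (\<Sum>n. ?f' n s)) (at s)"
  proof (rule has_field_derivative_series'(2)[of "{s. Re s > 3}"])
    show "convex {s. Re s > 3}" by (rule convex_halfspace_Re_gt)
    show "(?f n has_field_derivative ?f' n x) (at x within {s. Re s > 3})" for n x
    proof -
      have "((\<lambda>z. exp (- z * of_real (ln (real (n + Suc 0))))) has_field_derivative
          - of_real (ln (real (n + Suc 0))) * exp (- x * of_real (ln (real (n + Suc 0))))) (at x within {s. Re s > 3})"
        by (auto intro!: derivative_eq_intros)
      thus ?thesis by (simp add: nat_powr_exp del: of_nat_Suc of_nat_add)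
    qed
    show "uniformly_convergent_on {s. Re s > 3} (\<lambda>n x. \<Sum>i<n. ?f' i x)"
    proof (rule Weierstrass_m_test')
      show "norm (?f' n x) \<le> real (n + Suc 0) powr (- 2)" if "x \<in> {s. Re s > 3}" for n x
        using that by (intro norm_log_term_le) auto
    qed (intro summable_shifted_powr, simp)
    show "summable (\<lambda>n. ?f n 4)" by (rule summable_dtail) simp
    show "s \<in> interior {s. 3 < Re s}"
      using s open_halfspace_Re_gt[of 3] by (simp add: interior_open)
  qed auto
  thus ?thesis unfolding dtail_def .
qed

lemma has_sum_positive_nat:
  fixes f :: "nat \<Rightarrow> 'a::banach"
  assumes "summable (\<lambda>n. norm (f (n + Suc 0)))"
  shows "(f has_sum (\<Sum>n. f (n + Suc 0))) {0<..}"
proof -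
  have "((\<lambda>n. f (Suc n)) has_sum (\<Sum>n. f (n + Suc 0))) UNIV"
    using norm_summable_imp_has_sum[OF assms] summable_sums[OF summable_norm_cancel[OF assms]] by simp
  moreover have "bij_betw Suc UNIV {0<..}"
    by (rule bij_betwI[where g = "\<lambda>n. n - 1"]) auto
  ultimately show ?thesis using has_sum_reindex_bij_betw by blast
qed

lemma mangoldt_le_self: "mangoldt n \<le> real n"
proof (cases "n = 0")
  case False
  hence "mangoldt n \<le> ln (real n)" using mangoldt_le[of n] by simp
  also have "\<dots> \<le> real n" using ln_le_minus_one[of "real n"] False by simp
  finally show ?thesis .
qed simp

lemma summable_mangoldt:
  assumes "x > 2"
  shows "(\<lambda>n. mangoldt n * real n powr (- x)) summable_on {0<..}"
proof -
  have "summable (\<lambda>n. norm (mangoldt (n + Suc 0) * real (n + Suc 0) powr (- x)))"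
  proof (rule summable_comparison_test)
    show "summable (\<lambda>n. real (n + Suc 0) powr (- (x - 1)))"
      using assms by (intro summable_shifted_powr) auto
    have "norm (norm (mangoldt (n + Suc 0) * real (n + Suc 0) powr (- x))) \<le> real (n + Suc 0) powr (- (x - 1))" for n
    proof -
      define k where "k = n + Suc 0"
      have k: "k > 0" by (simp add: k_def)
      have "mangoldt k * real k powr (- x) \<le> real k * real k powr (- x)"
        by (intro mult_right_mono mangoldt_le_self) auto
      also have "\<dots> = real k powr (- (x - 1))" using k powr_add[of "real k" 1 "- x"] by simp
      finally show ?thesis using mangoldt_nonneg[of k] unfolding k_def[symmetric] by simp
    qed
    thus "\<exists>N. \<forall>n\<ge>N. norm (norm (mangoldt (n + Suc 0) * real (n + Suc 0) powr (- x))) \<le> real (n + Suc 0) powr (- (x - 1))"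
      by blast
  qed
  from has_sum_positive_nat[OF this] show ?thesis unfolding summable_on_def by blast
qed

text \<open>Since \<open>log n\<close> is the sum of \<open>\<Lambda>(d)\<close> over the divisors of \<open>n\<close>, the series of \<open>-\<zeta>'\<close> is the Dirichlet
  product of the series of \<open>\<zeta>\<close> and \<open>\<Lambda>\<close>. The pairs \<open>(n, d)\<close> with \<open>d\<close> dividing \<open>n\<close> are parametrized by
  \<open>(d, n / d)\<close>.\<close>

theorem logderiv_riemann_zeta_mangoldt:
  assumes s: "Re s > 3"
  shows "((\<lambda>n. mangoldt n * of_nat n powr (- s)) has_sum
           - (deriv riemann_zeta s / riemann_zeta s)) {0<..}"
proof -
  let ?P = "{0<..} :: nat set"
  define A where "A n = mangoldt n * (of_nat n :: complex) powr (- s)" for n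
  define b where "b n = (of_nat n :: complex) powr (- s)" for n
  define \<beta> where "\<beta> = dtail 0 s"
  have nA: "norm (A n) = mangoldt n * real n powr (- Re s)" if "n \<in> ?P" for n
    using that norm_nat_powr[of n "- s"] by (simp add: A_def norm_mult)
  have sA: "(\<lambda>n. norm (A n)) summable_on ?P"
    using summable_mangoldt[of "Re s"] s by (subst summable_on_cong[OF nA]) auto
  define \<alpha> where "\<alpha> = infsum A ?P"
  have hA: "(A has_sum \<alpha>) ?P" unfolding \<alpha>_def by (rule has_sum_infsum[OF abs_summable_summable[OF sA]])
  have hb: "(b has_sum \<beta>) ?P"
    unfolding b_def \<beta>_def dtail_def
    by (rule has_sum_positive_nat[OF summable_norm_dtail]) (use s in auto)
  have sb: "(\<lambda>n. norm (b n)) summable_on ?P"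
    using has_sum_positive_nat[of "\<lambda>n. norm (b n)"] summable_norm_dtail[of s 0] s
    unfolding b_def by (auto simp: summable_on_def)
  have "(\<lambda>(d,m). norm (A d) * norm (b m)) summable_on ?P \<times> ?P"
    by (rule summable_on_product_nonneg[OF sA sb]) auto
  hence "(\<lambda>(d,m). A d * b m) summable_on ?P \<times> ?P"
    by (rule abs_summable_summable[OF iffD1[OF summable_on_cong], rotated])
       (simp add: case_prod_unfold norm_mult)
  hence prod: "((\<lambda>(d,m). A d * b m) has_sum (\<alpha> * \<beta>)) (?P \<times> ?P)"
    by (intro has_sum_SigmaI[where g = "\<lambda>d. A d * \<beta>"])
       (auto intro!: has_sum_cmult_right has_sum_cmult_left hA hb)
  have "((\<lambda>(n,d). mangoldt d * b n) has_sum (\<alpha> * \<beta>)) (Sigma ?P (\<lambda>n. {d. d dvd n})) \<longleftrightarrow>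
        ((\<lambda>(d,m). A d * b m) has_sum (\<alpha> * \<beta>)) (?P \<times> ?P)"
  proof (rule has_sum_reindex_bij_witness[where j = "\<lambda>(n,d). (d, n div d)" and i = "\<lambda>(d,m). (d * m, d)"])
    fix x assume "x \<in> Sigma ?P (\<lambda>n. {d. d dvd n})"
    then obtain n d where x: "x = (n, d)" "n > 0" "d dvd n" by auto
    then obtain m where m: "n = d * m" by (elim dvdE)
    have dm: "d > 0" "m > 0" using x m by auto
    have "ln (real n) = ln (real d) + ln (real m)" using dm by (simp add: m ln_mult)
    hence "b n = of_nat d powr (- s) * b m"
      using nat_powr_exp[of n "- s"] nat_powr_exp[of d "- s"] nat_powr_exp[of m "- s"] dm x(2)
      unfolding b_def by (simp add: exp_add[symmetric] algebra_simps)
    hence "A d * b m = mangoldt d * b n" by (simp add: A_def)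
    thus "(case (case x of (n, d) \<Rightarrow> (d, n div d)) of (d, m) \<Rightarrow> A d * b m) = (case x of (n, d) \<Rightarrow> mangoldt d * b n)"
      using x m dm by simp
  qed (auto elim!: dvdE)
  with prod have "((\<lambda>(n,d). mangoldt d * b n) has_sum (\<alpha> * \<beta>)) (Sigma ?P (\<lambda>n. {d. d dvd n}))" by simp
  hence "((\<lambda>n. of_real (ln (real n)) * b n) has_sum (\<alpha> * \<beta>)) ?P"
  proof (rule has_sum_SigmaD)
    fix n assume n: "n \<in> ?P"
    have "(\<Sum>d | d dvd n. mangoldt d * b n) = of_real (ln (real n)) * b n"
      using mangoldt_sum[of n, where ?'a = complex] n by (simp add: sum_distrib_right[symmetric])
    thus "((\<lambda>d. case (n, d) of (n, d) \<Rightarrow> mangoldt d * b n) has_sum of_real (ln (real n)) * b n) {d. d dvd n}"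
      using n by (intro has_sum_finiteI) auto
  qed
  moreover have "((\<lambda>n. - of_real (ln (real n)) * b n) has_sum deriv (dtail 0) s) ?P"
  proof -
    let ?t = "\<lambda>n. - of_real (ln (real (n + Suc 0))) * b (n + Suc 0)"
    have "summable (\<lambda>n. norm (?t n))"
    proof (rule summable_comparison_test)
      show "summable (\<lambda>n. real (n + Suc 0) powr (- 2))" by (intro summable_shifted_powr) auto
      have "norm (norm (?t n)) \<le> real (n + Suc 0) powr (- 2)" for n
        using norm_log_term_le[OF s, of n] unfolding b_def by simp
      thus "\<exists>N. \<forall>n\<ge>N. norm (norm (?t n)) \<le> real (n + Suc 0) powr (- 2)"
        by blast
    qed
    from has_sum_positive_nat[OF this] show ?thesis
      using DERIV_imp_deriv[OF dtail_0_deriv[OF s]] by (simp add: b_def)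
  qed
  hence "((\<lambda>n. of_real (ln (real n)) * b n) has_sum - deriv (dtail 0) s) ?P"
    using has_sum_cmult_right[of "\<lambda>n. - of_real (ln (real n)) * b n" ?P "deriv (dtail 0) s" "- 1"] by simp
  ultimately have "\<alpha> * \<beta> = - deriv (dtail 0) s" using has_sum_unique by blast
  moreover have "deriv (dtail 0) s = deriv riemann_zeta s"
  proof (rule deriv_cong_ev)
    have "eventually (\<lambda>z. z \<in> {z. Re z > 1}) (nhds s)"
      using s open_halfspace_Re_gt[of 1] by (intro eventually_nhds_in_open) auto
    thus "eventually (\<lambda>z. dtail 0 z = riemann_zeta z) (nhds s)"
      by eventually_elim (simp add: riemann_zeta_eq_dtail)
  qed simp
  moreover have "riemann_zeta s = \<beta>" "\<beta> \<noteq> 0"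
    using riemann_zeta_eq_dtail[of s] dtail_0_nonzero[of s] s by (auto simp: \<beta>_def)
  ultimately have "\<alpha> = - (deriv riemann_zeta s / riemann_zeta s)"
    by (simp add: field_simps)
  thus ?thesis using hA unfolding A_def by simp
qed

section \<open>Laplace transforms on the half-line\<close>

lemma set_integrable_exp_Ici:
  assumes "b > 0"
  shows "set_integrable lborel {c..} (\<lambda>t. exp (- b * t) :: real)"
proof -
  have "(\<lambda>t. exp (- b * t) :: real) absolutely_integrable_on {c..}"
    by (intro nonnegative_absolutely_integrable_1 integrable_on_exp_minus_to_infinity assms) auto
  hence "integrable lebesgue (\<lambda>t. indicator {c..} t *\<^sub>R exp (- b * t) :: real)"
    by (simp add: set_integrable_def)
  thus ?thesis unfolding set_integrable_def by (subst (asm) integrable_completion) auto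
qed

lemma set_integrable_exp_dominated:
  fixes f :: "real \<Rightarrow> 'a::euclidean_space"
  assumes f: "continuous_on {c..} f" and b: "b > 0"
    and bd: "\<And>t. t \<ge> c \<Longrightarrow> norm (f t) \<le> M * exp (- b * t)"
  shows "set_integrable lborel {c..} f"
proof (rule set_integrable_bound)
  show "set_integrable lborel {c..} (\<lambda>t. M * exp (- b * t))"
    using set_integrable_exp_Ici[OF b] by (rule set_integrable_mult_right)
  show "set_borel_measurable lborel {c..} f"
    unfolding set_borel_measurable_def using borel_measurable_continuous_on_indicator[OF _ f] by simp
  have "norm (f t) \<le> norm (M * exp (- b * t))" if "t \<ge> c" for t
    using bd[OF that] by (smt (verit) real_norm_def)
  thus "AE t in lborel. t \<in> {c..} \<longrightarrow> norm (f t) \<le> norm (M * exp (- b * t))" by auto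
qed

lemma integral_FTC_Ici:
  fixes f :: "real \<Rightarrow> 'a::euclidean_space"
  assumes F: "\<And>t. t \<ge> c \<Longrightarrow> (F has_vector_derivative f t) (at t within {c..})"
    and f: "continuous_on {c..} f" "set_integrable lborel {c..} f" and l: "(F \<longlongrightarrow> l) at_top"
  shows "(LINT t:{c..}|lborel. f t) = l - F c"
proof -
  have "((\<lambda>u. LINT t:{c..u}|lborel. f t) \<longlongrightarrow> (LINT t:{c..}|lborel. f t)) at_top"
    by (rule tendsto_set_lebesgue_integral_at_top[OF _ f(2)]) auto
  moreover have "((\<lambda>u. LINT t:{c..u}|lborel. f t) \<longlongrightarrow> l - F c) at_top"
  proof (rule Lim_transform_eventually)
    show "((\<lambda>u. F u - F c) \<longlongrightarrow> l - F c) at_top" by (intro tendsto_intros l)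
    show "\<forall>\<^sub>F u in at_top. F u - F c = (LINT t:{c..u}|lborel. f t)"
      using eventually_ge_at_top[of c]
    proof eventually_elim
      case (elim u)
      show ?case unfolding set_lebesgue_integral_def
        by (rule integral_FTC_atLeastAtMost[symmetric])
           (use elim in \<open>auto intro: has_vector_derivative_within_subset[OF F] continuous_on_subset[OF f(1)]\<close>)
    qed
  qed
  ultimately show ?thesis by (rule tendsto_unique[rotated]) simp
qed

definition laplace :: "(real \<Rightarrow> complex) \<Rightarrow> real \<Rightarrow> complex" where
  "laplace g z = (LINT t:{0..}|lborel. g t * of_real (exp (- z * t)))"

abbreviation laplace_conv :: "(real \<Rightarrow> complex) \<Rightarrow> real \<Rightarrow> bool" where
  "laplace_conv g z \<equiv> set_integrable lborel {0..} (\<lambda>t. g t * of_real (exp (- z * t)))"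

lemma laplace_integrable:
  fixes g :: "real \<Rightarrow> complex"
  assumes "continuous_on {0..} g" "\<And>t. t \<ge> 0 \<Longrightarrow> norm (g t) \<le> M * exp (B * t)" "z > B"
  shows "laplace_conv g z"
proof (rule set_integrable_exp_dominated)
  show "continuous_on {0..} (\<lambda>t. g t * of_real (exp (- z * t)))"
    by (intro continuous_intros assms)
  show "norm (g t * of_real (exp (- z * t))) \<le> M * exp (- (z - B) * t)" if "t \<ge> 0" for t
  proof -
    have "norm (g t * of_real (exp (- z * t))) \<le> M * exp (B * t) * exp (- z * t)"
      using mult_right_mono[OF assms(2)[OF that], of "exp (- z * t)"] by (simp add: norm_mult)
    also have "\<dots> = M * exp (- (z - B) * t)" by (simp add: exp_add[symmetric] algebra_simps)
    finally show ?thesis .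
  qed
qed (use assms in auto)

lemma laplace_exp:
  assumes "z > Re w"
  shows "laplace (\<lambda>t. exp (w * of_real t)) z = 1 / (of_real z - w)"
proof -
  define u where "u = w - of_real z"
  have u: "Re u < 0" "u \<noteq> 0" using assms by (auto simp: u_def complex_eq_iff)
  have eq: "exp (w * of_real t) * of_real (exp (- z * t)) = exp (u * of_real t)" for t
    by (simp add: u_def exp_of_real[symmetric] exp_add[symmetric] algebra_simps)
  have "laplace (\<lambda>t. exp (w * of_real t)) z = (LINT t:{0..}|lborel. exp (u * of_real t))"
    unfolding laplace_def eq ..
  also have "\<dots> = 0 - exp (u * of_real 0) / u"
  proof (rule integral_FTC_Ici[where F = "\<lambda>t. exp (u * of_real t) / u"])
    show "((\<lambda>t. exp (u * of_real t) / u) has_vector_derivative exp (u * of_real t)) (at t within {0..})" for t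
    proof -
      have "((\<lambda>z. exp (u * z) / u) has_field_derivative exp (u * of_real t)) (at (of_real t))"
        using u by (auto intro!: derivative_eq_intros)
      thus ?thesis by (rule has_vector_derivative_real_field)
    qed
    show cont: "continuous_on {0..} (\<lambda>t. exp (u * of_real t))" by (intro continuous_intros)
    show "set_integrable lborel {0..} (\<lambda>t. exp (u * of_real t))"
      by (rule set_integrable_exp_dominated[OF cont, of "- Re u" 1]) (use u in auto)
    have "((\<lambda>t. exp (Re u * t) / norm u) \<longlongrightarrow> 0 / norm u) at_top"
      using u by (intro tendsto_divide tendsto_const filterlim_compose[OF exp_at_bot]
           filterlim_tendsto_neg_mult_at_bot[OF tendsto_const] filterlim_ident) auto
    hence "((\<lambda>t. norm (exp (u * of_real t) / u)) \<longlongrightarrow> 0) at_top"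
      by (simp add: norm_divide)
    thus "((\<lambda>t. exp (u * of_real t) / u) \<longlongrightarrow> 0) at_top"
      by (rule tendsto_norm_zero_cancel)
  qed
  also have "\<dots> = 1 / (of_real z - w)" using u by (simp add: u_def field_simps)
  finally show ?thesis .
qed

lemma laplace_ramp:
  assumes z: "z > 0" and a: "a \<ge> 0"
  shows "laplace (\<lambda>t. of_real (max 0 (t - a))) z = of_real (exp (- z * a) / z\<^sup>2)"
proof -
  define f where "f t = (t - a) * exp (- z * t)" for t
  define F where "F t = - ((t - a) / z + 1 / z\<^sup>2) * exp (- z * t)" for t
  have lin: "t \<le> 2 / z * exp (z / 2 * t)" for t
  proof -
    have "z / 2 * t \<le> exp (z / 2 * t)" using exp_ge_add_one_self[of "z / 2 * t"] by linarith
    hence "2 / z * (z / 2 * t) \<le> 2 / z * exp (z / 2 * t)" using z by (intro mult_left_mono) auto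
    thus ?thesis using z by simp
  qed
  have f_int: "set_integrable lborel {a..} f"
  proof (rule set_integrable_exp_dominated)
    show "continuous_on {a..} f" unfolding f_def by (intro continuous_intros)
    show "norm (f t) \<le> 2 / z * exp (- (z / 2) * t)" if "t \<ge> a" for t
    proof -
      have "norm (f t) = (t - a) * exp (- z * t)" using that by (simp add: f_def)
      also have "\<dots> \<le> (2 / z * exp (z / 2 * t)) * exp (- z * t)"
        using lin[of t] a by (intro mult_right_mono) auto
      also have "\<dots> = 2 / z * exp (- (z / 2) * t)" by (simp add: exp_add[symmetric])
      finally show ?thesis .
    qed
  qed (use z in auto)
  have "(LINT t:{a..}|lborel. f t) = 0 - F a"
  proof (rule integral_FTC_Ici[OF _ _ f_int])
    show "continuous_on {a..} f" unfolding f_def by (intro continuous_intros)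
    show "(F has_vector_derivative f t) (at t within {a..})" for t
    proof -
      have "(F has_real_derivative - (1 / z) * exp (- z * t) + - ((t - a) / z + 1 / z\<^sup>2) * (- z * exp (- z * t))) (at t within {a..})"
        unfolding F_def using z by (auto intro!: derivative_eq_intros simp: field_simps)
      moreover have "- (1 / z) * exp (- z * t) + - ((t - a) / z + 1 / z\<^sup>2) * (- z * exp (- z * t)) = f t"
        using z by (simp add: f_def field_simps power2_eq_square)
      ultimately show ?thesis by (simp add: has_real_derivative_iff_has_vector_derivative)
    qed
    show "(F \<longlongrightarrow> 0) at_top"
    proof (rule Lim_null_comparison)
      show "\<forall>\<^sub>F t in at_top. norm (F t) \<le> (2 / z\<^sup>2 + 1 / z\<^sup>2) * exp (- (z / 2) * t)"
        using eventually_ge_at_top[of a]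
      proof eventually_elim
        case (elim t)
        have "norm (F t) = ((t - a) / z + 1 / z\<^sup>2) * exp (- z * t)"
          unfolding F_def norm_mult norm_minus_cancel using elim z by simp
        also have "\<dots> \<le> ((2 / z * exp (z / 2 * t)) / z + 1 / z\<^sup>2 * exp (z / 2 * t)) * exp (- z * t)"
        proof -
          have "t - a \<le> 2 / z * exp (z / 2 * t)" using lin[of t] a by linarith
          hence "(t - a) / z \<le> (2 / z * exp (z / 2 * t)) / z" using z by (intro divide_right_mono) auto
          moreover have "1 / z\<^sup>2 * 1 \<le> 1 / z\<^sup>2 * exp (z / 2 * t)"
            using elim a z by (intro mult_left_mono) auto
          ultimately show ?thesis by (intro mult_right_mono add_mono) auto
        qed
        also have "\<dots> = (2 / z\<^sup>2 + 1 / z\<^sup>2) * (exp (z / 2 * t) * exp (- z * t))"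
          by (simp add: field_simps power2_eq_square)
        also have "exp (z / 2 * t) * exp (- z * t) = exp (- (z / 2) * t)" by (simp add: exp_add[symmetric])
        finally show ?case .
      qed
      have "((\<lambda>t. (2 / z\<^sup>2 + 1 / z\<^sup>2) * exp (- (z / 2) * t)) \<longlongrightarrow> (2 / z\<^sup>2 + 1 / z\<^sup>2) * 0) at_top"
        using z by (intro tendsto_mult tendsto_const filterlim_compose[OF exp_at_bot]
           filterlim_tendsto_neg_mult_at_bot[OF tendsto_const] filterlim_ident) auto
      thus "((\<lambda>t. (2 / z\<^sup>2 + 1 / z\<^sup>2) * exp (- (z / 2) * t)) \<longlongrightarrow> 0) at_top" by simp
    qed
  qed
  also have "0 - F a = exp (- z * a) / z\<^sup>2" by (simp add: F_def)
  finally have I: "(LINT t:{a..}|lborel. f t) = exp (- z * a) / z\<^sup>2" .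
  have "laplace (\<lambda>t. of_real (max 0 (t - a))) z = (LINT t|lborel. of_real (indicator {a..} t *\<^sub>R f t))"
    unfolding laplace_def set_lebesgue_integral_def
    by (intro Bochner_Integration.integral_cong) (use a in \<open>auto simp: f_def indicator_def max_def\<close>)
  also have "\<dots> = of_real (LINT t:{a..}|lborel. f t)"
    unfolding set_lebesgue_integral_def by (rule integral_complex_of_real)
  finally show ?thesis unfolding I .
qed

text \<open>Series of functions on the half-line with a common exponential rate. The divisor carries no natural
  order, so sums are limits along the finite subsets of the index set. The tails are dominated by one
  numerical tail times \<open>exp(B t)\<close>, so that continuity and Laplace transforms pass to the limit.\<close>

locale dominated_family =
  fixes I :: "'i set" and g :: "'i \<Rightarrow> real \<Rightarrow> complex" and c :: "'i \<Rightarrow> real" and B :: real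
  assumes cont: "\<And>i. i \<in> I \<Longrightarrow> continuous_on {0..} (g i)"
    and bd: "\<And>i t. i \<in> I \<Longrightarrow> t \<ge> 0 \<Longrightarrow> norm (g i t) \<le> c i * exp (B * t)"
    and sc: "c summable_on I"
begin

definition S where "S t = infsum (\<lambda>i. g i t) I"

lemma abs_summable: "t \<ge> 0 \<Longrightarrow> (\<lambda>i. norm (g i t)) summable_on I"
  by (rule Infinite_Sum.abs_summable_on_comparison_test'[OF summable_on_cmult_left[OF sc]]) (rule bd)

lemma pointwise: "t \<ge> 0 \<Longrightarrow> ((\<lambda>i. g i t) has_sum S t) I"
  unfolding S_def by (rule has_sum_infsum[OF abs_summable_summable[OF abs_summable]])

lemma tail_bound:
  assumes X: "finite X" "X \<subseteq> I" and t: "t \<ge> 0"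
  shows "norm (S t - (\<Sum>i\<in>X. g i t)) \<le> (infsum c I - sum c X) * exp (B * t)"
proof -
  have "((\<lambda>i. g i t) has_sum (S t - (\<Sum>i\<in>X. g i t))) (I - X)"
    by (intro has_sum_Diff pointwise t has_sum_finite X)
  moreover have "((\<lambda>i. c i * exp (B * t)) has_sum ((infsum c I - sum c X) * exp (B * t))) (I - X)"
    by (intro has_sum_cmult_left has_sum_Diff has_sum_infsum sc has_sum_finite X)
  ultimately show ?thesis
    by (rule norm_infsum_le) (use bd t in auto)
qed

lemma tail_tendsto: "((\<lambda>X. infsum c I - sum c X) \<longlongrightarrow> 0) (finite_subsets_at_top I)"
proof -
  have "((\<lambda>X. infsum c I - sum c X) \<longlongrightarrow> infsum c I - infsum c I) (finite_subsets_at_top I)"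
    using has_sum_infsum[OF sc] unfolding has_sum_def by (intro tendsto_diff tendsto_const)
  thus ?thesis by simp
qed

lemma norm_S_le: "t \<ge> 0 \<Longrightarrow> norm (S t) \<le> infsum c I * exp (B * t)"
  using tail_bound[of "{}" t] by simp

lemma continuous_S: "continuous_on {0..} S"
proof -
  have ct: "continuous_on {0..T} S" for T
  proof (rule uniform_limit_theorem)
    show "\<forall>\<^sub>F X in finite_subsets_at_top I. continuous_on {0..T} (\<lambda>t. \<Sum>i\<in>X. g i t)"
      using eventually_finite_subsets_at_top_weakI
      by (intro eventually_finite_subsets_at_top_weakI)
         (auto intro!: continuous_on_sum continuous_on_subset[OF cont])
    show "uniform_limit {0..T} (\<lambda>X t. \<Sum>i\<in>X. g i t) S (finite_subsets_at_top I)"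
    proof (rule uniform_limitI)
      fix e :: real assume e: "e > 0"
      define K where "K = exp (\<bar>B\<bar> * T)"
      have "\<forall>\<^sub>F X in finite_subsets_at_top I. dist (infsum c I - sum c X) 0 < e / K"
        by (rule tendstoD[OF tail_tendsto]) (use e in \<open>simp add: K_def\<close>)
      moreover have "\<forall>\<^sub>F X in finite_subsets_at_top I. finite X \<and> X \<subseteq> I"
        by (rule eventually_finite_subsets_at_top_weakI) auto
      ultimately show "\<forall>\<^sub>F X in finite_subsets_at_top I. \<forall>t\<in>{0..T}. dist (\<Sum>i\<in>X. g i t) (S t) < e"
      proof eventually_elim
        case (elim X)
        show ?case
        proof
          fix t assume t: "t \<in> {0..T}"
          have "dist (\<Sum>i\<in>X. g i t) (S t) \<le> (infsum c I - sum c X) * exp (B * t)"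
            using tail_bound[of X t] elim t by (simp add: dist_norm norm_minus_commute)
          also have "\<dots> \<le> \<bar>infsum c I - sum c X\<bar> * K"
          proof -
            have "B * t \<le> \<bar>B\<bar> * T" using t by (intro mult_mono) auto
            thus ?thesis unfolding K_def by (intro mult_mono) auto
          qed
          also have "\<dots> < e" using elim by (simp add: K_def dist_norm field_simps)
          finally show "dist (\<Sum>i\<in>X. g i t) (S t) < e" .
        qed
      qed
    qed
  qed simp
  show ?thesis
    unfolding continuous_on_eq_continuous_within
  proof
    fix t :: real assume t: "t \<in> {0..}"
    have "continuous (at t within {0..t+1}) S" using ct[of "t+1"] t by (auto simp: continuous_on_eq_continuous_within)
    moreover have "at t within {0..t+1} = at t within {0..}"
      by (rule at_within_nhd[of _ "{..<t+1}"]) (use t in auto)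
    ultimately show "continuous (at t within {0..}) S" by simp
  qed
qed

lemma laplace_S:
  assumes z: "z > B"
  shows "((\<lambda>i. laplace (g i) z) has_sum laplace S z) I"
  unfolding has_sum_def
proof (rule Lim_transform2)
  show "((\<lambda>X. laplace S z) \<longlongrightarrow> laplace S z) (finite_subsets_at_top I)" by simp
  define K where "K = (LINT t:{0..}|lborel. exp (- (z - B) * t))"
  show "((\<lambda>X. laplace S z - (\<Sum>i\<in>X. laplace (g i) z)) \<longlongrightarrow> 0) (finite_subsets_at_top I)"
  proof (rule Lim_null_comparison)
    have "((\<lambda>X. (infsum c I - sum c X) * K) \<longlongrightarrow> 0 * K) (finite_subsets_at_top I)"
      by (intro tendsto_mult tail_tendsto tendsto_const)
    thus "((\<lambda>X. (infsum c I - sum c X) * K) \<longlongrightarrow> 0) (finite_subsets_at_top I)" by simp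
    show "\<forall>\<^sub>F X in finite_subsets_at_top I.
       norm (laplace S z - (\<Sum>i\<in>X. laplace (g i) z)) \<le> (infsum c I - sum c X) * K"
    proof (rule eventually_finite_subsets_at_top_weakI)
      fix X assume X: "finite X" "X \<subseteq> I"
      let ?k = "\<lambda>t. complex_of_real (exp (- z * t))"
      let ?P = "\<lambda>t. \<Sum>i\<in>X. g i t * ?k t"
      let ?c = "infsum c I - sum c X"
      have iS: "set_integrable lborel {0..} (\<lambda>t. S t * ?k t)"
        by (rule laplace_integrable[OF continuous_S norm_S_le z])
      have ig: "set_integrable lborel {0..} (\<lambda>t. g i t * ?k t)" if "i \<in> X" for i
        using that X by (intro laplace_integrable[OF cont bd z]) auto
      have "(\<Sum>i\<in>X. laplace (g i) z) = (LINT t:{0..}|lborel. ?P t)"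
        using ig unfolding laplace_def set_lebesgue_integral_def set_integrable_def scaleR_sum_right
        by (subst Bochner_Integration.integral_sum) auto
      moreover have ig': "set_integrable lborel {0..} ?P"
        using ig unfolding set_integrable_def scaleR_sum_right by (intro Bochner_Integration.integrable_sum) auto
      ultimately have "laplace S z - (\<Sum>i\<in>X. laplace (g i) z) =
          (LINT t:{0..}|lborel. S t * ?k t - ?P t)"
        unfolding laplace_def using iS by (subst set_integral_diff(2)) auto
      also have "norm \<dots> \<le> (LINT t:{0..}|lborel. ?c * exp (- (z - B) * t))"
        unfolding set_lebesgue_integral_def
      proof (rule Bochner_Integration.integral_norm_bound_integral)
        show "integrable lborel (\<lambda>t. indicator {0..} t *\<^sub>R
            (S t * ?k t - ?P t))"
          using set_integral_diff(1)[OF iS ig'] unfolding set_integrable_def .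
        show "integrable lborel (\<lambda>t. indicator {0..} t *\<^sub>R (?c * exp (- (z - B) * t)))"
          using set_integrable_mult_right[OF set_integrable_exp_Ici[of "z - B" 0], of "infsum c I - sum c X"] z
          unfolding set_integrable_def by simp
        fix t
        show "norm (indicator {0..} t *\<^sub>R
            (S t * ?k t - ?P t))
           \<le> indicator {0..} t *\<^sub>R (?c * exp (- (z - B) * t))"
        proof (cases "t \<ge> 0")
          case True
          have "S t * ?k t - ?P t =
              (S t - (\<Sum>i\<in>X. g i t)) * ?k t"
            by (simp add: sum_distrib_right left_diff_distrib)
          hence "norm (S t * ?k t - ?P t)
              \<le> ?c * exp (B * t) * exp (- z * t)"
            using tail_bound[OF X True] by (simp add: norm_mult mult_right_mono)
          also have "\<dots> = ?c * exp (- (z - B) * t)"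
            by (simp add: mult.assoc exp_add[symmetric] algebra_simps)
          finally show ?thesis using True by simp
        qed simp
      qed
      also have "\<dots> = ?c * K" unfolding K_def by (rule set_integral_mult_right)
      finally show "norm (laplace S z - (\<Sum>i\<in>X. laplace (g i) z)) \<le> ?c * K" .
    qed
  qed
qed

end

text \<open>Lerch's theorem. For large \<open>N\<close> the function \<open>E(t) = exp(-N t) h(t)\<close> tends to \<open>0\<close>, and thus is a
  continuous function of \<open>x = exp(-t)\<close> on \<open>[0, 1]\<close>, all of whose moments vanish. Approximating it
  uniformly by polynomials in \<open>x\<close> yields \<open>\<integral> E(t)\<^sup>2 exp(-t) dt = 0\<close>.\<close>

lemma laplace_injective_real:
  fixes h :: "real \<Rightarrow> real"
  assumes h: "continuous_on {0..} h" "\<And>t. t \<ge> 0 \<Longrightarrow> \<bar>h t\<bar> \<le> M * exp (B * t)"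
    and zero: "\<And>z. z > B' \<Longrightarrow> (LINT t:{0..}|lborel. h t * exp (- z * t)) = 0" and t: "t \<ge> 0"
  shows "h t = 0"
proof -
  \<comment> \<open>\<open>N > B'\<close> gives vanishing moments, and \<open>N \<ge> B + 1\<close> the decay \<open>|E(t)| \<le> M exp(-t)\<close>\<close>
  define N where "N = max B B' + 1"
  define E where "E t = h t * exp (- N * t)" for t
  have M: "M \<ge> 0" using h(2)[of 0] by simp
  have Ec: "continuous_on {0..} E" unfolding E_def by (intro continuous_intros h)
  have Eb: "\<bar>E t\<bar> \<le> M * exp (- t)" if "t \<ge> 0" for t
  proof -
    have "\<bar>E t\<bar> \<le> M * exp (B * t) * exp (- N * t)"
      unfolding E_def abs_mult using h(2)[OF that] by (intro mult_mono) auto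
    also have "\<dots> = M * exp ((B - N) * t)" by (simp add: exp_add[symmetric] algebra_simps)
    also have "\<dots> \<le> M * exp (- 1 * t)"
    proof -
      have "B - N \<le> - 1" by (simp add: N_def)
      hence "(B - N) * t \<le> - 1 * t" using that by (rule mult_right_mono)
      thus ?thesis using M by (intro mult_left_mono) auto
    qed
    finally show ?thesis by simp
  qed
  define u where "u x = (if x \<le> 0 then 0 else E (- ln x))" for x
  have ue: "u (exp (- t)) = E t" for t by (simp add: u_def)
  have uc: "continuous_on {0..1} u"
    unfolding continuous_on_eq_continuous_within
  proof
    fix x :: real assume x: "x \<in> {0..1}"
    show "continuous (at x within {0..1}) u"
    proof (cases "x = 0")
      case True
      have "((\<lambda>y. u y) \<longlongrightarrow> 0) (at 0 within {0..1})"
      proof (rule Lim_null_comparison)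
        have "norm (u y) \<le> M * y" if "y \<in> {0..1}" for y
          using that Eb[of "- ln y"] by (cases "y = 0") (auto simp: u_def)
        thus "\<forall>\<^sub>F y in at 0 within {0..1}. norm (u y) \<le> M * y"
          by (auto simp: eventually_at_filter)
        show "((\<lambda>y. M * y) \<longlongrightarrow> 0) (at 0 within {0..1})"
          by (auto intro!: tendsto_eq_intros)
      qed
      moreover have "u 0 = 0" by (simp add: u_def)
      ultimately show ?thesis using True by (simp add: continuous_within)
    next
      case False
      hence x: "x \<in> {0<..1}" using x by auto
      have "continuous_on {0<..1} (E \<circ> (\<lambda>x. - ln x))"
        by (intro continuous_on_compose continuous_intros continuous_on_subset[OF Ec]) auto
      hence "continuous_on {0<..1} u"
        by (rule continuous_on_eq) (auto simp: u_def)
      hence "continuous (at x within {0<..1}) u" using x by (auto simp: continuous_on_eq_continuous_within)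
      moreover have "at x within {0<..1} = at x within {0..1}"
        by (rule at_within_nhd[of _ "{0<..}"]) (use x in auto)
      ultimately show ?thesis by simp
    qed
  qed
  have integ: "set_integrable lborel {0..} (\<lambda>t. E t * k t * exp (- t))"
    if k: "continuous_on {0..} k" "\<And>t. t \<ge> 0 \<Longrightarrow> \<bar>k t\<bar> \<le> K" for k :: "real \<Rightarrow> real" and K
  proof (rule set_integrable_exp_dominated)
    show "continuous_on {0..} (\<lambda>t. E t * k t * exp (- t))" by (intro continuous_intros Ec k)
    fix t :: real assume t: "t \<ge> 0"
    have "\<bar>E t\<bar> * \<bar>k t\<bar> * exp (- t) \<le> (M * 1) * K * exp (- t)"
      using Eb[OF t] k(2)[OF t] t M
      by (intro mult_mono order_trans[OF Eb[OF t]] mult_left_mono) auto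
    thus "norm (E t * k t * exp (- t)) \<le> (M * K) * exp (- 1 * t)" by (simp add: abs_mult)
  qed simp
  have mom: "(LINT t:{0..}|lborel. E t * exp (- t) ^ i * exp (- t)) = 0" for i :: nat
  proof -
    have "E t * exp (- t) ^ i * exp (- t) = h t * exp (- (N + real i + 1) * t)" for t
      by (simp add: E_def exp_of_nat_mult[symmetric] exp_add[symmetric] mult.assoc algebra_simps)
    thus ?thesis using zero[of "N + real i + 1"] by (simp add: N_def)
  qed
  define K where "K = (LINT t:{0..}|lborel. exp (- 1 * t :: real))"
  have K: "K \<ge> 0" unfolding K_def set_lebesgue_integral_def by (intro integral_nonneg_AE) auto
  define Q where "Q = (LINT t:{0..}|lborel. E t * E t * exp (- t))"
  let ?f = "\<lambda>t. E t * E t * exp (- t)"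
  have EM: "\<bar>E t\<bar> \<le> M" if "t \<ge> 0" for t
    using Eb[OF that] mult_left_mono[of "exp (- t)" 1 M] M that by simp
  have Qint: "set_integrable lborel {0..} ?f"
    by (rule integ[OF Ec EM])
  have Qsmall: "Q \<le> M * K * e" if e: "e > 0" for e
  proof -
    obtain p where p: "real_polynomial_function p" "\<And>x. x \<in> {0..1} \<Longrightarrow> \<bar>u x - p x\<bar> < e"
      using Stone_Weierstrass_real_polynomial_function[OF _ uc e] by auto
    obtain a n where pa: "p = (\<lambda>x. \<Sum>i\<le>n. a i * x ^ i)"
      using p(1) by (auto simp: real_polynomial_function_iff_sum)
    let ?q = "\<lambda>t. E t * p (exp (- t)) * exp (- t)"
    have near: "\<bar>E t - p (exp (- t))\<bar> \<le> e" if "t \<ge> 0" for t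
      using p(2)[of "exp (- t)"] that by (simp add: ue less_imp_le)
    have pc: "continuous_on {0..} (\<lambda>t. p (exp (- t)))" unfolding pa by (intro continuous_intros)
    have pint: "set_integrable lborel {0..} ?q"
    proof (rule integ[OF pc, of "M + e"])
      show "\<bar>p (exp (- t))\<bar> \<le> M + e" if "t \<ge> 0" for t using near[OF that] EM[OF that] by linarith
    qed
    have p0: "(LINT t:{0..}|lborel. ?q t) = 0"
    proof -
      have eq: "?q t = (\<Sum>i\<le>n. a i * (E t * exp (- t) ^ i * exp (- t)))" for t
        unfolding pa by (simp add: sum_distrib_left sum_distrib_right mult_ac)
      have int: "set_integrable lborel {0..} (\<lambda>t. E t * exp (- t) ^ i * exp (- t))" for i :: nat
        by (rule integ[of _ 1]) (auto intro!: continuous_intros power_le_one)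
      have "(LINT t:{0..}|lborel. ?q t) =
          (\<Sum>i\<le>n. LINT t:{0..}|lborel. a i * (E t * exp (- t) ^ i * exp (- t)))"
        unfolding eq set_lebesgue_integral_def scaleR_sum_right
        using set_integrable_mult_right[OF int] unfolding set_integrable_def
        by (intro Bochner_Integration.integral_sum) auto
      also have "\<dots> = 0" by (simp add: mom)
      finally show ?thesis .
    qed
    have "Q = (LINT t:{0..}|lborel. ?f t - ?q t)"
      unfolding Q_def by (subst set_integral_diff(2)[OF Qint pint]) (simp add: p0)
    also have "\<dots> \<le> (LINT t:{0..}|lborel. (M * e) * exp (- 1 * t))"
    proof (rule set_integral_mono)
      show "set_integrable lborel {0..} (\<lambda>t. ?f t - ?q t)"
        by (rule set_integral_diff(1)[OF Qint pint])
      show "set_integrable lborel {0..} (\<lambda>t. (M * e) * exp (- 1 * t))"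
        by (intro set_integrable_mult_right set_integrable_exp_Ici) auto
      fix t :: real assume "t \<in> {0..}"
      hence t: "t \<ge> 0" by simp
      have "?f t - ?q t = E t * (E t - p (exp (- t))) * exp (- t)"
        by (simp add: algebra_simps)
      also have "\<dots> \<le> \<bar>E t * (E t - p (exp (- t)))\<bar> * exp (- t)" by (intro mult_right_mono) auto
      also have "\<dots> \<le> (M * e) * exp (- t)"
        unfolding abs_mult using EM[OF t] near[OF t] M by (intro mult_right_mono mult_mono) auto
      finally show "?f t - ?q t \<le> (M * e) * exp (- 1 * t)" by simp
    qed
    also have "\<dots> = M * K * e" unfolding K_def by (subst set_integral_mult_right) simp
    finally show ?thesis .
  qed
  have Q0: "Q \<le> 0"
  proof (rule field_le_epsilon)
    fix e :: real assume e: "e > 0"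
    have "Q \<le> M * K * (e / (M * K + 1))" using M K e by (intro Qsmall) (auto intro!: divide_pos_pos add_nonneg_pos)
    also have "\<dots> = e * (M * K / (M * K + 1))" by simp
    also have "\<dots> \<le> e * 1" using M K e by (intro mult_left_mono) (auto simp: divide_le_eq_1 intro!: add_nonneg_pos)
    finally show "Q \<le> 0 + e" by simp
  qed
  define f where "f t = ?f t" for t
  have fc: "continuous_on {0..t+1} f"
    unfolding f_def by (intro continuous_intros continuous_on_subset[OF Ec]) auto
  have f0: "f t \<ge> 0" for t by (simp add: f_def)
  have "(LINT x:{0..t+1}|lborel. f x) \<le> Q"
    unfolding Q_def f_def[symmetric] set_lebesgue_integral_def
  proof (rule integral_mono)
    show "integrable lborel (\<lambda>x. indicator {0..t+1} x *\<^sub>R f x)"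
      using borel_integrable_atLeastAtMost'[OF fc] by (simp add: set_integrable_def)
    show "integrable lborel (\<lambda>x. indicator {0..} x *\<^sub>R f x)"
      using Qint unfolding f_def set_integrable_def .
  qed (auto simp: indicator_def f0)
  moreover have "(LINT x:{0..t+1}|lborel. f x) \<ge> 0"
    unfolding set_lebesgue_integral_def by (intro integral_nonneg_AE) (auto simp: f0)
  ultimately have "(LINT x:{0..t+1}|lborel. f x) = 0" using Q0 by simp
  moreover have "(f has_integral (LINT x:{0..t+1}|lborel. f x)) {0..t+1}"
    using set_borel_integral_eq_integral[OF borel_integrable_atLeastAtMost'[OF fc]]
    by (simp add: has_integral_integral)
  ultimately have "(f has_integral 0) (cbox 0 (t+1))" by simp
  hence "f t = 0"
    by (rule has_integral_0_cbox_imp_0[rotated 2]) (use fc f0 t in auto)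
  thus ?thesis by (simp add: f_def E_def)
qed

lemma laplace_injective:
  assumes h: "continuous_on {0..} h" "\<And>t. t \<ge> 0 \<Longrightarrow> norm (h t) \<le> M * exp (B * t)"
    and zero: "\<And>z. z > B' \<Longrightarrow> laplace h z = 0" and t: "t \<ge> 0"
  shows "h t = 0"
proof -
  have int: "integrable lborel (\<lambda>t. indicator {0..} t *\<^sub>R (h t * of_real (exp (- z * t))))" if "z > B" for z
    using laplace_integrable[OF h that] by (simp add: set_integrable_def)
  have part: "L (h t) = 0" if L: "bounded_linear L" "\<And>w. \<bar>L w\<bar> \<le> norm w" for L :: "complex \<Rightarrow> real"
  proof (rule laplace_injective_real[where h = "\<lambda>t. L (h t)" and B' = "max B B'"])
    show "continuous_on {0..} (\<lambda>t. L (h t))" by (intro bounded_linear.continuous_on[OF L(1)] h)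
    show "\<bar>L (h t)\<bar> \<le> M * exp (B * t)" if "t \<ge> 0" for t
      using L(2) h(2)[OF that] order_trans by blast
    fix z assume z: "z > max B B'"
    have "L (w * of_real r) = L w * r" for w r
      using linear_scale[OF bounded_linear.linear[OF L(1)], of r w] by (simp add: scaleR_conv_of_real mult.commute)
    hence "(LINT t:{0..}|lborel. L (h t) * exp (- z * t)) = L (laplace h z)"
      unfolding laplace_def set_lebesgue_integral_def using int[of z] z L(1)
      by (subst integral_bounded_linear[symmetric]) (auto simp: linear_scale bounded_linear.linear)
    thus "(LINT t:{0..}|lborel. L (h t) * exp (- z * t)) = 0"
      using zero[of z] z linear_0[OF bounded_linear.linear[OF L(1)]] by simp
  qed (rule t)
  show ?thesis
    using part[OF bounded_linear_Re abs_Re_le_cmod] part[OF bounded_linear_Im abs_Im_le_cmod]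
    by (simp add: complex_eq_iff)
qed

section \<open>Zeros against primes on the half-line\<close>

lemma laplace_cmult: "laplace (\<lambda>t. c * g t) z = c * laplace g z"
  unfolding laplace_def mult.assoc by (rule set_integral_mult_right)

lemma laplace_add:
  assumes "laplace_conv f z"
    "laplace_conv g z"
  shows "laplace (\<lambda>t. f t + g t) z = laplace f z + laplace g z"
  unfolding laplace_def distrib_right by (rule set_integral_add(2)[OF assms])

lemma laplace_diff:
  assumes "laplace_conv f z"
    "laplace_conv g z"
  shows "laplace (\<lambda>t. f t - g t) z = laplace f z - laplace g z"
  unfolding laplace_def left_diff_distrib by (rule set_integral_diff(2)[OF assms])

abbreviation zeta_discrepancy :: complex where
  "zeta_discrepancy \<equiv> discrepancy_const riemann_zeta (1/2)"

definition zero_weight :: "complex \<Rightarrow> complex" where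
  "zero_weight \<rho> = of_int (zorder riemann_zeta \<rho>) / (\<rho> - 1/2)\<^sup>2"

definition zero_wave :: "complex \<Rightarrow> real \<Rightarrow> complex" where
  "zero_wave \<rho> t = zero_weight \<rho> * (exp ((\<rho> - 1/2) * of_real t) - 1)"

definition prime_ramp :: "nat \<Rightarrow> real \<Rightarrow> complex" where
  "prime_ramp n t = of_real (mangoldt n * real n powr (- (1/2))) * of_real (max 0 (t - ln (real n)))"

lemma norm_exp_le_exp_4:
  assumes "\<rho> \<in> divisor riemann_zeta" "t \<ge> 0"
  shows "norm (exp ((\<rho> - 1/2) * of_real t)) \<le> exp (4 * t)"
proof -
  have "Re \<rho> - 1/2 \<le> 4" using divisor_Re_le[OF assms(1)] by simp
  hence "(Re \<rho> - 1/2) * t \<le> 4 * t" using assms(2) by (rule mult_right_mono)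
  thus ?thesis by simp
qed

interpretation zeros: dominated_family "divisor riemann_zeta" zero_wave "\<lambda>\<rho>. 2 * norm (zero_weight \<rho>)" 4
proof
  show "continuous_on {0..} (zero_wave \<rho>)" for \<rho>
    unfolding zero_wave_def by (intro continuous_intros)
  show "(\<lambda>\<rho>. 2 * norm (zero_weight \<rho>)) summable_on divisor riemann_zeta"
    using summable_divisor_squares unfolding zero_weight_def by (rule summable_on_cmult_right)
  fix \<rho> and t :: real assume *: "\<rho> \<in> divisor riemann_zeta" "t \<ge> 0"
  have "norm (exp ((\<rho> - 1/2) * of_real t) - 1) \<le> norm (exp ((\<rho> - 1/2) * of_real t)) + norm (1::complex)"
    by (rule norm_triangle_ineq4)
  also have "\<dots> \<le> exp (4 * t) + exp (4 * t)"
    using * by (intro add_mono norm_exp_le_exp_4) auto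
  finally have "norm (zero_wave \<rho> t) \<le> norm (zero_weight \<rho>) * (2 * exp (4 * t))"
    unfolding zero_wave_def norm_mult by (intro mult_left_mono) auto
  thus "norm (zero_wave \<rho> t) \<le> 2 * norm (zero_weight \<rho>) * exp (4 * t)" by simp
qed

interpretation primes: dominated_family "{0<..}" prime_ramp
  "\<lambda>n. mangoldt n * real n powr (- (9/2))" 4
proof
  show "continuous_on {0..} (prime_ramp n)" for n
    unfolding prime_ramp_def by (intro continuous_intros)
  show "(\<lambda>n. mangoldt n * real n powr (- (9/2))) summable_on {0<..}"
    by (rule summable_mangoldt) simp
  fix n :: nat and t :: real assume *: "n \<in> {0<..}" "t \<ge> 0"
  \<comment> \<open>trading growth in \<open>t\<close> for decay in \<open>n\<close> makes the coefficients summable\<close>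
  have "max 0 x \<le> exp (4 * x)" for x :: real
  proof (cases "x \<ge> 0")
    case True
    have "1 + 4 * x \<le> exp (4 * x)" by (rule exp_ge_add_one_self)
    moreover have "max 0 x = x" using True by simp
    ultimately show ?thesis using True by linarith
  qed (simp add: max_def)
  hence "max 0 (t - ln (real n)) \<le> exp (4 * (t - ln (real n)))" .
  also have "\<dots> = real n powr (- 4) * exp (4 * t)"
    using * by (simp add: powr_def exp_add[symmetric] algebra_simps)
  finally have m: "max 0 (t - ln (real n)) \<le> real n powr (- 4) * exp (4 * t)" .
  have "norm (prime_ramp n t) = mangoldt n * real n powr (- (1/2)) * max 0 (t - ln (real n))"
    unfolding prime_ramp_def norm_mult norm_of_real using mangoldt_nonneg[of n] by (simp add: abs_mult)
  also have "\<dots> \<le> mangoldt n * real n powr (- (1/2)) * (real n powr (- 4) * exp (4 * t))"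
    using mangoldt_nonneg[of n] by (intro mult_left_mono m) auto
  also have "\<dots> = mangoldt n * (real n powr (- (1/2)) * real n powr (- 4)) * exp (4 * t)" by simp
  also have "real n powr (- (1/2)) * real n powr (- 4) = real n powr (- (9/2))"
    using * by (simp flip: powr_add)
  finally show "norm (prime_ramp n t) \<le> mangoldt n * real n powr (- (9/2)) * exp (4 * t)" .
qed

lemma far_right_notin_divisor: "z > 4 \<Longrightarrow> of_real z + 1/2 \<notin> divisor riemann_zeta"
  using divisor_Re_le[of "of_real z + 1/2"] by auto

text \<open>With \<open>w = \<rho> - 1/2\<close> and \<open>s = z + 1/2\<close>, the transform \<open>(n\<^sub>\<rho> / w\<^sup>2) (1 / (z - w) - 1 / z)\<close> of a summand
  equals \<open>(1 / z\<^sup>2) n\<^sub>\<rho> (z / w) / (z - w)\<close>, which up to \<open>1 / z\<^sup>2\<close> is the summand of \<open>G\<close> at \<open>s\<close>.\<close>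

lemma laplace_zeros:
  assumes z: "z > 4"
  defines "s \<equiv> of_real z + 1/2"
  shows "laplace zeros.S z =
    (zeta_discrepancy + deriv riemann_zeta s / riemann_zeta s) / of_real (z\<^sup>2)"
proof -
  let ?L = "1 / of_real (z\<^sup>2) * (zeta_discrepancy + deriv riemann_zeta s / riemann_zeta s)"
  let ?t = "\<lambda>\<rho>. 1 / of_real (z\<^sup>2) * (G_term riemann_zeta (1/2) s \<rho>)"
  have "(?t has_sum
     ?L)
     (divisor riemann_zeta)"
    unfolding s_def by (intro has_sum_cmult_right divisor_sum far_right_notin_divisor z)
  also have "?this \<longleftrightarrow> ((\<lambda>\<rho>. laplace (zero_wave \<rho>) z) has_sum
     ?L)
     (divisor riemann_zeta)"
  proof (intro has_sum_cong)
    fix \<rho> assume \<rho>: "\<rho> \<in> divisor riemann_zeta"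
    define w where "w = \<rho> - 1/2"
    have w: "w \<noteq> 0"
    proof
      assume "w = 0"
      hence "\<rho> = 1/2" unfolding w_def by (simp only: eq_iff_diff_eq_0[symmetric])
      thus False using \<rho> half_notin_divisor by metis
    qed
    have Rew: "Re w < z" using divisor_Re_le[OF \<rho>] z by (simp add: w_def)
    have zw: "of_real z \<noteq> w" "z \<noteq> 0" using Rew z by auto
    have b: "norm (exp (w * of_real t)) \<le> 1 * exp (4 * t)" if "t \<ge> 0" for t
      using norm_exp_le_exp_4[OF \<rho> that] by (simp add: w_def)
    have int1: "laplace_conv (\<lambda>t. exp (w * of_real t)) z"
      by (rule laplace_integrable[OF _ b z]) (intro continuous_intros)
    have int2: "laplace_conv (\<lambda>t. exp (0 * complex_of_real t)) z"
      by (rule laplace_integrable[where B = 0 and M = 1]) (use z in \<open>auto intro!: continuous_intros\<close>)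
    have "laplace (zero_wave \<rho>) z = zero_weight \<rho> * laplace (\<lambda>t. exp (w * of_real t) - exp (0 * of_real t)) z"
      unfolding laplace_cmult[symmetric] by (simp add: zero_wave_def[abs_def] w_def)
    also have "\<dots> = zero_weight \<rho> * (1 / (of_real z - w) - 1 / (of_real z - 0))"
    proof -
      have e1: "laplace (\<lambda>t. exp (w * of_real t)) z = 1 / (of_real z - w)" by (rule laplace_exp[OF Rew])
      have e2: "laplace (\<lambda>t. exp (0 * of_real t)) z = 1 / (of_real z - 0)"
        by (rule laplace_exp) (use z in simp)
      show ?thesis unfolding laplace_diff[OF int1 int2] e1 e2 ..
    qed
    also have "\<dots> = 1 / of_real (z\<^sup>2) * (of_int (zorder riemann_zeta \<rho>) * (of_real z / w) * (1 / (of_real z - w)))"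
      using w zw unfolding zero_weight_def w_def[symmetric]
      by (simp add: divide_simps power2_eq_square)
    finally show "?t \<rho>
       = laplace (zero_wave \<rho>) z"
      by (simp add: s_def w_def)
  qed
  finally have "?L
      = laplace zeros.S z"
    using zeros.laplace_S[OF z] by (rule has_sum_unique)
  thus ?thesis by simp
qed

lemma laplace_primes:
  assumes z: "z > 4"
  defines "s \<equiv> of_real z + 1/2"
  shows "laplace primes.S z = - (deriv riemann_zeta s / riemann_zeta s) / of_real (z\<^sup>2)"
proof -
  let ?L = "1 / of_real (z\<^sup>2) * - (deriv riemann_zeta s / riemann_zeta s)"
  have Re: "Re s > 3" using z by (simp add: s_def)
  have "((\<lambda>n. 1 / of_real (z\<^sup>2) * (mangoldt n * of_nat n powr (- s))) has_sum
     ?L) {0<..}"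
    by (intro has_sum_cmult_right logderiv_riemann_zeta_mangoldt Re)
  also have "?this \<longleftrightarrow> ((\<lambda>n. laplace (prime_ramp n) z) has_sum
     ?L) {0<..}"
  proof (intro has_sum_cong)
    fix n :: nat assume n: "n \<in> {0<..}"
    have ln: "ln (real n) \<ge> 0" using n by simp
    have "of_nat n powr (- s) = complex_of_real (exp (- (z + 1/2) * ln (real n)))"
      using n nat_powr_exp[of n "- s"] by (simp add: s_def exp_of_real[symmetric] algebra_simps)
    also have "exp (- (z + 1/2) * ln (real n)) = real n powr (- (1/2)) * exp (- z * ln (real n))"
      using n by (simp add: powr_def exp_add[symmetric] algebra_simps)
    finally have p: "of_nat n powr (- s) = complex_of_real (real n powr (- (1/2)) * exp (- z * ln (real n)))" .
    have "laplace (prime_ramp n) z = of_real (mangoldt n * real n powr (- (1/2))) * of_real (exp (- z * ln (real n)) / z\<^sup>2)"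
      using laplace_ramp[of z "ln (real n)"] z ln unfolding prime_ramp_def[abs_def] laplace_cmult by simp
    thus "1 / of_real (z\<^sup>2) * (mangoldt n * of_nat n powr (- s)) = laplace (prime_ramp n) z"
      unfolding p by simp
  qed
  finally have "?L = laplace primes.S z"
    using primes.laplace_S[OF z] by (rule has_sum_unique)
  thus ?thesis by (simp add: mult.commute)
qed

text \<open>The discrepancy constant is the part of the transform that is left over between \<open>G\<close> and \<open>\<zeta>'/\<zeta>\<close>;
  multiplied by \<open>1 / z\<^sup>2\<close> it is the transform of the ramp \<open>c\<^sub>0 t\<close>.\<close>

theorem zeros_eq_primes:
  assumes "t \<ge> 0"
  shows "zeros.S t = zeta_discrepancy * of_real t - primes.S t"
proof -
  define c0 where "c0 = zeta_discrepancy"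
  define l where "l t = c0 * complex_of_real (max 0 (t - 0))" for t
  have lc: "continuous_on {0..} l" unfolding l_def by (intro continuous_intros)
  have lb: "norm (l t) \<le> norm c0 * exp (4 * t)" if "t \<ge> 0" for t
  proof -
    have "t \<le> exp (4 * t)" using exp_ge_add_one_self[of "4 * t"] that by linarith
    thus ?thesis using that by (simp add: l_def norm_mult mult_left_mono)
  qed
  define h where "h t = zeros.S t - l t + primes.S t" for t
  define M where "M = infsum (\<lambda>\<rho>. 2 * norm (zero_weight \<rho>)) (divisor riemann_zeta) + norm c0 +
    infsum (\<lambda>n. mangoldt n * real n powr (- (9/2))) {0<..}"
  have "h t = 0"
  proof (rule laplace_injective[OF _ _ _ assms])
    show "continuous_on {0..} h"
      unfolding h_def by (intro continuous_intros zeros.continuous_S primes.continuous_S lc)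
    show "norm (h t) \<le> M * exp (4 * t)" if "t \<ge> 0" for t
    proof -
      have "norm (h t) \<le> norm (zeros.S t) + norm (l t) + norm (primes.S t)"
        unfolding h_def by (meson add_right_mono norm_triangle_ineq norm_triangle_ineq4 order_trans)
      thus ?thesis using zeros.norm_S_le[OF that] lb[OF that] primes.norm_S_le[OF that]
        unfolding M_def distrib_right by linarith
    qed
    fix z :: real assume z: "z > 4"
    have i1: "laplace_conv zeros.S z"
      by (rule laplace_integrable[OF zeros.continuous_S zeros.norm_S_le z])
    have i2: "laplace_conv l z"
      by (rule laplace_integrable[OF lc lb z])
    have i3: "laplace_conv primes.S z"
      by (rule laplace_integrable[OF primes.continuous_S primes.norm_S_le z])
    have i12: "laplace_conv (\<lambda>t. zeros.S t - l t) z"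
      using set_integral_diff(1)[OF i1 i2] by (simp add: left_diff_distrib)
    have "laplace l z = c0 / of_real (z\<^sup>2)"
      using laplace_ramp[of z 0] z unfolding l_def[abs_def] laplace_cmult by simp
    moreover have "laplace h z = laplace zeros.S z - laplace l z + laplace primes.S z"
      unfolding h_def[abs_def] by (simp add: laplace_add[OF i12 i3] laplace_diff[OF i1 i2])
    ultimately show "laplace h z = 0"
      unfolding laplace_zeros[OF z] laplace_primes[OF z] by (simp add: c0_def add_divide_distrib)
  qed
  thus ?thesis using assms by (simp add: h_def l_def c0_def algebra_simps)
qed

lemma K2_increment:
  assumes "t \<ge> 0"
  shows "K2 riemann_zeta (1/2) t - K2 riemann_zeta (1/2) 0 = zeros.S t"
proof -
  let ?D = "divisor riemann_zeta"
  have a: "(\<lambda>\<rho>. norm (zero_weight \<rho>)) summable_on ?D"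
    using summable_divisor_squares by (simp add: zero_weight_def)
  have sm: "(\<lambda>\<rho>. zero_weight \<rho> * exp ((\<rho> - 1/2) * of_real t)) summable_on ?D" if "t \<ge> 0" for t
  proof (rule abs_summable_summable, rule Infinite_Sum.abs_summable_on_comparison_test')
    show "(\<lambda>\<rho>. norm (zero_weight \<rho>) * exp (4 * t)) summable_on ?D"
      using a by (rule summable_on_cmult_left)
    show "norm (zero_weight \<rho> * exp ((\<rho> - 1/2) * of_real t)) \<le> norm (zero_weight \<rho>) * exp (4 * t)"
      if "\<rho> \<in> ?D" for \<rho>
      unfolding norm_mult using that \<open>t \<ge> 0\<close> by (intro mult_left_mono norm_exp_le_exp_4) auto
  qed
  have K: "((\<lambda>\<rho>. zero_weight \<rho> * exp ((\<rho> - 1/2) * of_real t)) has_sum K2 riemann_zeta (1/2) t) ?D"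
    if "t \<ge> 0" for t
    using has_sum_infsum[OF sm[OF that]] that by (simp add: K2_def zero_weight_def)
  have "((\<lambda>\<rho>. zero_weight \<rho> * exp ((\<rho> - 1/2) * of_real t) - zero_weight \<rho> * exp ((\<rho> - 1/2) * of_real 0)) has_sum
      (K2 riemann_zeta (1/2) t - K2 riemann_zeta (1/2) 0)) ?D"
    using has_sum_add[OF K[OF assms] has_sum_uminusI[OF K[of 0]]] by simp
  hence "((\<lambda>\<rho>. zero_wave \<rho> t) has_sum (K2 riemann_zeta (1/2) t - K2 riemann_zeta (1/2) 0)) ?D"
    by (simp add: zero_wave_def right_diff_distrib)
  thus ?thesis using zeros.pointwise[OF assms] by (rule has_sum_unique)
qed

section \<open>Test functions\<close>

lemma smooth_has_derivative:
  assumes "smooth \<phi>"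
  shows "((vderiv ^^ n) \<phi> has_vector_derivative (vderiv ^^ Suc n) \<phi> t) (at t)"
  using assms unfolding smooth_def by (simp add: vderiv_def vector_derivative_works[symmetric])

lemma smooth_continuous:
  assumes "smooth \<phi>"
  shows "continuous_on S ((vderiv ^^ n) \<phi>)"
  using smooth_has_derivative[OF assms, of n]
  by (meson continuous_at_imp_continuous_on has_vector_derivative_continuous)

abbreviation vanishes_beyond :: "real \<Rightarrow> (real \<Rightarrow> complex) \<Rightarrow> bool" where
  "vanishes_beyond M \<phi> \<equiv> \<forall>t. \<bar>t\<bar> > M \<longrightarrow> \<phi> t = 0"

lemma test_function_iff:
  "test_function \<phi> \<longleftrightarrow> smooth \<phi> \<and> (\<exists>M. \<forall>t. \<bar>t\<bar> > M \<longrightarrow> \<phi> t = 0)"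
proof -
  have "bounded {t. \<phi> t \<noteq> 0} \<longleftrightarrow> (\<exists>M. \<forall>t. \<bar>t\<bar> > M \<longrightarrow> \<phi> t = 0)"
    by (simp add: bounded_iff flip: not_le) blast
  thus ?thesis by (simp add: test_function_def compact_closure)
qed

lemma vderiv_eq_0_outside:
  assumes "\<And>t. \<bar>t\<bar> > M \<Longrightarrow> \<phi> t = 0" "\<bar>t\<bar> > M"
  shows "vderiv \<phi> t = 0"
proof -
  have op: "open {t. \<bar>t\<bar> > M}" by (intro open_Collect_less continuous_intros)
  have "(\<phi> has_vector_derivative 0) (at t)"
  proof (rule has_vector_derivative_transform_within_open[OF _ op])
    show "((\<lambda>_. 0) has_vector_derivative 0) (at t)" by (rule has_vector_derivative_const)
    show "t \<in> {t. \<bar>t\<bar> > M}" using assms(2) by simp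
    show "0 = \<phi> x" if "x \<in> {t. \<bar>t\<bar> > M}" for x using assms(1)[of x] that by simp
  qed
  thus ?thesis unfolding vderiv_def by (rule vector_derivative_at)
qed

lemma vderiv_iterate_add:
  assumes "smooth \<phi>" "smooth \<psi>"
  shows "(vderiv ^^ n) (\<lambda>t. \<phi> t + \<psi> t) = (\<lambda>t. (vderiv ^^ n) \<phi> t + (vderiv ^^ n) \<psi> t)"
proof (induction n)
  case (Suc n)
  have "vderiv (\<lambda>t. (vderiv ^^ n) \<phi> t + (vderiv ^^ n) \<psi> t) t = (vderiv ^^ Suc n) \<phi> t + (vderiv ^^ Suc n) \<psi> t" for t
    unfolding vderiv_def[of "\<lambda>t. (vderiv ^^ n) \<phi> t + (vderiv ^^ n) \<psi> t"]
    by (intro vector_derivative_at has_vector_derivative_add smooth_has_derivative assms)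
  thus ?case by (auto simp: Suc)
qed simp

lemma vderiv_iterate_cmult:
  assumes "smooth \<phi>"
  shows "(vderiv ^^ n) (\<lambda>t. c * \<phi> t) = (\<lambda>t. c * (vderiv ^^ n) \<phi> t)"
proof (induction n)
  case (Suc n)
  have "vderiv (\<lambda>t. c * (vderiv ^^ n) \<phi> t) t = c * (vderiv ^^ Suc n) \<phi> t" for t
    unfolding vderiv_def[of "\<lambda>t. c * (vderiv ^^ n) \<phi> t"]
    by (intro vector_derivative_at has_vector_derivative_mult_right smooth_has_derivative assms)
  thus ?case by (auto simp: Suc)
qed simp

lemma has_vector_derivative_reflect:
  assumes "(f has_vector_derivative f') (at (- t))"
  shows "((\<lambda>t. f (- t)) has_vector_derivative - f') (at (t::real))"
proof -
  have "(f \<circ> uminus has_vector_derivative (- 1) *\<^sub>R f') (at t)"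
    by (rule vector_diff_chain_at) (auto intro!: derivative_eq_intros assms)
  thus ?thesis by (simp add: o_def)
qed

lemma vderiv_iterate_reflect:
  assumes "smooth \<phi>"
  shows "(vderiv ^^ n) (\<lambda>t. \<phi> (- t)) = (\<lambda>t. (- 1) ^ n * (vderiv ^^ n) \<phi> (- t))"
proof (induction n)
  case (Suc n)
  have "vderiv (\<lambda>t. (- 1) ^ n * (vderiv ^^ n) \<phi> (- t)) t = (- 1) ^ n * - (vderiv ^^ Suc n) \<phi> (- t)" for t
    unfolding vderiv_def[of "\<lambda>t. (- 1) ^ n * (vderiv ^^ n) \<phi> (- t)"]
    by (intro vector_derivative_at has_vector_derivative_mult_right has_vector_derivative_reflect
          smooth_has_derivative assms)
  thus ?case by (auto simp: Suc)
qed simp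

lemma test_function_add:
  assumes "test_function \<phi>" "test_function \<psi>"
  shows "test_function (\<lambda>t. \<phi> t + \<psi> t)"
proof -
  have s: "smooth \<phi>" "smooth \<psi>" using assms by (auto simp: test_function_iff)
  obtain M M' where "vanishes_beyond M \<phi>" "vanishes_beyond M' \<psi>"
    using assms by (auto simp: test_function_iff)
  hence "vanishes_beyond (max M M') (\<lambda>t. \<phi> t + \<psi> t)" by simp
  moreover have "smooth (\<lambda>t. \<phi> t + \<psi> t)"
    unfolding smooth_def vderiv_iterate_add[OF s] using s by (auto simp: smooth_def)
  ultimately show ?thesis unfolding test_function_iff by blast
qed

lemma test_function_cmult:
  assumes "test_function \<phi>"
  shows "test_function (\<lambda>t. c * \<phi> t)"
proof -
  have s: "smooth \<phi>" using assms by (simp add: test_function_iff)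
  hence "smooth (\<lambda>t. c * \<phi> t)"
    unfolding smooth_def vderiv_iterate_cmult[OF s] by (auto simp: smooth_def)
  thus ?thesis using assms by (fastforce simp: test_function_iff)
qed

lemma test_function_reflect:
  assumes "test_function \<phi>"
  shows "test_function (\<lambda>t. \<phi> (- t))"
proof -
  have s: "smooth \<phi>" using assms by (simp add: test_function_iff)
  have "(\<lambda>t. (- 1) ^ n * (vderiv ^^ n) \<phi> (- t)) differentiable (at t)" for n t
    using has_vector_derivative_mult_right[OF has_vector_derivative_reflect[OF smooth_has_derivative[OF s]]]
    by (rule differentiableI_vector)
  hence "smooth (\<lambda>t. \<phi> (- t))" unfolding smooth_def vderiv_iterate_reflect[OF s] by blast
  moreover obtain M where "vanishes_beyond M \<phi>" using assms by (auto simp: test_function_iff)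
  hence "vanishes_beyond M (\<lambda>t. \<phi> (- t))" by simp
  ultimately show ?thesis unfolding test_function_iff by blast
qed

lemma norm_le_SUP_test_function:
  assumes "test_function \<phi>"
  shows "norm (\<phi> t) \<le> (SUP t. norm (\<phi> t))"
proof (rule cSUP_upper)
  have s: "smooth \<phi>" using assms by (simp add: test_function_iff)
  obtain M where M: "vanishes_beyond M \<phi>" using assms by (auto simp: test_function_iff)
  have "compact (\<phi> ` {-M..M})"
    using smooth_continuous[OF s, of _ 0] by (intro compact_continuous_image) auto
  hence "bounded (\<phi> ` {-M..M})" by (rule compact_imp_bounded)
  then obtain B where "\<forall>x\<in>\<phi> ` {-M..M}. norm x \<le> B" unfolding bounded_iff ..
  hence B: "norm (\<phi> t) \<le> B" if "t \<in> {-M..M}" for t using that by (rule bspec[OF _ imageI])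
  have "norm (\<phi> t) \<le> max B 0" for t
  proof (cases "\<bar>t\<bar> > M")
    case False
    hence "t \<in> {-M..M}" by auto
    thus ?thesis using B[of t] by simp
  qed (simp add: M)
  thus "bdd_above (range (\<lambda>t. norm (\<phi> t)))" by (intro bdd_aboveI2)
qed simp

text \<open>An antiderivative of \<open>(t - a) \<phi>''(t)\<close> is \<open>(t - a) \<phi>'(t) - \<phi>(t)\<close>.\<close>

lemma ramp_against_second_derivative:
  assumes \<phi>: "test_function \<phi>" and a: "a \<ge> 0"
  shows "has_bochner_integral lborel
     (\<lambda>t. of_real (max 0 (t - a)) * indicator {0..} t * vderiv (vderiv \<phi>) t) (\<phi> a)"
proof -
  have s: "smooth \<phi>" using \<phi> by (simp add: test_function_iff)
  obtain M0 where M0: "vanishes_beyond M0 \<phi>" using \<phi> by (auto simp: test_function_iff)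
  define M where "M = max a \<bar>M0\<bar> + 1"
  have z0: "\<phi> t = 0" if "\<bar>t\<bar> > M - 1" for t
  proof -
    have "\<bar>t\<bar> > M0" using that unfolding M_def by linarith
    thus ?thesis using M0 by blast
  qed
  have z1: "vderiv \<phi> t = 0" if "\<bar>t\<bar> > M - 1" for t by (rule vderiv_eq_0_outside[OF z0 that])
  have z2: "vderiv (vderiv \<phi>) t = 0" if "\<bar>t\<bar> > M - 1" for t by (rule vderiv_eq_0_outside[OF z1 that])
  have d0: "(\<phi> has_vector_derivative vderiv \<phi> t) (at t)" for t
    using smooth_has_derivative[OF s, of 0 t] by simp
  have d1: "(vderiv \<phi> has_vector_derivative vderiv (vderiv \<phi>) t) (at t)" for t
    using smooth_has_derivative[OF s, of 1 t] by simp
  have c2: "continuous_on S (vderiv (vderiv \<phi>))" for S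
    using smooth_continuous[OF s, of S 2] by (simp add: numeral_2_eq_2)
  define f where "f t = of_real (t - a) * vderiv (vderiv \<phi>) t" for t
  define F where "F t = of_real (t - a) * vderiv \<phi> t - \<phi> t" for t
  have fc: "continuous_on {a..M} f" unfolding f_def by (intro continuous_intros c2)
  have "integrable lborel (\<lambda>t. indicator {a..M} t *\<^sub>R f t)"
    using borel_integrable_atLeastAtMost'[OF fc] by (simp add: set_integrable_def)
  moreover have "integral\<^sup>L lborel (\<lambda>t. indicator {a..M} t *\<^sub>R f t) = F M - F a"
  proof (rule integral_FTC_atLeastAtMost[OF _ _ fc])
    fix t
    have "((\<lambda>t. of_real (t - a)) has_vector_derivative (1::complex)) (at t within {a..M})"
    proof -
      have "((\<lambda>z. z - of_real a) has_field_derivative (1::complex)) (at (of_real t))"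
        by (auto intro!: derivative_eq_intros)
      from has_vector_derivative_real_field[OF this] show ?thesis by simp
    qed
    hence "(F has_vector_derivative (of_real (t - a) * vderiv (vderiv \<phi>) t + 1 * vderiv \<phi> t - vderiv \<phi> t))
       (at t within {a..M})"
      unfolding F_def
      by (intro has_vector_derivative_diff has_vector_derivative_mult has_vector_derivative_at_within[OF d0]
            has_vector_derivative_at_within[OF d1])
    thus "(F has_vector_derivative f t) (at t within {a..M})" by (simp add: f_def)
  qed (simp add: M_def)
  moreover have "F M - F a = \<phi> a"
  proof -
    have "\<bar>M\<bar> > M - 1" by (simp add: M_def)
    thus ?thesis by (simp add: F_def z0 z1)
  qed
  ultimately have "has_bochner_integral lborel (\<lambda>t. indicator {a..M} t *\<^sub>R f t) (\<phi> a)"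
    by (simp add: has_bochner_integral_iff)
  moreover have "indicator {a..M} t *\<^sub>R f t =
      of_real (max 0 (t - a)) * indicator {0..} t * vderiv (vderiv \<phi>) t" for t
  proof (cases "t > M")
    case True
    hence "\<bar>t\<bar> > M - 1" by linarith
    hence "vderiv (vderiv \<phi>) t = 0" by (rule z2)
    thus ?thesis by (simp add: f_def)
  next
    case False
    thus ?thesis using a by (cases "t \<ge> a") (auto simp: f_def max_def)
  qed
  ultimately show ?thesis by simp
qed

section \<open>The explicit formula as an identity of distributions\<close>

definition prime_coeff :: "nat \<Rightarrow> complex" where
  "prime_coeff n = of_real (mangoldt n * real n powr (- (1/2)))"

text \<open>The integers whose ramps or point masses meet the interval \<open>[0, R]\<close>.\<close>

definition log_upto :: "real \<Rightarrow> nat set" where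
  "log_upto R = {n. n > 0 \<and> ln (real n) \<le> R}"

lemma finite_log_upto: "finite (log_upto R)"
proof (rule finite_subset)
  show "log_upto R \<subseteq> {..nat \<lceil>exp R\<rceil>}"
  proof
    fix n assume "n \<in> log_upto R"
    hence n: "n > 0" "ln (real n) \<le> R" by (auto simp: log_upto_def)
    hence "real n \<le> exp R" by (metis exp_le_cancel_iff exp_ln of_nat_0_less_iff)
    thus "n \<in> {..nat \<lceil>exp R\<rceil>}" by simp linarith
  qed
qed simp

lemma primes_S_finite:
  assumes "0 \<le> t" "t \<le> R"
  shows "primes.S t = (\<Sum>n\<in>log_upto R. prime_coeff n * of_real (max 0 (t - ln (real n))))"
proof -
  have "((\<lambda>n. prime_ramp n t) has_sum (\<Sum>n\<in>log_upto R. prime_ramp n t)) {0<..}"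
    by (rule has_sum_finite_neutralI[OF finite_log_upto])
       (use assms in \<open>auto simp: log_upto_def prime_ramp_def\<close>)
  with primes.pointwise[OF assms(1)] have "primes.S t = (\<Sum>n\<in>log_upto R. prime_ramp n t)"
    by (rule has_sum_unique)
  thus ?thesis by (simp add: prime_ramp_def prime_coeff_def)
qed

text \<open>On the support of \<open>\<phi>\<close> only finitely many ramps are present, so the integral is taken term by term.\<close>

lemma pairing_half_line:
  assumes \<phi>: "test_function \<phi>" and M: "vanishes_beyond M \<phi>"
  shows "(LINT t|lborel. (K2 riemann_zeta (1/2) t - K2 riemann_zeta (1/2) 0) * indicator {0..} t * vderiv (vderiv \<phi>) t)
     = zeta_discrepancy * \<phi> 0 - (\<Sum>n\<in>log_upto M. prime_coeff n * \<phi> (ln (real n)))"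
proof -
  define c0 where "c0 = zeta_discrepancy"
  define r where "r a t = of_real (max 0 (t - a)) * indicator {0..} t * vderiv (vderiv \<phi>) t" for a t
  have z1: "vderiv \<phi> t = 0" if "\<bar>t\<bar> > M" for t by (rule vderiv_eq_0_outside[OF M[rule_format] that])
  have z2: "vderiv (vderiv \<phi>) t = 0" if "\<bar>t\<bar> > M" for t by (rule vderiv_eq_0_outside[OF z1 that])
  have r: "has_bochner_integral lborel (r a) (\<phi> a)" if "a \<ge> 0" for a
    unfolding r_def by (rule ramp_against_second_derivative[OF \<phi> that])
  have "has_bochner_integral lborel (\<lambda>t. c0 * r 0 t - (\<Sum>n\<in>log_upto M. prime_coeff n * r (ln (real n)) t))
     (c0 * \<phi> 0 - (\<Sum>n\<in>log_upto M. prime_coeff n * \<phi> (ln (real n))))"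
    by (intro has_bochner_integral_diff has_bochner_integral_sum has_bochner_integral_mult_right r)
       (auto simp: log_upto_def)
  moreover have "c0 * r 0 t - (\<Sum>n\<in>log_upto M. prime_coeff n * r (ln (real n)) t) =
     (K2 riemann_zeta (1/2) t - K2 riemann_zeta (1/2) 0) * indicator {0..} t * vderiv (vderiv \<phi>) t" for t
  proof (cases "0 \<le> t \<and> t \<le> M")
    case True
    have "K2 riemann_zeta (1/2) t - K2 riemann_zeta (1/2) 0 =
        c0 * of_real t - (\<Sum>n\<in>log_upto M. prime_coeff n * of_real (max 0 (t - ln (real n))))"
      using True by (simp add: K2_increment zeros_eq_primes primes_S_finite[of t M] c0_def)
    thus ?thesis using True
      by (simp add: r_def sum_distrib_right left_diff_distrib mult.assoc)
  next
    case False
    thus ?thesis using z2[of t] by (cases "t \<ge> 0") (auto simp: r_def)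
  qed
  ultimately show ?thesis unfolding c0_def[symmetric] by (simp add: has_bochner_integral_iff)
qed

text \<open>The factors \<open>exp(- t / 2)\<close> and, after reflection, \<open>exp(t / 2)\<close> cancel the factor \<open>exp(\<sigma> t)\<close> of \<open>W\<close>, and
  the signs of the two distributional derivatives cancel.\<close>

lemma divisor_exp_sum_unfold:
  "divisor_exp_sum f \<phi> =
     (LINT t|lborel. (K2 f (1/2) t - K2 f (1/2) 0) * indicator {0..} t * vderiv (vderiv \<phi>) t) +
     (LINT t|lborel. (K2 f (1/2) t - K2 f (1/2) 0) * indicator {0..} t * vderiv (vderiv (\<lambda>t. \<phi> (- t))) t)"
proof -
  have 1: "(\<lambda>t. exp (1/2 * complex_of_real t) * (exp (- complex_of_real t / 2) * \<phi> t)) = \<phi>"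
    by (simp add: fun_eq_iff mult.assoc[symmetric] exp_add[symmetric])
  have 2: "(\<lambda>t. exp (1/2 * complex_of_real t) * (exp (complex_of_real (- t) / 2) * \<phi> (- t))) = (\<lambda>t. \<phi> (- t))"
    by (simp add: fun_eq_iff mult.assoc[symmetric] exp_add[symmetric])
  show ?thesis
    unfolding divisor_exp_sum_def W_dist_def dist_mult_def dist_reflect_def dist_deriv_def dist_of_fun_def 1 2
    by simp
qed

text \<open>A prime power determines its prime and its exponent, so the double sum is a sum of \<open>\<Lambda>(n)\<close>; only the \<open>n\<close>
  with \<open>log n \<le> M\<close> are seen by \<open>\<phi>\<close>.\<close>

lemma prime_power_sum:
  assumes M: "vanishes_beyond M \<phi>"
  shows "((\<lambda>(p, k). complex_of_real (ln (real p) * real p powr (- real k / 2))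
            * (dirac (real k * ln (real p)) \<phi> + dirac (- (real k * ln (real p))) \<phi>))
     has_sum (\<Sum>n\<in>log_upto M. prime_coeff n * (\<phi> (ln (real n)) + \<phi> (- ln (real n)))))
     ({p::nat. prime p} \<times> {k::nat. k \<ge> 1})" (is "(?g has_sum _) ?I")
proof -
  define h where "h n = prime_coeff n * (\<phi> (ln (real n)) + \<phi> (- ln (real n)))" for n
  have out: "h n = 0" if "n \<notin> log_upto M" "n > 0" for n
  proof -
    have "ln (real n) > M" using that by (simp add: log_upto_def)
    hence "\<bar>ln (real n)\<bar> > M" "\<bar>- ln (real n)\<bar> > M" by auto
    thus ?thesis using M by (simp add: h_def)
  qed
  have "(h has_sum (\<Sum>n\<in>log_upto M. h n)) {0<..}"
    by (rule has_sum_finite_neutralI[OF finite_log_upto]) (use out in \<open>auto simp: log_upto_def\<close>)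
  also have "?this \<longleftrightarrow> (h has_sum (\<Sum>n\<in>log_upto M. h n)) (Collect primepow)"
    by (rule has_sum_cong_neutral) (auto simp: h_def prime_coeff_def mangoldt_def primepow_gt_0_nat)
  also have "\<dots> \<longleftrightarrow> ((\<lambda>x. h ((\<lambda>(p, k). p ^ k) x)) has_sum (\<Sum>n\<in>log_upto M. h n)) ?I"
  proof (rule has_sum_reindex_bij_betw[symmetric])
    have "bij_betw (\<lambda>(p, k). (p, k - 1)) ?I (Collect prime \<times> UNIV)"
      by (rule bij_betwI[where g = "\<lambda>(p, k). (p, Suc k)"]) auto
    from bij_betw_trans[OF this bij_betw_primepows]
    have "bij_betw ((\<lambda>(p, k). p ^ Suc k) \<circ> (\<lambda>(p, k). (p, k - 1)))
       ?I (Collect primepow)" .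
    thus "bij_betw (\<lambda>(p, k). p ^ k) ?I (Collect primepow)"
      by (rule bij_betw_cong[THEN iffD1, rotated]) (auto simp flip: power_Suc)
  qed
  also have "\<dots> \<longleftrightarrow> (?g has_sum (\<Sum>n\<in>log_upto M. h n)) ?I"
  proof (rule has_sum_cong)
    fix x :: "nat \<times> nat" assume "x \<in> ?I"
    then obtain p k where x: "x = (p, k)" "prime p" "k \<ge> 1" by auto
    have p: "real p > 0" using prime_gt_0_nat[OF x(2)] by simp
    have m: "mangoldt (p ^ k) = ln (real p)" using x mangoldt_primepow'[of p k, where ?'a = real] by simp
    have l: "ln (real (p ^ k)) = real k * ln (real p)" using p by (simp add: ln_realpow)
    have w: "real (p ^ k) powr (- (1/2)) = real p powr (- real k / 2)"
      using p by (simp add: powr_realpow[symmetric] powr_powr)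
    show "h ((\<lambda>(p, k). p ^ k) x) = ?g x"
      unfolding x(1) prod.case h_def prime_coeff_def m l w dirac_def ..
  qed
  finally show ?thesis unfolding h_def .
qed

definition prime_side :: functional where
  "prime_side = (\<lambda>\<phi>. 2 * zeta_discrepancy * dirac 0 \<phi>
       - (\<Sum>\<^sub>\<infinity>(p, k)\<in>{p::nat. prime p} \<times> {k::nat. k \<ge> 1}.
            complex_of_real (ln (real p) * real p powr (- real k / 2))
            * (dirac (real k * ln (real p)) \<phi> + dirac (- (real k * ln (real p))) \<phi>)))"

lemma prime_side_finite:
  assumes "vanishes_beyond M \<phi>"
  shows "prime_side \<phi> = 2 * zeta_discrepancy * \<phi> 0
     - (\<Sum>n\<in>log_upto M. prime_coeff n * (\<phi> (ln (real n)) + \<phi> (- ln (real n))))"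
  by (simp only: prime_side_def infsumI[OF prime_power_sum[OF assms]]) (simp only: dirac_def)

lemma divisor_exp_sum_eq_prime_side:
  assumes \<phi>: "test_function \<phi>"
  shows "divisor_exp_sum riemann_zeta \<phi> = prime_side \<phi>"
proof -
  obtain M where M: "vanishes_beyond M \<phi>" using \<phi> by (auto simp: test_function_iff)
  have M': "vanishes_beyond M (\<lambda>t. \<phi> (- t))" using M by simp
  show ?thesis
    unfolding divisor_exp_sum_unfold pairing_half_line[OF \<phi> M]
      pairing_half_line[OF test_function_reflect[OF \<phi>] M'] prime_side_finite[OF M]
    by (simp add: sum.distrib distrib_left)
qed

text \<open>On test functions supported in \<open>[-R, R]\<close> this is a finite combination of point evaluations, so the
  supremum of \<open>\<phi>\<close> itself bounds it.\<close>

lemma distribution_prime_side: "distribution prime_side"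
  unfolding distribution_def
proof (intro conjI allI impI)
  fix \<phi> \<psi> assume *: "test_function \<phi>" "test_function \<psi>"
  obtain M where M: "vanishes_beyond M \<phi>" using *(1) by (auto simp: test_function_iff)
  obtain M' where M': "vanishes_beyond M' \<psi>" using *(2) by (auto simp: test_function_iff)
  define R where "R = max M M'"
  have R: "vanishes_beyond R \<phi>" "vanishes_beyond R \<psi>"
    "vanishes_beyond R (\<lambda>t. \<phi> t + \<psi> t)" using M M' by (auto simp: R_def)
  show "prime_side (\<lambda>t. \<phi> t + \<psi> t) = prime_side \<phi> + prime_side \<psi>"
    unfolding prime_side_finite[OF R(1)] prime_side_finite[OF R(2)] prime_side_finite[OF R(3)]
    by (simp add: algebra_simps sum.distrib)
next
  fix c \<phi> assume *: "test_function \<phi>"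
  obtain M where M: "vanishes_beyond M \<phi>" using * by (auto simp: test_function_iff)
  have M': "vanishes_beyond M (\<lambda>t. c * \<phi> t)" using M by simp
  show "prime_side (\<lambda>t. c * \<phi> t) = c * prime_side \<phi>"
    unfolding prime_side_finite[OF M] prime_side_finite[OF M']
    by (simp add: right_diff_distrib sum_distrib_left algebra_simps)
next
  fix R :: real
  define C where "C = 2 * norm (zeta_discrepancy) + (\<Sum>n\<in>log_upto R. norm (prime_coeff n) * 2)"
  have "norm (prime_side \<phi>) \<le> C * (\<Sum>n\<le>0. SUP t. norm ((vderiv ^^ n) \<phi> t))"
    if \<phi>: "test_function \<phi>" and R: "vanishes_beyond R \<phi>" for \<phi>
  proof -
    define s where "s = (SUP t. norm (\<phi> t))"
    have s: "norm (\<phi> t) \<le> s" for t unfolding s_def by (rule norm_le_SUP_test_function[OF \<phi>])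
    have "norm (prime_side \<phi>) \<le> norm (2 * zeta_discrepancy * \<phi> 0) +
       norm (\<Sum>n\<in>log_upto R. prime_coeff n * (\<phi> (ln (real n)) + \<phi> (- ln (real n))))"
      using R by (subst prime_side_finite[of R]) (auto intro: norm_triangle_ineq4)
    also have "\<dots> \<le> 2 * norm (zeta_discrepancy) * s +
       (\<Sum>n\<in>log_upto R. norm (prime_coeff n) * (2 * s))"
    proof (intro add_mono sum_norm_le)
      show "norm (2 * zeta_discrepancy * \<phi> 0) \<le> 2 * norm (zeta_discrepancy) * s"
        by (simp add: norm_mult mult_left_mono s)
      fix n
      have "norm (\<phi> (ln (real n)) + \<phi> (- ln (real n))) \<le> 2 * s"
        using norm_triangle_ineq[of "\<phi> (ln (real n))" "\<phi> (- ln (real n))"] s[of "ln (real n)"] s[of "- ln (real n)"]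
        by linarith
      thus "norm (prime_coeff n * (\<phi> (ln (real n)) + \<phi> (- ln (real n)))) \<le> norm (prime_coeff n) * (2 * s)"
        unfolding norm_mult by (intro mult_left_mono) auto
    qed
    also have "\<dots> = C * s" by (simp add: C_def algebra_simps sum_distrib_left sum_distrib_right)
    finally show ?thesis by (simp add: s_def)
  qed
  thus "\<exists>C N. \<forall>\<phi>. test_function \<phi> \<longrightarrow> (\<forall>t. \<bar>t\<bar> > R \<longrightarrow> \<phi> t = 0) \<longrightarrow>
        norm (prime_side \<phi>) \<le> C * (\<Sum>n\<le>N. SUP t. norm ((vderiv ^^ n) \<phi> t))"
    by blast
qed

lemma distribution_cong:
  assumes "\<And>\<phi>. test_function \<phi> \<Longrightarrow> S \<phi> = T \<phi>" "distribution T"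
  shows "distribution S"
  using assms test_function_add test_function_cmult unfolding distribution_def by (simp cong: conj_cong)

theorem theorem6p10:
  shows "equal_distributions
    (divisor_exp_sum riemann_zeta)
    (\<lambda>\<phi>. 2 * discrepancy_const riemann_zeta (1/2) * dirac 0 \<phi>
       - (\<Sum>\<^sub>\<infinity>(p, k)\<in>{p::nat. prime p} \<times> {k::nat. k \<ge> 1}.
            complex_of_real (ln (real p) * real p powr (- real k / 2))
            * (dirac (real k * ln (real p)) \<phi> + dirac (- (real k * ln (real p))) \<phi>)))"
  unfolding prime_side_def[symmetric] equal_distributions_def
  using distribution_cong[OF divisor_exp_sum_eq_prime_side distribution_prime_side]
    distribution_prime_side divisor_exp_sum_eq_prime_side by blast

end
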